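(* Let $N=2$, $n\ge1$, $r_0>0$ and $0<\ell_0\le\ell_1$. Let $U=U(r)$, $r=|x|$, be a radial potential on $\mathbb{R}^n$ in $W^{2,\infty}_{\mathrm{loc}}(\mathbb{R}^n)$ such that $$U(r)=\begin{cases}\text{smooth and decreasing, with }U'(r)<0\text{ for }r>0, & r\le\frac12\ell_0,\\ |r-\ell_0|^2, & \frac12\ell_0\le r\le\ell_0,\\ 0, & \ell_0\le r\le\ell_1,\\ |r-\ell_1|^2, & r\ge\ell_1,\end{cases}$$ and $U$ is $C^2$ near the origin as a function on $\mathbb{R}^n$. Let $\phi:\mathbb{R}^n\to[0,\infty)$ be a smooth radial kernel with $\phi(x)>0$ for $|x|<r_0$, $\phi(x)=0$ for $|x|\ge r_0$, such that $\phi'(r)\ge0$ for $r\le\ell_0$ and $\phi'(r)\le0$ for $r\ge\ell_1$. Consider the system $$\dot x_i=v_i,\qquad \dot v_i=\frac12\sum_{j=1}^2\phi(x_i-x_j)(v_j-v_i)-\frac12\sum_{j=1}^2\nabla U(x_i-x_j),\qquad i=1,2,$$ and let $$\mathcal{H}=\{(\mathbf{x}_0,\mathbf{v}_0)\in\mathbb{R}^{2n}\times\mathbb{R}^{2n}:\ |x_1(t)-x_2(t)|\ge r_0\ \ \forall t\ge0\}.$$ Then for Lebesgue-almost every initial datum $(\mathbf{x}_0,\mathbf{v}_0)\in(\mathbb{R}^{2n}\times\mathbb{R}^{2n})\setminus\mathcal{H}$, $$\operatorname{dist}\{|x_1-x_2|,[\ell_0,\ell_1]\}+|v_1-v_2|\to0\quad\text{as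 }t\to\infty.$$ Furthermore, if $r_0>\ell_1$, then for almost every such datum there is a constant $C>0$ (depending on the solution) such that $$\operatorname{dist}\{|x_1-x_2|,[\ell_0,\ell_1]\}+|v_1-v_2|\le\frac{C}{\sqrt{1+t}},\qquad t\ge0.$$ In particular, these results hold for almost every initial datum with $|x_1^0-x_2^0|<r_0$.
   Context: $\mathbf{x}=(x_1,x_2)$, $\mathbf{v}=(v_1,v_2)$ with $x_i,v_i\in\mathbb{R}^n$; $(\mathbf{x}(t),\mathbf{v}(t))$ denotes the solution with initial datum $(\mathbf{x}_0,\mathbf{v}_0)$, and $x_i^0=x_i(0)$. For radial functions, $\phi'$ and $U'$ denote derivatives of the radial profiles with respect to $r=|x|$; $\nabla U(0)=0$. *)

theory Defs
  imports "HOL-Analysis.Analysis"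
begin

text \<open>
  Continuous differentiability of order \<open>k\<close>. Derivatives are taken within \<open>S\<close>, so the notion is
  meant for sets on which such derivatives are unique: open sets, and nondegenerate intervals of
  the real line (with one-sided derivatives at the end points).
\<close>

primrec Ck_on :: "nat \<Rightarrow> 'a::euclidean_space set \<Rightarrow> ('a \<Rightarrow> real) \<Rightarrow> bool" where
  "Ck_on 0 S f \<longleftrightarrow> continuous_on S f"
| "Ck_on (Suc k) S f \<longleftrightarrow>
     f differentiable_on S \<and> (\<forall>b\<in>Basis. Ck_on k S (\<lambda>x. frechet_derivative f (at x within S) b))"

definition smooth_on :: "'a::euclidean_space set \<Rightarrow> ('a \<Rightarrow> real) \<Rightarrow> bool" where
  "smooth_on S f \<longleftrightarrow> (\<forall>k. Ck_on k S f)"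

definition test_function :: "('a::euclidean_space \<Rightarrow> real) \<Rightarrow> bool" where
  "test_function \<psi> \<longleftrightarrow> smooth_on UNIV \<psi> \<and> compact (closure {x. \<psi> x \<noteq> 0})"

definition Linf_loc :: "('a::euclidean_space \<Rightarrow> real) \<Rightarrow> bool" where
  "Linf_loc f \<longleftrightarrow> f \<in> borel_measurable lebesgue \<and>
     (\<forall>K. compact K \<longrightarrow> (\<exists>M. AE x in lebesgue. x \<in> K \<longrightarrow> \<bar>f x\<bar> \<le> M))"

definition weak_partial :: "'a::euclidean_space \<Rightarrow> ('a \<Rightarrow> real) \<Rightarrow> ('a \<Rightarrow> real) \<Rightarrow> bool" where
  "weak_partial b f g \<longleftrightarrow> (\<forall>\<psi>. test_function \<psi> \<longrightarrow>
     (LINT x|lebesgue. f x * frechet_derivative \<psi> (at x) b) = - (LINT x|lebesgue. g x * \<psi> x))"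

text \<open>The local Sobolev spaces \<open>W\<^sup>k\<^sup>,\<^sup>\<infinity>\<close> on the whole space.\<close>

primrec W_inf_loc :: "nat \<Rightarrow> ('a::euclidean_space \<Rightarrow> real) \<Rightarrow> bool" where
  "W_inf_loc 0 f \<longleftrightarrow> Linf_loc f"
| "W_inf_loc (Suc k) f \<longleftrightarrow> Linf_loc f \<and> (\<forall>b\<in>Basis. \<exists>g. weak_partial b f g \<and> W_inf_loc k g)"

definition radial :: "(real \<Rightarrow> real) \<Rightarrow> 'a::real_normed_vector \<Rightarrow> real" where
  "radial f x = f (norm x)"

definition grad :: "('a::real_inner \<Rightarrow> real) \<Rightarrow> 'a \<Rightarrow> 'a" where
  "grad f x = (THE D. GDERIV f x :> D)"

text \<open>
  A state is a pair \<open>(x, v)\<close> with \<open>x = (x\<^sub>1, x\<^sub>2)\<close>, \<open>v = (v\<^sub>1, v\<^sub>2)\<close>. The type \<open>real^'n^2\<close> reads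
  \<open>(real^'n)^2\<close>: two vectors of \<open>\<real>\<^sup>n\<close>, indexed by the two-element type \<open>2\<close> with elements 1 and 2.
\<close>

type_synonym 'n state = "(real^'n^2) \<times> (real^'n^2)"

text \<open>
  Forward solutions; only the values at times \<open>t \<ge> 0\<close> are relevant, and the derivative at
  \<open>t = 0\<close> is one-sided.
\<close>

definition is_solution ::
  "(real^'n \<Rightarrow> real) \<Rightarrow> (real^'n \<Rightarrow> real) \<Rightarrow> (real \<Rightarrow> 'n::finite state) \<Rightarrow> bool" where
  "is_solution \<phi> U z \<longleftrightarrow> (\<forall>t\<ge>0. \<forall>i. let x = fst (z t); v = snd (z t) in
     ((\<lambda>s. fst (z s) $ i) has_vector_derivative v $ i) (at t within {0..}) \<and>
     ((\<lambda>s. snd (z s) $ i) has_vector_derivative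
        (1/2) *\<^sub>R (\<Sum>j\<in>UNIV. \<phi> (x $ i - x $ j) *\<^sub>R (v $ j - v $ i))
        - (1/2) *\<^sub>R (\<Sum>j\<in>UNIV. grad U (x $ i - x $ j))) (at t within {0..}))"

text \<open>The value at time \<open>t \<ge> 0\<close> of the solution with initial datum \<open>z\<^sub>0\<close>.\<close>

definition flow ::
  "(real^'n \<Rightarrow> real) \<Rightarrow> (real^'n \<Rightarrow> real) \<Rightarrow> 'n::finite state \<Rightarrow> real \<Rightarrow> 'n state" where
  "flow \<phi> U z\<^sub>0 t = (THE y. \<exists>z. is_solution \<phi> U z \<and> z 0 = z\<^sub>0 \<and> z t = y)"

definition rel_pos :: "'n::finite state \<Rightarrow> real^'n" where
  "rel_pos z = fst z $ 1 - fst z $ 2"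

definition rel_vel :: "'n::finite state \<Rightarrow> real^'n" where
  "rel_vel z = snd z $ 1 - snd z $ 2"

text \<open>The set \<open>\<H>\<close> of data whose particles never come closer than \<open>r\<^sub>0\<close>.\<close>

definition noninteracting ::
  "(real^'n \<Rightarrow> real) \<Rightarrow> (real^'n \<Rightarrow> real) \<Rightarrow> real \<Rightarrow> 'n::finite state set" where
  "noninteracting \<phi> U r\<^sub>0 = {z\<^sub>0. \<forall>t\<ge>0. norm (rel_pos (flow \<phi> U z\<^sub>0 t)) \<ge> r\<^sub>0}"

definition flocking_defect :: "real \<Rightarrow> real \<Rightarrow> 'n::finite state \<Rightarrow> real" where
  "flocking_defect l\<^sub>0 l\<^sub>1 z = infdist (norm (rel_pos z)) {l\<^sub>0..l\<^sub>1} + norm (rel_vel z)"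

text \<open>
  The potential, in terms of its profile \<open>u\<close>. Being \<open>C\<^sup>2\<close> near the origin is a condition on the
  function \<open>radial u\<close> on \<open>\<real>\<^sup>n\<close>; the remaining regularity of the inner branch is that of the profile
  on \<open>(0, l\<^sub>0/2]\<close>. In particular \<open>grad (radial u) 0 = 0\<close>.
\<close>

definition well_potential :: "'n::finite itself \<Rightarrow> real \<Rightarrow> real \<Rightarrow> (real \<Rightarrow> real) \<Rightarrow> bool" where
  "well_potential TYPE('n) l\<^sub>0 l\<^sub>1 u \<longleftrightarrow>
     W_inf_loc 2 (radial u :: real^'n \<Rightarrow> real) \<and>
     smooth_on {0<..l\<^sub>0/2} u \<and>
     strict_antimono_on {0..l\<^sub>0/2} u \<and>
     (\<forall>r\<in>{0<..l\<^sub>0/2}. vector_derivative u (at r within {0<..l\<^sub>0/2}) < 0) \<and>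
     (\<forall>r\<in>{l\<^sub>0/2..l\<^sub>0}. u r = \<bar>r - l\<^sub>0\<bar>\<^sup>2) \<and>
     (\<forall>r\<in>{l\<^sub>0..l\<^sub>1}. u r = 0) \<and>
     (\<forall>r\<ge>l\<^sub>1. u r = \<bar>r - l\<^sub>1\<bar>\<^sup>2) \<and>
     (\<exists>\<epsilon>>0. Ck_on 2 (ball 0 \<epsilon>) (radial u :: real^'n \<Rightarrow> real))"

text \<open>
  The communication kernel, in terms of its profile \<open>p\<close>, whose values at negative arguments are
  irrelevant.
\<close>

definition comm_kernel ::
  "'n::finite itself \<Rightarrow> real \<Rightarrow> real \<Rightarrow> real \<Rightarrow> (real \<Rightarrow> real) \<Rightarrow> bool" where
  "comm_kernel TYPE('n) r\<^sub>0 l\<^sub>0 l\<^sub>1 p \<longleftrightarrow>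
     smooth_on UNIV (radial p :: real^'n \<Rightarrow> real) \<and>
     (\<forall>x::real^'n. radial p x \<ge> 0) \<and>
     (\<forall>x::real^'n. norm x < r\<^sub>0 \<longrightarrow> radial p x > 0) \<and>
     (\<forall>x::real^'n. norm x \<ge> r\<^sub>0 \<longrightarrow> radial p x = 0) \<and>
     (\<forall>r\<in>{0..l\<^sub>0}. vector_derivative p (at r within {0..}) \<ge> 0) \<and>
     (\<forall>r\<ge>l\<^sub>1. vector_derivative p (at r within {0..}) \<le> 0)"

end

theory Submission
  imports Defs
begin

text \<open>
  The relative motion \<open>x = x\<^sub>1 - x\<^sub>2\<close>, \<open>v = v\<^sub>1 - v\<^sub>2\<close> solves \<open>x' = v\<close>, \<open>v' = - \<phi>(x) v - \<nabla>U(x)\<close>, so the energy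
  \<open>E = |v|\<^sup>2 / 2 + U(x)\<close> decreases to a limit \<open>e\<close>, and the claim is that \<open>e = 0\<close> almost always. On
  \<open>\<omega>\<close>-limit trajectories \<open>\<phi>(x) |v|\<^sup>2 = 0\<close>. If \<open>e > 0\<close>, such a trajectory rests at the origin as soon as it
  enters \<open>|x| < r\<^sub>0\<close>. It cannot stay in \<open>|x| \<ge> r\<^sub>0\<close> either: a trajectory that leaves a radius
  \<open>b < r\<^sub>0\<close> for good keeps \<open>L\<^sup>2 \<le> 2 b\<^sup>2 (E - u(b))\<close> for its angular momentum \<open>L\<close>, and with this bound a
  central motion in the convex outer part of the well must fall back to radius \<open>b\<close>. Hence \<open>e > 0\<close>
  forces \<open>(x, v) \<rightarrow> (0, 0)\<close>, the unstable rest point. The data with this behaviour are null: in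
  dimension at least 2 their angular momentum vanishes, and in dimension 1 they lie on countably many
  orbits. The matching of the slopes of the potential at \<open>l\<^sub>0 / 2\<close>, on which the uniqueness of
  solutions rests, is extracted from \<open>W\<^sup>2\<^sup>,\<^sup>\<infinity>\<close> with the kernel \<open>\<phi>\<close> itself as mollifier.
\<close>

section \<open>Differential inequalities and Lipschitz differential equations\<close>

text \<open>Dissipation acts only where |x| < \<open>r\<^sub>0\<close>, so constancy of the energy
  along a limit trajectory says nothing about motion outside, and the potential alone admits
  circular orbits that last forever. What excludes them is memory: the angular momentum bound
  acquired on leaving a radius b < \<open>r\<^sub>0\<close> survives the passage to the limit, and
  the gap between b and \<open>r\<^sub>0\<close> makes it effective. The maximum of U at the origin
  may be degenerate, so the data attracted to it cannot be read off from a linearisation. Pairs (x,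
  v) of parallel vectors form a family with n + 1 parameters, which is null in dimension 2n only for
  n >= 2. On the line angular momentum carries no information, and trajectories are compared in the
  phase plane instead. \<open>grad\<close> and \<open>flow\<close> are definite descriptions: a jump
  of the slope at \<open>l\<^sub>0 / 2\<close> would leave the gradient there unspecified, and a
  failure of uniqueness would do the same to the flow. Hence the regularity of U is settled before
  any dynamics.\<close>

lemma within_atLeast_eq_within_atLeastAtMost:
  fixes s :: real
  assumes "a \<le> s" "s < b"
  shows "at s within {a..} = at s within {a..b}"
proof -
  have "open {..<b}" "s \<in> {..<b}" "{a..} \<inter> {..<b} - {s} = {a..b} \<inter> {..<b} - {s}"
    using assms by auto
  then show ?thesis
    by (intro at_within_nhd[of s "{..<b}"])
qed

lemma integral_has_vector_derivative_atLeast: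
  fixes F :: "real \<Rightarrow> 'a::banach"
  assumes "continuous_on {a..} F" "a \<le> s"
  shows "((\<lambda>s. integral {a..s} F) has_vector_derivative F s) (at s within {a..})"
proof -
  have "continuous_on {a..s + 1} F"
    using assms(1) by (rule continuous_on_subset) auto
  then have "((\<lambda>s. integral {a..s} F) has_vector_derivative F s) (at s within {a..s + 1})"
    using assms by (intro integral_has_vector_derivative) auto
  then show ?thesis
    using within_atLeast_eq_within_atLeastAtMost[of a s "s + 1"] assms by simp
qed

text \<open>The sign is asked only on the open interval, because some applications start at a last
  time of some kind, where the sign of the derivative itself is unknown.\<close>

lemma nondecreasing_if_deriv_nonneg:
  fixes f :: "real \<Rightarrow> real"
  assumes "\<And>t. t \<ge> a \<Longrightarrow> (f has_real_derivative f' t) (at t within {a..})"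
    and "\<And>t. s < t \<Longrightarrow> t < e \<Longrightarrow> f' t \<ge> 0" and "a \<le> s" "s \<le> e"
  shows "f s \<le> f e"
proof (cases "s = e")
  case False
  then have "s < e" using assms by simp
  moreover have "(f has_derivative (*) (f' t)) (at t within {s..e})" if "s \<le> t" "t \<le> e" for t
  proof -
    have "(f has_real_derivative f' t) (at t within {s..e})"
      by (rule DERIV_subset[OF assms(1)]) (use that assms in auto)
    then show ?thesis by (simp add: has_field_derivative_def)
  qed
  ultimately obtain t where "t \<in> {s<..<e}" "f e - f s = f' t * (e - s)"
    using mvt_simple[of s e f "\<lambda>t. (*) (f' t)"] by auto
  moreover have "f' t * (e - s) \<ge> 0"
    using calculation assms by (intro mult_nonneg_nonneg) auto
  ultimately show ?thesis by simp
qed simp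

lemma nonincreasing_if_deriv_nonpos:
  fixes f :: "real \<Rightarrow> real"
  assumes "\<And>t. t \<ge> a \<Longrightarrow> (f has_real_derivative f' t) (at t within {a..})"
    and "\<And>t. s < t \<Longrightarrow> t < e \<Longrightarrow> f' t \<le> 0" and "a \<le> s" "s \<le> e"
  shows "f e \<le> f s"
proof -
  have "- f s \<le> - f e"
    by (rule nondecreasing_if_deriv_nonneg[of a "\<lambda>t. - f t" "\<lambda>t. - f' t"])
      (use assms DERIV_minus[OF assms(1)] in auto)
  then show ?thesis by simp
qed

lemma constant_if_deriv_zero:
  fixes f :: "real \<Rightarrow> 'a::euclidean_space"
  assumes "\<And>t. t \<ge> a \<Longrightarrow> (f has_vector_derivative 0) (at t within {a..})" "a \<le> s"
  shows "f s = f a"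
proof -
  obtain c where c: "\<And>x. x \<in> {a..} \<Longrightarrow> f x = c"
    by (rule has_vector_derivative_zero_constant[of "{a..}" f]) (simp_all add: assms(1))
  show ?thesis using c[of s] c[of a] assms(2) by simp
qed

text \<open>Picard iteration in a weighted norm: for \<open>g t = exp (- 2 L t) x t\<close> the
  integral operator halves sup-norm distances on the whole half-line, so a single fixed point is
  already a global solution. Freezing time at \<open>max 0 t\<close> lets the operator act on
  bounded continuous functions on the whole line.\<close>

lemma lipschitz_ode_global_solution:
  fixes f :: "'a::euclidean_space \<Rightarrow> 'a"
  assumes "K-lipschitz_on UNIV f"
  obtains x where "x 0 = x\<^sub>0"
    and "\<And>t. t \<ge> 0 \<Longrightarrow> (x has_vector_derivative f (x t)) (at t within {0..})"
proof -
  \<comment> \<open>L >= 1 gives s <= exp (2 L s), which bounds the image of the zero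
    function.\<close>
  define L where "L = max K 1"
  have L: "L \<ge> 1" "L-lipschitz_on UNIV f"
    using assms by (auto simp: L_def intro: lipschitz_on_mono)
  have Lf: "norm (f x - f y) \<le> L * norm (x - y)" for x y
    using lipschitz_on_normD[OF L(2)] by auto
  have fc: "continuous_on S f" for S
    using lipschitz_on_continuous_on[OF L(2)] continuous_on_subset by blast
  define F where "F g s = f (exp (2 * L * s) *\<^sub>R g s)" for g :: "real \<Rightarrow> 'a" and s
  define P where "P g t = exp (- 2 * L * max 0 t) *\<^sub>R (x\<^sub>0 + integral {0..max 0 t} (F g))"
    for g :: "real \<Rightarrow> 'a" and t
  have Fc: "continuous_on S (F g)" if "continuous_on UNIV g" for g S
    unfolding F_def
    by (intro continuous_on_compose2[OF fc[of UNIV]] continuous_intros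
        continuous_on_subset[OF that]) auto
  have Fi: "F g integrable_on {0..s}" if "continuous_on UNIV g" for g s
    by (intro integrable_continuous_interval Fc that)
  have Pc: "continuous_on UNIV (P g)" if "continuous_on UNIV g" for g
  proof -
    have "continuous_on {0..} (\<lambda>s. integral {0..s} (F g))"
      unfolding continuous_on_eq_continuous_within
      by (auto intro!: has_vector_derivative_continuous
          integral_has_vector_derivative_atLeast[OF Fc[OF that]])
    then have "continuous_on UNIV (\<lambda>t. integral {0..max 0 t} (F g))"
      by (rule continuous_on_compose2) (auto intro!: continuous_intros)
    then show ?thesis
      unfolding P_def by (intro continuous_intros)
  qed
  \<comment> \<open>The factor 1/2 is the Lipschitz constant L divided by the rate 2 L of the
    weight.\<close>
  have contr: "norm (P g t - P h t) \<le> d / 2"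
    if "continuous_on UNIV g" "continuous_on UNIV h" "\<And>s. norm (g s - h s) \<le> d" for g h d t
  proof -
    define s where "s = max 0 t"
    have s: "s \<ge> 0" by (simp add: s_def)
    have d: "d \<ge> 0" using that(3)[of 0] norm_ge_zero order_trans by blast
    have I: "((\<lambda>\<tau>. L * (exp (2 * L * \<tau>) * d)) has_integral
        (exp (2 * L * s) * d / 2 - exp (2 * L * 0) * d / 2)) {0..s}"
      using s L by (intro fundamental_theorem_of_calculus)
        (auto intro!: derivative_eq_intros simp: has_real_derivative_iff_has_vector_derivative[symmetric])
    have "norm (integral {0..s} (\<lambda>\<tau>. F g \<tau> - F h \<tau>)) \<le>
       integral {0..s} (\<lambda>\<tau>. L * (exp (2 * L * \<tau>) * d))"
    proof (rule integral_norm_bound_integral)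
      show "(\<lambda>\<tau>. F g \<tau> - F h \<tau>) integrable_on {0..s}"
        using Fi that by (intro integrable_diff) auto
      show "(\<lambda>\<tau>. L * (exp (2 * L * \<tau>) * d)) integrable_on {0..s}"
        using I by (rule has_integral_integrable)
      fix \<tau> assume "\<tau> \<in> {0..s}"
      have "norm (F g \<tau> - F h \<tau>) \<le> L * norm (exp (2 * L * \<tau>) *\<^sub>R g \<tau> - exp (2 * L * \<tau>) *\<^sub>R h \<tau>)"
        unfolding F_def by (rule Lf)
      also have "\<dots> = L * (exp (2 * L * \<tau>) * norm (g \<tau> - h \<tau>))"
        by (simp flip: scaleR_diff_right)
      also have "\<dots> \<le> L * (exp (2 * L * \<tau>) * d)"
        using L that(3) by (intro mult_left_mono) auto
      finally show "norm (F g \<tau> - F h \<tau>) \<le> L * (exp (2 * L * \<tau>) * d)" .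
    qed
    also have "\<dots> = exp (2 * L * s) * d / 2 - d / 2"
      using integral_unique[OF I] by simp
    finally have *: "norm (integral {0..s} (F g) - integral {0..s} (F h)) \<le> exp (2 * L * s) * d / 2"
      using Fi that d by (simp add: integral_diff)
    have "norm (P g t - P h t) = exp (- 2 * L * s) * norm (integral {0..s} (F g) - integral {0..s} (F h))"
      by (simp add: P_def s_def flip: scaleR_diff_right)
    also have "\<dots> \<le> exp (- 2 * L * s) * (exp (2 * L * s) * d / 2)"
      using * by (intro mult_left_mono) auto
    also have "\<dots> = d / 2" by (simp flip: exp_add mult.assoc)
    finally show ?thesis .
  qed
  have P0: "norm (P (\<lambda>_. 0) t) \<le> norm x\<^sub>0 + norm (f 0)" for t
  proof -
    define s where "s = max 0 t"
    have s: "s \<ge> 0" by (simp add: s_def)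
    have "s \<le> exp (2 * L * s)"
    proof -
      have "s * 1 \<le> s * (2 * L)" using s L by (intro mult_left_mono) auto
      then have "s \<le> 1 + 2 * L * s" by (simp add: algebra_simps)
      then show ?thesis using exp_ge_add_one_self[of "2 * L * s"] by linarith
    qed
    then have "exp (- 2 * L * s) * s \<le> exp (- 2 * L * s) * exp (2 * L * s)"
      by (intro mult_left_mono) auto
    then have e: "exp (- 2 * L * s) * s \<le> 1" by (simp flip: exp_add)
    have "P (\<lambda>_. 0) t = exp (- 2 * L * s) *\<^sub>R x\<^sub>0 + (exp (- 2 * L * s) * s) *\<^sub>R f 0"
      using s by (simp add: P_def F_def[abs_def] s_def scaleR_add_right)
    also have "norm \<dots> \<le> norm (exp (- 2 * L * s) *\<^sub>R x\<^sub>0) + norm ((exp (- 2 * L * s) * s) *\<^sub>R f 0)"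
      by (rule norm_triangle_ineq)
    also have "\<dots> \<le> norm x\<^sub>0 + norm (f 0)"
      using s e L by (intro add_mono) (auto simp: mult_left_le_one_le)
    finally show ?thesis .
  qed
  have PB: "P g \<in> bcontfun" if g: "continuous_on UNIV g" "bounded (range g)" for g
  proof -
    obtain M where M: "\<And>s. norm (g s) \<le> M"
      using g(2) by (auto simp: bounded_iff)
    have "norm (P g t) \<le> norm x\<^sub>0 + norm (f 0) + M / 2" for t
    proof -
      have "norm (P g t) \<le> norm (P (\<lambda>_. 0) t) + norm (P g t - P (\<lambda>_. 0) t)"
        by norm
      then show ?thesis
        using P0[of t] contr[of g "\<lambda>_. 0" M t] g M by simp
    qed
    then show ?thesis
      using Pc[OF g(1)] by (auto simp: bcontfun_def bounded_iff)
  qed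
  define T where "T g = Bcontfun (P (apply_bcontfun g))" for g
  have T: "apply_bcontfun (T g) = P (apply_bcontfun g)" for g
    unfolding T_def by (rule Bcontfun_inverse) (auto intro: PB)
  have "\<exists>!g. T g = g"
  proof (rule banach_fix_type[of "1/2"])
    show "\<forall>g h. dist (T g) (T h) \<le> 1 / 2 * dist g h"
    proof (intro allI dist_bound)
      fix g h :: "real \<Rightarrow>\<^sub>C 'a" and t
      have "norm (g s - h s) \<le> dist g h" for s
        using dist_bounded[of g s h] by (simp add: dist_norm)
      then have "norm (P g t - P h t) \<le> dist g h / 2"
        by (intro contr) auto
      then show "dist (T g t) (T h t) \<le> 1 / 2 * dist g h"
        unfolding T dist_norm[of "P g t"] by simp
    qed
  qed auto
  then obtain g where "T g = g" by blast
  then have g: "P g t = g t" for t using T by metis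
  define x where "x t = exp (2 * L * t) *\<^sub>R g t" for t
  have x: "x t = x\<^sub>0 + integral {0..t} (\<lambda>s. f (x s))" if "t \<ge> 0" for t
  proof -
    have "x t = exp (2 * L * t) *\<^sub>R P g t" by (simp add: x_def g)
    also have "\<dots> = x\<^sub>0 + integral {0..t} (F g)"
      using that by (simp add: P_def flip: exp_add)
    finally show ?thesis by (simp add: F_def[abs_def] x_def)
  qed
  have xc: "continuous_on {0..} (\<lambda>s. f (x s))"
    unfolding x_def by (intro continuous_on_compose2[OF fc[of UNIV]] continuous_intros) auto
  show ?thesis
  proof (rule that)
    show "x 0 = x\<^sub>0" using x[of 0] by simp
    fix t :: real assume t: "t \<ge> 0"
    have "((\<lambda>t. x\<^sub>0 + integral {0..t} (\<lambda>s. f (x s))) has_vector_derivative f (x t)) (at t within {0..})"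
      using integral_has_vector_derivative_atLeast[OF xc t]
      by (auto intro!: derivative_eq_intros)
    then show "(x has_vector_derivative f (x t)) (at t within {0..})"
      by (rule has_vector_derivative_transform[rotated 2]) (use t x in auto)
  qed
qed

section \<open>Test functions and second-order Sobolev regularity\<close>

lemma Ck_on_differentiable:
  "Ck_on (Suc k) UNIV f \<Longrightarrow> f differentiable at x"
  by (simp add: differentiable_on_def)

lemma Ck_on_continuous: "Ck_on k S f \<Longrightarrow> continuous_on S f"
  by (cases k) (auto intro: differentiable_imp_continuous_on)

lemma smooth_on_has_derivative:
  "smooth_on UNIV f \<Longrightarrow> (f has_derivative frechet_derivative f (at x)) (at x)"
  unfolding smooth_on_def using Ck_on_differentiable[of 0 f x] frechet_derivative_works by blast

lemma smooth_on_partial: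
  "smooth_on S f \<Longrightarrow> b \<in> Basis \<Longrightarrow> smooth_on S (\<lambda>x. frechet_derivative f (at x within S) b)"
  unfolding smooth_on_def using Ck_on.simps(2) by blast

lemma frechet_derivative_affine:
  fixes f :: "'a::euclidean_space \<Rightarrow> real"
  assumes "f differentiable at (c *\<^sub>R x + a)"
  shows "((\<lambda>x. m * f (c *\<^sub>R x + a)) has_derivative
      (\<lambda>h. m * c * frechet_derivative f (at (c *\<^sub>R x + a)) h)) (at x)"
proof -
  let ?D = "frechet_derivative f (at (c *\<^sub>R x + a))"
  have D: "(f has_derivative ?D) (at (c *\<^sub>R x + a))"
    using assms frechet_derivative_works by blast
  then have lin: "linear ?D"
    by (rule has_derivative_linear)
  have "((\<lambda>x. c *\<^sub>R x + a) has_derivative (\<lambda>h. c *\<^sub>R h)) (at x)"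
    by (auto intro!: derivative_eq_intros)
  from has_derivative_compose[OF this D]
  have "((\<lambda>x. m * f (c *\<^sub>R x + a)) has_derivative (\<lambda>h. m * ?D (c *\<^sub>R h))) (at x)"
    by (intro has_derivative_mult_right) 
  then show ?thesis by (simp add: linear_scale[OF lin] mult.assoc)
qed

text \<open>The factor m serves the induction: every differentiation multiplies it by c.\<close>

lemma Ck_on_affine:
  "Ck_on k UNIV f \<Longrightarrow> Ck_on k UNIV (\<lambda>x. m * f (c *\<^sub>R x + a))"
proof (induction k arbitrary: f m)
  case 0
  then show ?case
    by (auto intro!: continuous_intros continuous_on_compose2[of UNIV f])
next
  case (Suc k)
  have d: "((\<lambda>x. m * f (c *\<^sub>R x + a)) has_derivative
      (\<lambda>h. m * c * frechet_derivative f (at (c *\<^sub>R x + a)) h)) (at x)" for x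
    using Suc.prems by (intro frechet_derivative_affine Ck_on_differentiable)
  have "frechet_derivative (\<lambda>x. m * f (c *\<^sub>R x + a)) (at x) =
      (\<lambda>h. m * c * frechet_derivative f (at (c *\<^sub>R x + a)) h)" for x
    by (rule frechet_derivative_at[OF d, symmetric])
  moreover have "Ck_on k UNIV (\<lambda>x. m * c * frechet_derivative f (at (c *\<^sub>R x + a)) b)"
    if "b \<in> Basis" for b
    by (rule Suc.IH[of "\<lambda>y. frechet_derivative f (at y) b"]) (use Suc.prems that in auto)
  ultimately show ?case
    using differentiableI[OF d] by (simp add: differentiable_on_def)
qed

lemma test_function_affine:
  fixes f :: "'a::euclidean_space \<Rightarrow> real"
  assumes "test_function f" "c \<noteq> 0"
  shows "test_function (\<lambda>x. f (c *\<^sub>R x + a))"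
proof -
  obtain B where B: "\<And>x. f x \<noteq> 0 \<Longrightarrow> norm x \<le> B"
    using assms by (auto simp: test_function_def bounded_iff)
  have "norm x \<le> (B + norm a) / \<bar>c\<bar>" if "f (c *\<^sub>R x + a) \<noteq> 0" for x
  proof -
    have "\<bar>c\<bar> * norm x = norm ((c *\<^sub>R x + a) - a)" by simp
    also have "\<dots> \<le> B + norm a" using B[OF that] norm_triangle_ineq4[of "c *\<^sub>R x + a" a] by linarith
    finally show ?thesis using assms(2) by (simp add: field_simps)
  qed
  then have "bounded {x. f (c *\<^sub>R x + a) \<noteq> 0}"
    by (auto simp: bounded_iff)
  moreover have "smooth_on UNIV (\<lambda>x. 1 * f (c *\<^sub>R x + a))"
    using assms unfolding test_function_def smooth_on_def by (intro allI Ck_on_affine) auto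
  ultimately show ?thesis by (simp add: test_function_def)
qed

lemma test_function_partial:
  fixes f :: "'a::euclidean_space \<Rightarrow> real"
  assumes "test_function f" "b \<in> Basis"
  shows "test_function (\<lambda>x. frechet_derivative f (at x) b)"
    and "closure {x. frechet_derivative f (at x) b \<noteq> 0} \<subseteq> closure {x. f x \<noteq> 0}"
proof -
  have "frechet_derivative f (at x) b = 0" if "x \<notin> closure {x. f x \<noteq> 0}" for x
  proof -
    have "(f has_derivative (\<lambda>_. 0)) (at x)"
      by (rule has_derivative_transform_within_open[where s = "- closure {x. f x \<noteq> 0}" and f = "\<lambda>_. 0"])
        (use that closure_subset[of "{x. f x \<noteq> 0}"] in auto)
    from frechet_derivative_at[OF this] show ?thesis by metis
  qed
  then have sub: "{x. frechet_derivative f (at x) b \<noteq> 0} \<subseteq> closure {x. f x \<noteq> 0}" by blast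
  then show "closure {x. frechet_derivative f (at x) b \<noteq> 0} \<subseteq> closure {x. f x \<noteq> 0}"
    by (simp add: closure_minimal)
  then show "test_function (\<lambda>x. frechet_derivative f (at x) b)"
    using assms smooth_on_partial[of UNIV f b] sub
    by (auto simp: test_function_def intro: bounded_subset)
qed

text \<open>Weak derivatives are phrased with the Lebesgue integral, differentiation under the
  integral sign with the integral over a box; this passes between the two.\<close>

lemma continuous_supported_in_cbox:
  fixes f :: "'a::euclidean_space \<Rightarrow> real"
  assumes "continuous_on UNIV f" "\<And>x. x \<notin> cbox a b \<Longrightarrow> f x = 0"
  shows "integrable lebesgue f" "(LINT x|lebesgue. f x) = integral (cbox a b) f"
proof -
  have c: "set_integrable lebesgue (cbox a b) f"
    using assms by (intro absolutely_integrable_continuous continuous_on_subset[OF assms(1)]) auto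
  have e: "(\<lambda>x. indicator (cbox a b) x *\<^sub>R f x) = f"
    using assms(2) by (force simp: indicator_def)
  show "integrable lebesgue f" using c unfolding set_integrable_def e .
  show "(LINT x|lebesgue. f x) = integral (cbox a b) f"
    using set_lebesgue_integral_eq_integral(2)[OF c] unfolding set_lebesgue_integral_def e .
qed

lemma lebesgue_integral_translation:
  fixes f :: "'a::euclidean_space \<Rightarrow> real"
  assumes "continuous_on UNIV f"
  shows "(LINT x|lebesgue. f (a + x)) = (LINT x|lebesgue. f x)"
proof -
  have m: "f \<in> borel_measurable borel"
    using assms by (rule borel_measurable_continuous_onI)
  then have "(LINT x|lebesgue. f (a + x)) = (LINT x|lborel. f (a + x))"
    by (intro integral_completion) auto
  also have "\<dots> = (LINT x|distr lborel borel ((+) a). f x)"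
    using m by (subst integral_distr) auto
  also have "\<dots> = (LINT x|lebesgue. f x)"
    using m by (simp add: lborel_distr_plus integral_completion)
  finally show ?thesis .
qed

lemma partial_along_line:
  fixes f :: "'a::euclidean_space \<Rightarrow> real"
  assumes "(f has_derivative D) (at (x + h *\<^sub>R b))"
  shows "((\<lambda>h. f (x + h *\<^sub>R b)) has_real_derivative D b) (at h)"
proof -
  have "((\<lambda>h. x + h *\<^sub>R b) has_derivative (\<lambda>d. d *\<^sub>R b)) (at h)"
    by (auto intro!: derivative_eq_intros)
  from has_derivative_compose[OF this assms]
  have "((\<lambda>h. f (x + h *\<^sub>R b)) has_derivative (\<lambda>d. D (d *\<^sub>R b))) (at h)" .
  then show ?thesis
    using linear_scale[OF has_derivative_linear[OF assms]]
    by (simp add: has_field_derivative_def mult_commute_abs)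
qed

text \<open>Two integrations by parts move both derivatives from \<psi> to f. The bound M depends on
  K only, so it survives when the test functions concentrate at a point.\<close>

lemma integral_bound_weak_second_partial:
  fixes f :: "'a::euclidean_space \<Rightarrow> real"
  assumes "W_inf_loc 2 f" "b \<in> Basis" "compact K"
  shows "\<exists>M\<ge>0. \<forall>\<psi>. test_function \<psi> \<and> (\<forall>x. \<psi> x \<ge> 0) \<and> (\<forall>x. x \<notin> K \<longrightarrow> \<psi> x = 0) \<longrightarrow>
      \<bar>LINT x|lebesgue. f x * frechet_derivative (\<lambda>x. frechet_derivative \<psi> (at x) b) (at x) b\<bar>
        \<le> M * (LINT x|lebesgue. \<psi> x)"
proof -
  obtain g where g: "weak_partial b f g" "W_inf_loc 1 g"
    using assms(1,2) by (auto simp: numeral_2_eq_2)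
  then obtain k where k: "weak_partial b g k" "Linf_loc k"
    using assms(2) by auto
  then obtain M where M: "AE x in lebesgue. x \<in> K \<longrightarrow> \<bar>k x\<bar> \<le> M"
    using assms(3) by (auto simp: Linf_loc_def)
  show ?thesis
  proof (rule exI[of _ "max M 0"], intro conjI allI impI)
    show "max M 0 \<ge> 0" by simp
    fix \<psi> :: "'a \<Rightarrow> real"
    assume "test_function \<psi> \<and> (\<forall>x. \<psi> x \<ge> 0) \<and> (\<forall>x. x \<notin> K \<longrightarrow> \<psi> x = 0)"
    then have \<psi>: "test_function \<psi>" "\<And>x. \<psi> x \<ge> 0" "\<And>x. x \<notin> K \<Longrightarrow> \<psi> x = 0" by auto
    have "continuous_on UNIV \<psi>"
      using \<psi>(1) by (auto simp: test_function_def smooth_on_def intro: Ck_on_continuous)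
    moreover obtain a c where "K \<subseteq> cbox a c"
      using bounded_subset_cbox_symmetric[OF compact_imp_bounded[OF assms(3)]] by blast
    ultimately have i: "integrable lebesgue \<psi>"
      using \<psi>(3) by (intro continuous_supported_in_cbox(1)[of \<psi> a c]) auto
    have "(LINT x|lebesgue. f x * frechet_derivative (\<lambda>x. frechet_derivative \<psi> (at x) b) (at x) b)
        = - (LINT x|lebesgue. g x * frechet_derivative \<psi> (at x) b)"
      using g(1) test_function_partial(1)[OF \<psi>(1) assms(2)] by (auto simp: weak_partial_def)
    also have "\<dots> = (LINT x|lebesgue. k x * \<psi> x)"
      using k(1) \<psi>(1) by (auto simp: weak_partial_def)
    also have "\<bar>\<dots>\<bar> \<le> (LINT x|lebesgue. max M 0 * \<psi> x)"
    proof (cases "integrable lebesgue (\<lambda>x. k x * \<psi> x)")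
      case True
      have "\<bar>LINT x|lebesgue. k x * \<psi> x\<bar> \<le> (LINT x|lebesgue. \<bar>k x * \<psi> x\<bar>)"
        by (rule integral_abs_bound)
      also have "\<dots> \<le> (LINT x|lebesgue. max M 0 * \<psi> x)"
      proof (rule integral_mono_AE)
        show "AE x in lebesgue. \<bar>k x * \<psi> x\<bar> \<le> max M 0 * \<psi> x"
          using M
        proof eventually_elim
          case (elim x)
          then show ?case
            using \<psi>(2)[of x] \<psi>(3)[of x] by (cases "x \<in> K") (auto simp: abs_mult intro!: mult_right_mono)
        qed
      qed (use True i in auto)
      finally show ?thesis .
    next
      \<comment> \<open>A function that is not integrable has integral 0 by convention.\<close>
      case False
      then show ?thesis
        using \<psi>(2) by (simp add: not_integrable_integral_eq)
    qed
    finally show "\<bar>LINT x|lebesgue. f x * frechet_derivative (\<lambda>x. frechet_derivative \<psi> (at x) b) (at x) b\<bar>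
        \<le> max M 0 * (LINT x|lebesgue. \<psi> x)" by simp
  qed
qed

text \<open>The increment h sits in the argument of the smooth g, so continuity of f is enough. The
  mollification is differentiated twice with this, the factor s being absorbed into f the second
  time.\<close>

lemma integral_shifted_has_derivative:
  fixes f g :: "'a::euclidean_space \<Rightarrow> real"
  assumes "continuous_on UNIV f" "smooth_on UNIV g" "b \<in> Basis"
  shows "((\<lambda>h. integral (cbox p q) (\<lambda>t. f t * g (\<kappa> *\<^sub>R t + c + h *\<^sub>R (s *\<^sub>R b)))) has_real_derivative
    integral (cbox p q) (\<lambda>t. s * f t * frechet_derivative g (at (\<kappa> *\<^sub>R t + c + h *\<^sub>R (s *\<^sub>R b))) b)) (at h)"
proof -
  let ?g' = "\<lambda>y. frechet_derivative g (at y) b"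
  have gc: "continuous_on UNIV g" "continuous_on UNIV ?g'"
    using assms(2) smooth_on_partial[OF assms(2,3)] by (auto simp: smooth_on_def intro: Ck_on_continuous)
  have "((\<lambda>h. f t * g (\<kappa> *\<^sub>R t + c + h *\<^sub>R (s *\<^sub>R b))) has_real_derivative
      s * f t * ?g' (\<kappa> *\<^sub>R t + c + h *\<^sub>R (s *\<^sub>R b))) (at h)" for h t
  proof -
    have D: "(g has_derivative frechet_derivative g (at y)) (at y)" for y
      by (rule smooth_on_has_derivative[OF assms(2)])
    have "((\<lambda>h. g (\<kappa> *\<^sub>R t + c + h *\<^sub>R (s *\<^sub>R b))) has_real_derivative
        frechet_derivative g (at (\<kappa> *\<^sub>R t + c + h *\<^sub>R (s *\<^sub>R b))) (s *\<^sub>R b)) (at h)"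
      by (rule partial_along_line[OF D])
    from DERIV_cmult[OF this, of "f t"] show ?thesis
      using linear_scale[OF has_derivative_linear[OF D]] by (simp add: mult_ac)
  qed
  moreover have "(\<lambda>t. f t * g (\<kappa> *\<^sub>R t + c + h *\<^sub>R (s *\<^sub>R b))) integrable_on cbox p q" for h
    by (intro integrable_continuous continuous_intros continuous_on_subset[OF assms(1)]
        continuous_on_compose2[OF gc(1)]) auto
  moreover have "continuous_on (UNIV \<times> cbox p q)
      (\<lambda>(h, t). s * f t * ?g' (\<kappa> *\<^sub>R t + c + h *\<^sub>R (s *\<^sub>R b)))"
    unfolding split_beta
    by (intro continuous_intros continuous_on_compose2[OF assms(1)]
        continuous_on_compose2[OF gc(2)]) auto
  ultimately show ?thesis
    by (intro leibniz_rule_field_derivative[where U = UNIV]) auto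
qed

lemma continuous_integral_pos:
  fixes f :: "'a::euclidean_space \<Rightarrow> real"
  assumes "continuous_on UNIV f" "integrable lebesgue f" "\<And>x. f x \<ge> 0" "f c > 0"
  shows "(LINT x|lebesgue. f x) > 0"
proof (rule ccontr)
  assume "\<not> (LINT x|lebesgue. f x) > 0"
  then have "(LINT x|lebesgue. f x) = 0"
    using assms(3) by (simp add: order_antisym)
  then have "AE x in lebesgue. f x = 0"
    using integral_nonneg_eq_0_iff_AE[OF assms(2)] assms(3) by simp
  moreover have o: "open {x. f x \<noteq> 0}"
    using assms(1) by (intro open_Collect_neq) auto
  moreover from o have "{x. f x \<noteq> 0} \<in> sets lebesgue" by simp
  ultimately have "negligible {x. f x \<noteq> 0}"
    using AE_iff_null[of lebesgue "\<lambda>x. f x = 0"] by (simp add: negligible_iff_null_sets)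
  then show False
    using open_not_negligible[OF o] assms(4) less_irrefl[of "0::real"] by force
qed

text \<open>The bump is not normalised; its mass stays as a factor and is cancelled by the
  caller.\<close>

lemma integral_bump_approx:
  fixes f \<psi> :: "'a::euclidean_space \<Rightarrow> real"
  assumes "continuous_on UNIV f" "continuous_on UNIV \<psi>" "\<And>x. \<psi> x \<ge> 0"
    and "\<And>x. x \<notin> cbox p q \<Longrightarrow> \<psi> x = 0" and "\<And>x. \<psi> x \<noteq> 0 \<Longrightarrow> \<bar>f x - y\<bar> \<le> \<omega>"
  shows "\<bar>(LINT x|lebesgue. f x * \<psi> x) - y * (LINT x|lebesgue. \<psi> x)\<bar> \<le> \<omega> * (LINT x|lebesgue. \<psi> x)"
proof -
  have i: "integrable lebesgue \<psi>" "integrable lebesgue (\<lambda>x. f x * \<psi> x)"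
    by (rule continuous_supported_in_cbox(1)[of _ p q]; use assms in \<open>auto intro: continuous_intros\<close>)+
  have "(LINT x|lebesgue. f x * \<psi> x) - y * (LINT x|lebesgue. \<psi> x) = (LINT x|lebesgue. f x * \<psi> x - y * \<psi> x)"
    using i by simp
  also have "\<bar>\<dots>\<bar> \<le> (LINT x|lebesgue. \<bar>f x * \<psi> x - y * \<psi> x\<bar>)"
    by (rule integral_abs_bound)
  also have "\<dots> \<le> (LINT x|lebesgue. \<omega> * \<psi> x)"
  proof (rule integral_mono)
    fix x
    have "f x * \<psi> x - y * \<psi> x = (f x - y) * \<psi> x" by (simp add: algebra_simps)
    then show "\<bar>f x * \<psi> x - y * \<psi> x\<bar> \<le> \<omega> * \<psi> x"
      using assms(3)[of x] assms(5)[of x] by (cases "\<psi> x = 0") (auto simp: abs_mult intro: mult_right_mono)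
  qed (use i in auto)
  finally show ?thesis by simp
qed

text \<open>The mollification \<open>h \<mapsto> \<integral> f(t) \<eta>((t - x\<^sub>0 - h b)/\<delta>) dt\<close> is twice differentiable with a second
  derivative that the weak second derivative of \<open>f\<close> bounds uniformly in \<open>\<delta>\<close>.\<close>

lemma W_inf_loc_2_second_difference:
  fixes f \<eta> :: "'a::euclidean_space \<Rightarrow> real"
  assumes "W_inf_loc 2 f" and fc: "continuous_on UNIV f" and b: "b \<in> Basis"
    and \<eta>: "test_function \<eta>" "\<And>x. \<eta> x \<ge> 0" "\<eta> 0 > 0"
  obtains M where "M \<ge> 0"
    "\<And>h. 0 < h \<Longrightarrow> h \<le> 1 \<Longrightarrow> \<bar>f (x\<^sub>0 + h *\<^sub>R b) + f (x\<^sub>0 - h *\<^sub>R b) - 2 * f x\<^sub>0\<bar> \<le> M * h\<^sup>2"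
proof -
  obtain R where R: "R > 0" "\<And>x. \<eta> x \<noteq> 0 \<Longrightarrow> norm x \<le> R"
    using \<eta>(1) by (auto simp: test_function_def bounded_pos)
  \<comment> \<open>Holds the support of every bump of radius at most R centred at
    \<open>x\<^sub>0 + s b\<close> with |s| <= 1.\<close>
  define K where "K = cball x\<^sub>0 (1 + R)"
  have "compact K" by (simp add: K_def)
  obtain M where M: "M \<ge> 0" "\<forall>\<psi>. test_function \<psi> \<and> (\<forall>x. \<psi> x \<ge> 0) \<and> (\<forall>x. x \<notin> K \<longrightarrow> \<psi> x = 0) \<longrightarrow>
      \<bar>LINT x|lebesgue. f x * frechet_derivative (\<lambda>x. frechet_derivative \<psi> (at x) b) (at x) b\<bar>
        \<le> M * (LINT x|lebesgue. \<psi> x)"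
    using integral_bound_weak_second_partial[OF assms(1) b \<open>compact K\<close>] by (elim exE conjE) 
  obtain p q where Q: "K \<subseteq> cbox p q"
    using bounded_subset_cbox_symmetric[OF compact_imp_bounded[OF \<open>compact K\<close>]] by blast
  define \<eta>1 where "\<eta>1 y = frechet_derivative \<eta> (at y) b" for y
  define \<eta>2 where "\<eta>2 y = frechet_derivative \<eta>1 (at y) b" for y
  have s\<eta>: "smooth_on UNIV \<eta>" using \<eta>(1) by (simp add: test_function_def)
  then have s\<eta>1: "smooth_on UNIV \<eta>1" unfolding \<eta>1_def by (rule smooth_on_partial[OF _ b])
  then have s\<eta>2: "smooth_on UNIV \<eta>2" unfolding \<eta>2_def by (rule smooth_on_partial[OF _ b])
  have c\<eta>: "continuous_on UNIV \<eta>" "continuous_on UNIV \<eta>2"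
    using s\<eta> s\<eta>2 by (auto simp: smooth_on_def intro: Ck_on_continuous)
  \<comment> \<open>\<omega> is the error of replacing f by its mollification at each of the three
    points, which count with weights 1, 1 and 2.\<close>
  have bound: "\<bar>f (x\<^sub>0 + h *\<^sub>R b) + f (x\<^sub>0 - h *\<^sub>R b) - 2 * f x\<^sub>0\<bar> \<le> M * h\<^sup>2 + 4 * \<omega>"
    if h: "0 < h" "h \<le> 1" and "\<omega> > 0" for h \<omega>
  proof -
    have "\<exists>d>0. \<forall>t. norm (t - c) < d \<longrightarrow> \<bar>f t - f c\<bar> \<le> \<omega>" for c
    proof -
      have "isCont f c" using fc by (simp add: continuous_on_eq_continuous_at)
      then show ?thesis using \<open>\<omega> > 0\<close> unfolding continuous_at_eps_delta
        by (metis dist_norm dist_real_def less_imp_le)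
    qed
    then obtain d where d: "\<And>c. d c > 0" "\<And>c t. norm (t - c) < d c \<Longrightarrow> \<bar>f t - f c\<bar> \<le> \<omega>"
      by metis
    define m where "m = min (d (x\<^sub>0 + h *\<^sub>R b)) (min (d (x\<^sub>0 - h *\<^sub>R b)) (d x\<^sub>0))"
    have m: "m > 0" using d(1) by (simp add: m_def)
    \<comment> \<open>The inverse width of the bump: the factor 2 makes R / \<kappa> < m strict, and
      \<kappa> >= 1 keeps the support inside K.\<close>
    define \<kappa> where "\<kappa> = max 1 (2 * R / m)"
    have \<kappa>: "\<kappa> \<ge> 1" "R / \<kappa> < m" "\<kappa> > 0"
    proof -
      show "\<kappa> \<ge> 1" "\<kappa> > 0" by (auto simp: \<kappa>_def)
      have "2 * R \<le> m * \<kappa>" using m by (simp add: \<kappa>_def field_simps max_def)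
      then show "R / \<kappa> < m" using \<open>\<kappa> > 0\<close> R(1) by (simp add: field_simps)
    qed
    define \<psi> where "\<psi> s t = \<eta> (\<kappa> *\<^sub>R t + - (\<kappa> *\<^sub>R x\<^sub>0) + s *\<^sub>R (- \<kappa> *\<^sub>R b))" for s t
    have \<psi>near: "norm (t - (x\<^sub>0 + s *\<^sub>R b)) \<le> R / \<kappa>" if "\<psi> s t \<noteq> 0" for s t
    proof -
      have "norm (\<kappa> *\<^sub>R (t - (x\<^sub>0 + s *\<^sub>R b))) \<le> R"
        using R(2)[of "\<kappa> *\<^sub>R t + - (\<kappa> *\<^sub>R x\<^sub>0) + s *\<^sub>R (- \<kappa> *\<^sub>R b)"] that by (simp add: \<psi>_def algebra_simps)
      then have "\<kappa> * norm (t - (x\<^sub>0 + s *\<^sub>R b)) \<le> R" using \<kappa> by simp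
      then show ?thesis using \<kappa> by (simp add: pos_le_divide_eq mult.commute)
    qed
    have \<psi>K: "\<psi> s t = 0" if "t \<notin> K" "\<bar>s\<bar> \<le> 1" for s t
    proof (rule ccontr)
      assume "\<psi> s t \<noteq> 0"
      then have "norm (t - (x\<^sub>0 + s *\<^sub>R b)) \<le> R / \<kappa>" by (rule \<psi>near)
      moreover have "R / \<kappa> \<le> R" using \<kappa> R by (simp add: field_simps)
      moreover have "norm (t - x\<^sub>0) \<le> norm (t - (x\<^sub>0 + s *\<^sub>R b)) + norm (s *\<^sub>R b)"
        using norm_triangle_ineq[of "t - (x\<^sub>0 + s *\<^sub>R b)" "s *\<^sub>R b"] by (simp add: algebra_simps)
      moreover have "norm (s *\<^sub>R b) \<le> 1" using that(2) b by simp
      ultimately have "norm (t - x\<^sub>0) \<le> 1 + R" by linarith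
      then show False using that(1) by (simp add: K_def dist_norm norm_minus_commute)
    qed
    have \<psi>Q: "\<psi> s t = 0" if "t \<notin> cbox p q" "\<bar>s\<bar> \<le> 1" for s t
      using \<psi>K Q that by blast
    have \<psi>t: "test_function (\<psi> s)" for s
      using test_function_affine[OF \<eta>(1), of \<kappa>] \<kappa> unfolding \<psi>_def add.assoc by simp
    have \<psi>c: "continuous_on UNIV (\<psi> s)" for s
      using \<psi>t[of s] by (auto simp: test_function_def smooth_on_def intro: Ck_on_continuous)
    have \<psi>0: "\<psi> s t \<ge> 0" for s t using \<eta>(2) by (simp add: \<psi>_def)
    define I where "I = (LINT t|lebesgue. \<psi> 0 t)"
    have I: "(LINT t|lebesgue. \<psi> s t) = I" for s
    proof -
      have "\<psi> s t = \<psi> 0 (- (s *\<^sub>R b) + t)" for t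
        by (simp add: \<psi>_def algebra_simps)
      then show ?thesis
        using lebesgue_integral_translation[OF \<psi>c[of 0], of "- (s *\<^sub>R b)"] by (simp add: I_def)
    qed
    have "I > 0"
      unfolding I_def
    proof (rule continuous_integral_pos[where c = x\<^sub>0])
      show "integrable lebesgue (\<psi> 0)"
        using \<psi>Q by (intro continuous_supported_in_cbox(1)[of _ p q] \<psi>c) auto
      show "0 < \<psi> 0 x\<^sub>0" using \<eta>(3) by (simp add: \<psi>_def)
    qed (use \<psi>c \<psi>0 in auto)
    define G where "G s = integral (cbox p q) (\<lambda>t. f t * \<psi> s t)" for s
    define G1 where "G1 s = integral (cbox p q)
      (\<lambda>t. (- \<kappa> * f t) * \<eta>1 (\<kappa> *\<^sub>R t + - (\<kappa> *\<^sub>R x\<^sub>0) + s *\<^sub>R (- \<kappa> *\<^sub>R b)))" for s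
    define G2 where "G2 s = integral (cbox p q)
      (\<lambda>t. (- \<kappa> * (- \<kappa> * f t)) * \<eta>2 (\<kappa> *\<^sub>R t + - (\<kappa> *\<^sub>R x\<^sub>0) + s *\<^sub>R (- \<kappa> *\<^sub>R b)))" for s
    have dG: "(G has_real_derivative G1 s) (at s)" for s
      unfolding G_def[abs_def] \<psi>_def G1_def \<eta>1_def
      by (rule integral_shifted_has_derivative[OF fc s\<eta> b])
    have dG1: "(G1 has_real_derivative G2 s) (at s)" for s
      unfolding G1_def[abs_def] G2_def \<eta>2_def
      by (rule integral_shifted_has_derivative[OF _ s\<eta>1 b]) (intro continuous_intros fc)
    have G2: "\<bar>G2 s\<bar> \<le> M * I" if s: "\<bar>s\<bar> \<le> 1" for s
    proof -
      have a: "\<psi> s = (\<lambda>t. 1 * \<eta> (\<kappa> *\<^sub>R t + (- (\<kappa> *\<^sub>R x\<^sub>0) + s *\<^sub>R (- \<kappa> *\<^sub>R b))))"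
        by (rule ext) (simp only: \<psi>_def add.assoc mult_1_left)
      have e1: "(\<psi> s has_derivative (\<lambda>h. 1 * \<kappa> * frechet_derivative \<eta> (at (\<kappa> *\<^sub>R t + (- (\<kappa> *\<^sub>R x\<^sub>0) + s *\<^sub>R (- \<kappa> *\<^sub>R b)))) h)) (at t)" for t
        unfolding a
        by (rule frechet_derivative_affine) (use smooth_on_has_derivative[OF s\<eta>] differentiableI in blast)
      have d1: "frechet_derivative (\<psi> s) (at t) b = \<kappa> * \<eta>1 (\<kappa> *\<^sub>R t + (- (\<kappa> *\<^sub>R x\<^sub>0) + s *\<^sub>R (- \<kappa> *\<^sub>R b)))" for t
        by (simp only: frechet_derivative_at[OF e1, symmetric] \<eta>1_def mult_1_left)
      have e2: "((\<lambda>t. \<kappa> * \<eta>1 (\<kappa> *\<^sub>R t + (- (\<kappa> *\<^sub>R x\<^sub>0) + s *\<^sub>R (- \<kappa> *\<^sub>R b)))) has_derivative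
          (\<lambda>h. \<kappa> * \<kappa> * frechet_derivative \<eta>1 (at (\<kappa> *\<^sub>R t + (- (\<kappa> *\<^sub>R x\<^sub>0) + s *\<^sub>R (- \<kappa> *\<^sub>R b)))) h)) (at t)" for t
        by (rule frechet_derivative_affine) (use smooth_on_has_derivative[OF s\<eta>1] differentiableI in blast)
      have d2: "frechet_derivative (\<lambda>t. frechet_derivative (\<psi> s) (at t) b) (at t) b
          = \<kappa> * \<kappa> * \<eta>2 (\<kappa> *\<^sub>R t + (- (\<kappa> *\<^sub>R x\<^sub>0) + s *\<^sub>R (- \<kappa> *\<^sub>R b)))" for t
        by (simp only: d1 frechet_derivative_at[OF e2, symmetric] \<eta>2_def)
      let ?\<psi>1 = "\<lambda>t. frechet_derivative (\<psi> s) (at t) b"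
      have "closure {t. frechet_derivative ?\<psi>1 (at t) b \<noteq> 0} \<subseteq> closure {t. ?\<psi>1 t \<noteq> 0}"
        by (intro test_function_partial(2)[OF _ b] test_function_partial(1)[OF \<psi>t b])
      also have "\<dots> \<subseteq> closure {t. \<psi> s t \<noteq> 0}"
        by (rule test_function_partial(2)[OF \<psi>t b])
      also have "\<dots> \<subseteq> K"
        using \<psi>K s \<open>compact K\<close> by (intro closure_minimal) (auto simp: compact_imp_closed)
      finally have z: "frechet_derivative ?\<psi>1 (at t) b = 0" if "t \<notin> cbox p q" for t
        using that Q closure_subset[of "{t. frechet_derivative ?\<psi>1 (at t) b \<noteq> 0}"] by blast
      have "(LINT t|lebesgue. f t * frechet_derivative ?\<psi>1 (at t) b)
          = integral (cbox p q) (\<lambda>t. f t * frechet_derivative ?\<psi>1 (at t) b)"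
      proof (rule continuous_supported_in_cbox(2))
        show "continuous_on UNIV (\<lambda>t. f t * frechet_derivative ?\<psi>1 (at t) b)"
          unfolding d2
          by (intro continuous_intros fc continuous_on_compose2[OF c\<eta>(2)]) auto
      qed (use z in auto)
      also have "\<dots> = G2 s"
        unfolding G2_def d2 add.assoc by (rule integral_cong) (simp add: mult_ac)
      finally show ?thesis
        using M(2)[rule_format, of "\<psi> s"] \<psi>t[of s] \<psi>0[of s] \<psi>K[OF _ s] by (simp add: I)
    qed
    \<comment> \<open>After symmetrisation k and its first derivative vanish at 0, so Taylor's
      formula of order two reduces to its remainder.\<close>
    define k where "k s = G s + G (- s) - 2 * G 0" for s
    define k1 where "k1 s = G1 s - G1 (- s)" for s
    define k2 where "k2 s = G2 s + G2 (- s)" for s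
    have dk: "(k has_real_derivative k1 s) (at s)" "(k1 has_real_derivative k2 s) (at s)" for s
    proof -
      have "((\<lambda>s. G (- s)) has_real_derivative G1 (- s) * - 1) (at s)"
        by (rule DERIV_chain2[OF dG]) (auto intro!: derivative_eq_intros)
      then show "(k has_real_derivative k1 s) (at s)"
        unfolding k_def[abs_def] k1_def using dG[of s] by (auto intro!: derivative_eq_intros)
      have "((\<lambda>s. G1 (- s)) has_real_derivative G2 (- s) * - 1) (at s)"
        by (rule DERIV_chain2[OF dG1]) (auto intro!: derivative_eq_intros)
      then show "(k1 has_real_derivative k2 s) (at s)"
        unfolding k1_def[abs_def] k2_def using dG1[of s] by (auto intro!: derivative_eq_intros)
    qed
    have "\<exists>t. 0 < t \<and> t < h \<and> k h = (\<Sum>m<2. ([k, k1, k2] ! m) 0 / fact m * h ^ m) + ([k, k1, k2] ! 2) t / fact 2 * h ^ 2"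
      using dk h(1) by (intro Maclaurin) (auto simp: less_2_cases_iff)
    then obtain t where t: "0 < t" "t < h" "k h = k2 t / 2 * h\<^sup>2"
      by (auto simp: k_def k1_def numeral_2_eq_2)
    have "\<bar>k2 t\<bar> \<le> 2 * (M * I)"
      using G2[of t] G2[of "- t"] t h by (simp add: k2_def)
    then have kh: "\<bar>k h\<bar> \<le> M * I * h\<^sup>2"
      using mult_right_mono[of "\<bar>k2 t\<bar>" "2 * (M * I)" "h\<^sup>2"] by (simp add: t(3) abs_mult)
    have near: "\<bar>G s - f (x\<^sub>0 + s *\<^sub>R b) * I\<bar> \<le> \<omega> * I" if s: "s \<in> {h, - h, 0}" for s
    proof -
      have s1: "\<bar>s\<bar> \<le> 1" using s h by auto
      have "m \<le> d (x\<^sub>0 + s *\<^sub>R b)" using s by (auto simp: m_def)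
      then have f: "\<bar>f t - f (x\<^sub>0 + s *\<^sub>R b)\<bar> \<le> \<omega>" if "\<psi> s t \<noteq> 0" for t
        using \<psi>near[OF that] \<kappa>(2) by (intro d(2)) linarith
      have "G s = (LINT t|lebesgue. f t * \<psi> s t)"
        unfolding G_def using \<psi>Q s1
        by (intro continuous_supported_in_cbox(2)[symmetric] continuous_intros fc \<psi>c) auto
      then show ?thesis
        using integral_bump_approx[OF fc \<psi>c \<psi>0 \<psi>Q[OF _ s1] f] by (simp add: I)
    qed
    have "\<bar>f (x\<^sub>0 + h *\<^sub>R b) + f (x\<^sub>0 - h *\<^sub>R b) - 2 * f x\<^sub>0\<bar> * I
        = \<bar>f (x\<^sub>0 + h *\<^sub>R b) * I + f (x\<^sub>0 - h *\<^sub>R b) * I - 2 * (f x\<^sub>0 * I)\<bar>"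
    proof -
      have "f (x\<^sub>0 + h *\<^sub>R b) * I + f (x\<^sub>0 - h *\<^sub>R b) * I - 2 * (f x\<^sub>0 * I)
          = (f (x\<^sub>0 + h *\<^sub>R b) + f (x\<^sub>0 - h *\<^sub>R b) - 2 * f x\<^sub>0) * I"
        by (simp add: left_diff_distrib distrib_right)
      then show ?thesis using \<open>I > 0\<close> by (simp add: abs_mult)
    qed
    also have "\<dots> \<le> M * I * h\<^sup>2 + 4 * (\<omega> * I)"
      using kh near[of h] near[of "- h"] near[of 0] by (auto simp: k_def)
    also have "\<dots> = (M * h\<^sup>2 + 4 * \<omega>) * I"
      by (simp add: algebra_simps)
    finally show ?thesis using \<open>I > 0\<close> by simp
  qed
  show ?thesis
  proof (rule that[OF M(1)])
    fix h :: real assume h: "0 < h" "h \<le> 1"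
    show "\<bar>f (x\<^sub>0 + h *\<^sub>R b) + f (x\<^sub>0 - h *\<^sub>R b) - 2 * f x\<^sub>0\<bar> \<le> M * h\<^sup>2"
    proof (rule field_le_epsilon)
      fix e :: real assume "e > 0"
      then show "\<bar>f (x\<^sub>0 + h *\<^sub>R b) + f (x\<^sub>0 - h *\<^sub>R b) - 2 * f x\<^sub>0\<bar> \<le> M * h\<^sup>2 + e"
        using bound[OF h, of "e / 4"] by simp
    qed
  qed
qed

section \<open>The gradient of the well potential\<close>

lemma lipschitz_on_if_C1:
  fixes f f' :: "real \<Rightarrow> real"
  assumes "\<And>x. x \<in> {a..b} \<Longrightarrow> (f has_real_derivative f' x) (at x within {a..b})"
    and "continuous_on {a..b} f'"
  obtains K where "K-lipschitz_on {a..b} f"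
proof -
  have "bounded (f' ` {a..b})"
    using assms(2) by (intro compact_imp_bounded compact_continuous_image) auto
  then obtain B where B: "B > 0" "\<And>x. x \<in> {a..b} \<Longrightarrow> \<bar>f' x\<bar> \<le> B"
    by (auto simp: bounded_pos)
  have "B-lipschitz_on {a..b} f"
  proof (rule lipschitz_onI)
    fix x y assume "x \<in> {a..b}" "y \<in> {a..b}"
    then show "dist (f x) (f y) \<le> B * dist x y"
      using field_differentiable_bound[of "{a..b}" f f' B x y] assms(1) B by (simp add: dist_norm)
  qed (use B in auto)
  then show ?thesis using that by blast
qed

lemma lipschitz_on_glue:
  fixes f :: "real \<Rightarrow> real"
  assumes "K-lipschitz_on {a..b} f" "L-lipschitz_on {b..c} f"
  shows "(max K L)-lipschitz_on {a..c} f"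
proof -
  have "(\<lambda>x. if x \<le> b then f x else f x) = f" by (rule ext) (rule if_cancel)
  with lipschitz_on_concat_max[OF assms refl] show ?thesis by metis
qed

text \<open>Treats the squares of min and max at and off their kinks alike, since their error bound
  is global.\<close>

lemma has_derivative_if_quadratic_bound:
  fixes f :: "real \<Rightarrow> real"
  assumes "\<And>z. \<bar>f z - f y - D * (z - y)\<bar> \<le> (z - y)\<^sup>2"
  shows "(f has_real_derivative D) (at y)"
proof -
  have "\<bar>(f z - f y) / (z - y) - D\<bar> \<le> \<bar>z - y\<bar>" if "z \<noteq> y" for z
  proof -
    have "\<bar>(f z - f y) / (z - y) - D\<bar> = \<bar>f z - f y - D * (z - y)\<bar> / \<bar>z - y\<bar>"
    proof -
      have "(f z - f y) / (z - y) - D = (f z - f y - D * (z - y)) / (z - y)"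
        using that by (simp add: diff_divide_distrib)
      then show ?thesis by (simp add: abs_divide)
    qed
    also have "\<dots> \<le> (z - y)\<^sup>2 / \<bar>z - y\<bar>"
      using assms[of z] by (intro divide_right_mono) auto
    also have "\<dots> = \<bar>z - y\<bar>"
    proof -
      have "(z - y)\<^sup>2 = \<bar>z - y\<bar> * \<bar>z - y\<bar>"
        by (simp only: power2_eq_square abs_mult_self_eq)
      then show ?thesis using that by (simp del: abs_mult_self_eq)
    qed
    finally show ?thesis .
  qed
  then have 1: "\<forall>\<^sub>F z in at y. norm ((f z - f y) / (z - y) - D) \<le> \<bar>z - y\<bar>"
    unfolding eventually_at_filter by (intro always_eventually) simp
  have "((\<lambda>z. \<bar>z - y\<bar>) \<longlongrightarrow> \<bar>y - y\<bar>) (at y)"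
    by (intro tendsto_intros)
  then have 2: "((\<lambda>z. \<bar>z - y\<bar>) \<longlongrightarrow> 0) (at y)" by simp
  have "((\<lambda>z. (f z - f y) / (z - y) - D) \<longlongrightarrow> 0) (at y)"
    by (rule Lim_null_comparison[OF 1 2])
  then show ?thesis
    unfolding has_field_derivative_iff by (rule LIM_zero_cancel)
qed

text \<open>With a = \<open>l\<^sub>0\<close> and b = \<open>l\<^sub>1\<close>, the three outer
  branches of the potential in one formula, whose slope is visibly Lipschitz across both edges of
  the well.\<close>

definition well_outer :: "real \<Rightarrow> real \<Rightarrow> real \<Rightarrow> real" where
  "well_outer a b r = (min (r - a) 0)\<^sup>2 + (max (r - b) 0)\<^sup>2"

lemma max_quadratic_bound:
  fixes y z :: real
  shows "\<bar>(max z 0)\<^sup>2 - (max y 0)\<^sup>2 - 2 * max y 0 * (z - y)\<bar> \<le> (z - y)\<^sup>2"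
proof (cases "z \<ge> 0"; cases "y \<ge> 0")
  assume *: "z \<ge> 0" "y \<ge> 0"
  have "z\<^sup>2 - y\<^sup>2 - 2 * y * (z - y) = (z - y)\<^sup>2"
    by (simp add: power2_eq_square algebra_simps)
  then show ?thesis using * by simp
next
  assume *: "z \<ge> 0" "\<not> y \<ge> 0"
  then have "z\<^sup>2 \<le> (z - y)\<^sup>2" by (intro power_mono) auto
  then show ?thesis using * by (simp add: max_def)
next
  assume *: "\<not> z \<ge> 0" "y \<ge> 0"
  have "- y\<^sup>2 - 2 * y * (z - y) = (z - y)\<^sup>2 - z\<^sup>2"
    by (simp add: power2_eq_square algebra_simps)
  moreover have "0 \<le> y * (y - 2 * z)" using * by (intro mult_nonneg_nonneg) auto
  then have "z\<^sup>2 \<le> (z - y)\<^sup>2" by (simp add: power2_eq_square algebra_simps)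
  moreover have "\<bar>(z - y)\<^sup>2 - z\<^sup>2\<bar> \<le> (z - y)\<^sup>2" using calculation zero_le_power2[of z] by linarith
  ultimately show ?thesis using * by (simp add: max_def)
next
  assume *: "\<not> z \<ge> 0" "\<not> y \<ge> 0"
  then show ?thesis by (simp add: max_def)
qed

lemma max_squared_derivative:
  fixes r b :: real
  shows "((\<lambda>r. (max (r - b) 0)\<^sup>2) has_real_derivative 2 * max (r - b) 0) (at r)"
  using max_quadratic_bound[of "_ - b" "r - b"] by (intro has_derivative_if_quadratic_bound) simp

lemma min_squared_derivative:
  fixes r a :: real
  shows "((\<lambda>r. (min (r - a) 0)\<^sup>2) has_real_derivative 2 * min (r - a) 0) (at r)"
proof (rule has_derivative_if_quadratic_bound)
  fix z
  have m: "min y 0 = - max (- y) 0" for y :: real by (simp add: min_def max_def)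
  show "\<bar>(min (z - a) 0)\<^sup>2 - (min (r - a) 0)\<^sup>2 - 2 * min (r - a) 0 * (z - r)\<bar> \<le> (z - r)\<^sup>2"
    using max_quadratic_bound[of "a - z" "a - r"] unfolding m[of "z - a"] m[of "r - a"]
    by (simp add: power2_commute[of r z] algebra_simps)
qed

lemma well_outer_derivative:
  "(well_outer a b has_real_derivative 2 * min (r - a) 0 + 2 * max (r - b) 0) (at r)"
  unfolding well_outer_def[abs_def]
  by (rule DERIV_add[OF min_squared_derivative max_squared_derivative])

lemma well_outer_slope_lipschitz:
  "4-lipschitz_on S (\<lambda>r::real. 2 * min (r - a) 0 + 2 * max (r - b) 0)"
proof (rule lipschitz_onI)
  fix x y :: real
  define p q where "p = min (x - a) 0 - min (y - a) 0" and "q = max (x - b) 0 - max (y - b) 0"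
  have pq: "\<bar>p\<bar> \<le> \<bar>x - y\<bar>" "\<bar>q\<bar> \<le> \<bar>x - y\<bar>"
    by (auto simp: p_def q_def)
  have "\<bar>2 * p + 2 * q\<bar> \<le> 2 * \<bar>p\<bar> + 2 * \<bar>q\<bar>"
    using abs_triangle_ineq[of "2 * p" "2 * q"] by (simp add: abs_mult)
  also have "\<dots> \<le> 2 * \<bar>x - y\<bar> + 2 * \<bar>x - y\<bar>"
    by (intro add_mono mult_left_mono pq) simp_all
  also have "\<dots> = 4 * \<bar>x - y\<bar>" by simp
  finally have "\<bar>2 * p + 2 * q\<bar> \<le> 4 * \<bar>x - y\<bar>" .
  then show "dist (2 * min (x - a) 0 + 2 * max (x - b) 0) (2 * min (y - a) 0 + 2 * max (y - b) 0) \<le> 4 * dist x y"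
    by (simp add: p_def q_def dist_real_def algebra_simps)
qed simp

lemma has_derivative_from_sides:
  fixes f :: "real \<Rightarrow> real"
  assumes "(f has_real_derivative D) (at x within {a..x})" "(f has_real_derivative D) (at x within {x..b})"
    and "a < x" "x < b"
  shows "(f has_real_derivative D) (at x)"
proof -
  have "(f has_real_derivative D) (at x within {a..x} \<union> {x..b})"
    using assms(1,2) unfolding has_field_derivative_iff by (rule Lim_Un)
  moreover have "at x within {a..x} \<union> {x..b} = at x"
    using assms(3,4) by (intro at_within_interior) (auto simp: ivl_disj_un_two_touch)
  ultimately show ?thesis by simp
qed

text \<open>If |y| <= |x|, the difference splits into a change of magnitude along x, of size at most
  K |x - y|, and a change of direction at radius |y|, of size at most 2 K |x - y| because |w s| <= K
  s.\<close>

lemma lipschitz_on_radial_field: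
  fixes w :: "real \<Rightarrow> real"
  assumes "K-lipschitz_on {0..} w" "w 0 = 0"
  shows "(3 * K)-lipschitz_on UNIV (\<lambda>x::'a::real_normed_vector. (w (norm x) / norm x) *\<^sub>R x)"
proof -
  define G where "G x = (w (norm x) / norm x) *\<^sub>R x" for x :: 'a
  have K: "K \<ge> 0" using assms(1) lipschitz_on_nonneg by blast
  have w: "\<bar>w r - w s\<bar> \<le> K * \<bar>r - s\<bar>" if "r \<ge> 0" "s \<ge> 0" for r s
    using lipschitz_onD[OF assms(1), of r s] that by (simp add: dist_real_def)
  have G: "norm (G x - G y) \<le> 3 * K * norm (x - y)" if le: "norm y \<le> norm x" for x y
  proof -
    define r s where "r = norm x" and "s = norm y"
    have rs: "0 \<le> s" "s \<le> r" "r - s \<le> norm (x - y)"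
      using le norm_triangle_ineq2[of x y] by (auto simp: r_def s_def)
    have ws: "\<bar>w s\<bar> \<le> K * s" using w[of s 0] rs assms(2) by simp
    consider "r = 0" | "r > 0" "s = 0" | "r > 0" "s > 0" using rs by linarith
    then show ?thesis
    proof cases
      case 1
      then have "x = 0" "y = 0" using le by (auto simp: r_def)
      then show ?thesis by simp
    next
      case 2
      then have "y = 0" by (simp add: s_def)
      moreover have "norm (G x) = \<bar>w r\<bar>" using 2 by (simp add: G_def r_def)
      moreover have "\<bar>w r\<bar> \<le> K * r" using w[of r 0] 2 assms(2) by simp
      moreover have "K * r \<le> 3 * K * r" using K 2 by (simp add: mult_right_mono)
      ultimately show ?thesis by (simp add: G_def r_def)
    next
      case 3
      have "G x - G y = ((w r - w s) / r) *\<^sub>R x + (w s / s) *\<^sub>R ((s / r) *\<^sub>R x - y)"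
        using 3 by (simp add: G_def r_def s_def algebra_simps diff_divide_distrib)
      also have "norm \<dots> \<le> norm (((w r - w s) / r) *\<^sub>R x) + norm ((w s / s) *\<^sub>R ((s / r) *\<^sub>R x - y))"
        by (rule norm_triangle_ineq)
      also have "norm (((w r - w s) / r) *\<^sub>R x) = \<bar>w r - w s\<bar>"
        using 3 by (simp add: r_def)
      also have "\<dots> \<le> K * norm (x - y)"
        using w[of r s] rs K mult_left_mono[OF rs(3) K] by simp
      also have "norm ((w s / s) *\<^sub>R ((s / r) *\<^sub>R x - y)) \<le> K * (2 * norm (x - y))"
      proof -
        have eq: "(s / r) *\<^sub>R x - y = (x - y) - ((r - s) / r) *\<^sub>R x"
          using 3 by (simp add: algebra_simps diff_divide_distrib)
        have "norm (((r - s) / r) *\<^sub>R x) = r - s"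
          using 3 rs by (simp add: r_def)
        then have "norm ((s / r) *\<^sub>R x - y) \<le> 2 * norm (x - y)"
          unfolding eq using norm_triangle_ineq4[of "x - y" "((r - s) / r) *\<^sub>R x"] rs by simp
        moreover have "\<bar>w s / s\<bar> \<le> K" using ws 3 by (simp add: abs_divide pos_divide_le_eq)
        ultimately show ?thesis 
          using K by (simp only: norm_scaleR) (rule mult_mono, simp_all)
      qed
      finally show ?thesis by simp
    qed
  qed
  have "(3 * K)-lipschitz_on UNIV G"
  proof (rule lipschitz_onI)
    fix x y
    show "dist (G x) (G y) \<le> 3 * K * dist x y"
      using G[of x y] G[of y x] by (cases "norm y \<le> norm x") (auto simp: dist_norm norm_minus_commute)
  qed (use K in auto)
  then show ?thesis by (simp add: G_def[abs_def])
qed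

lemma gderiv_zero_if_even:
  fixes f :: "'a::real_inner \<Rightarrow> real"
  assumes "f differentiable at 0" "\<And>x. f (- x) = f x"
  shows "GDERIV f 0 :> 0"
proof -
  obtain D where D: "(f has_derivative D) (at 0)"
    using assms(1) by (auto simp: differentiable_def)
  have "((\<lambda>x. f (- x)) has_derivative (\<lambda>h. D (- h))) (at 0)"
    by (rule has_derivative_compose[where f = uminus]) (auto intro!: derivative_eq_intros simp: D)
  then have "D = (\<lambda>h. D (- h))"
    using D has_derivative_unique assms(2) by (metis (no_types, lifting) ext)
  then have "D h = - D h" for h
    using linear_neg[OF has_derivative_linear[OF D]] by metis
  then have "D = (\<lambda>h. inner h 0)" by (auto simp: fun_eq_iff)
  then show ?thesis using D by (simp add: gderiv_def)
qed

text \<open>A symmetric second difference at c equals (right slope - left slope) h + o(h). A bound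
  of order h^2 therefore forces the slopes to agree.\<close>

lemma well_outer_slope_at_kink:
  fixes u :: "real \<Rightarrow> real"
  assumes "(u has_real_derivative d) (at c within {0<..c})" "0 < c" "c < l" "M \<ge> 0"
    and "\<And>h. 0 < h \<Longrightarrow> h \<le> 1 \<Longrightarrow> h < c \<Longrightarrow> \<bar>u (c + h) + u (c - h) - 2 * u c\<bar> \<le> M * h\<^sup>2"
    and "\<And>r. c \<le> r \<Longrightarrow> r \<le> l \<Longrightarrow> u r = (r - l)\<^sup>2"
  shows "d = 2 * (c - l)"
proof (rule ccontr)
  \<comment> \<open>A third of the gap between the slopes: the left remainder and the quadratic
    terms cost at most e h each, against a gap of 3 e h.\<close>
  define e where "e = \<bar>d - 2 * (c - l)\<bar> / 3"
  assume "d \<noteq> 2 * (c - l)"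
  then have e: "e > 0" by (simp add: e_def)
  have "(u has_derivative (\<lambda>h. d * h)) (at c within {0<..c})"
    using assms(1) by (simp add: has_field_derivative_def mult_commute_abs)
  then obtain \<delta> where \<delta>: "\<delta> > 0" "\<And>y. y \<in> {0<..c} \<Longrightarrow> \<bar>y - c\<bar> < \<delta> \<Longrightarrow> \<bar>u y - u c - d * (y - c)\<bar> \<le> e * \<bar>y - c\<bar>"
    unfolding has_derivative_within_alt using e by (metis real_norm_def)
  \<comment> \<open>Small enough for the left derivative, for c - h and c + h to stay in (0, l], and
    for (M + 1) h <= e.\<close>
  define h where "h = min (min (\<delta> / 2) (c / 2)) (min (min 1 (l - c)) (e / (M + 1)))"
  have h: "0 < h" "h < \<delta>" "h < c" "h \<le> 1" "h \<le> l - c" "h \<le> e / (M + 1)"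
    using \<delta>(1) e assms(2-4) unfolding h_def by (auto simp: min_less_iff_disj)
  have "(M + 1) * h \<le> e" using h(6) assms(4) by (simp add: field_simps)
  then have Mh: "(M + 1) * h * h \<le> e * h" using h(1) by simp
  have 1: "\<bar>u (c - h) - u c + d * h\<bar> \<le> e * h"
    using \<delta>(2)[of "c - h"] h by simp
  have "u (c + h) - u c = 2 * (c - l) * h + h * h"
    using assms(6)[of "c + h"] assms(6)[of c] h assms(3) by (simp add: power2_eq_square algebra_simps)
  then have 2: "\<bar>u (c - h) - u c + (2 * (c - l) * h + h * h)\<bar> \<le> M * h * h"
    using assms(5)[OF h(1,4,3)] by (simp add: power2_eq_square algebra_simps)
  have "\<bar>(d - 2 * (c - l)) * h\<bar> \<le> e * h + M * h * h + h * h"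
  proof -
    define p q where "p = u (c - h) - u c + d * h" and "q = u (c - h) - u c + (2 * (c - l) * h + h * h)"
    have "(d - 2 * (c - l)) * h = p - q + h * h" by (simp add: p_def q_def algebra_simps)
    moreover have "h * h \<ge> 0" by simp
    ultimately show ?thesis using 1 2 unfolding p_def[symmetric] q_def[symmetric] by linarith
  qed
  moreover have "\<bar>(d - 2 * (c - l)) * h\<bar> = 3 * (e * h)"
    using h(1) by (simp add: e_def abs_mult)
  moreover have "M * h * h + h * h \<le> e * h" using Mh by (simp add: algebra_simps)
  moreover have "e * h > 0" using e h by simp
  ultimately show False by linarith
qed

lemma has_derivative_imp_has_real_derivative:
  fixes f :: "real \<Rightarrow> real"
  assumes "(f has_derivative D) F"
  shows "(f has_real_derivative D 1) F"
proof -
  have "D h = D 1 * h" for h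
    using linear_scale[OF has_derivative_linear[OF assms], of h 1] by (simp add: mult.commute)
  then have e: "D = (*) (D 1)" by (rule ext)
  show ?thesis unfolding has_field_derivative_def by (subst e[symmetric]) (rule assms)
qed

text \<open>The end point r = c is included, so derivatives are compared through limits from the
  left.\<close>

lemma has_real_derivative_unique_left:
  fixes f :: "real \<Rightarrow> real"
  assumes "(f has_real_derivative d) (at r within {0<..c})" "(f has_real_derivative e) (at r within {0<..c})"
    and "0 < r" "r \<le> c"
  shows "d = e"
proof -
  have "(f has_real_derivative D) (at_left r)" if "(f has_real_derivative D) (at r within {0<..c})" for D
  proof -
    have "(f has_real_derivative D) (at r within {r/2..r})"
      by (rule DERIV_subset[OF that]) (use assms(3,4) in auto)
    then show ?thesis using assms(3) by (simp add: at_within_Icc_at_left)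
  qed
  from this[OF assms(1)] this[OF assms(2)] show ?thesis
    unfolding has_field_derivative_iff
    by (intro tendsto_unique[OF trivial_limit_at_left_real])
qed

lemma smooth_on_left_half_open:
  fixes u :: "real \<Rightarrow> real"
  assumes "smooth_on {0<..c} u"
  obtains F F' where "\<And>r. r \<in> {0<..c} \<Longrightarrow> (u has_real_derivative F r) (at r within {0<..c})"
    and "\<And>r. r \<in> {0<..c} \<Longrightarrow> (F has_real_derivative F' r) (at r within {0<..c})"
    and "continuous_on {0<..c} F'"
proof -
  define F where "F r = frechet_derivative u (at r within {0<..c}) 1" for r
  define F' where "F' r = frechet_derivative F (at r within {0<..c}) 1" for r
  have "Ck_on (Suc (Suc 0)) {0<..c} u" using assms unfolding smooth_on_def by blast
  then have "u differentiable_on {0<..c}" "F differentiable_on {0<..c}" "continuous_on {0<..c} F'"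
    by (auto simp: F_def[abs_def] F'_def[abs_def])
  then have "(u has_derivative frechet_derivative u (at r within {0<..c})) (at r within {0<..c})"
    "(F has_derivative frechet_derivative F (at r within {0<..c})) (at r within {0<..c})"
    if "r \<in> {0<..c}" for r
    using that by (simp_all add: differentiable_on_def frechet_derivative_works[symmetric])
  from this[THEN has_derivative_imp_has_real_derivative] show ?thesis
    using \<open>continuous_on {0<..c} F'\<close> by (intro that[of F F']) (simp_all add: F_def F'_def)
qed

text \<open>Along a coordinate axis a radial function reads u |s|; in this way the C^2 condition on
  the potential near the origin becomes one on the even extension of its profile.\<close>

lemma Ck_on_2_ray:
  fixes U :: "'a::euclidean_space \<Rightarrow> real"
  assumes "Ck_on 2 (ball 0 e) U" "b \<in> Basis"
  obtains V V' where "\<And>s. \<bar>s\<bar> < e \<Longrightarrow> ((\<lambda>s. U (s *\<^sub>R b)) has_real_derivative V s) (at s)"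
    and "\<And>s. \<bar>s\<bar> < e \<Longrightarrow> (V has_real_derivative V' s) (at s)"
    and "continuous_on {-e<..<e} V'"
proof -
  define B where "B = ball (0::'a) e"
  define V where "V y = frechet_derivative U (at y within B) b" for y
  define V' where "V' y = frechet_derivative V (at y within B) b" for y
  have "Ck_on (Suc (Suc 0)) B U" using assms(1) by (simp add: numeral_2_eq_2 B_def)
  then have d: "U differentiable_on B" "V differentiable_on B" "continuous_on B V'"
    using assms(2) by (auto simp: V_def[abs_def] V'_def[abs_def])
  have B: "s *\<^sub>R b \<in> B" if "\<bar>s\<bar> < e" for s using that assms(2) by (simp add: B_def)
  have at: "at y within B = at y" if "y \<in> B" for y
    using that by (intro at_within_open) (auto simp: B_def)
  have "((\<lambda>s. U (s *\<^sub>R b)) has_real_derivative V (s *\<^sub>R b)) (at s)" if "\<bar>s\<bar> < e" for s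
  proof -
    have "(U has_derivative frechet_derivative U (at (s *\<^sub>R b) within B)) (at (0 + s *\<^sub>R b))"
      using d(1) B[OF that] by (simp add: differentiable_on_def at frechet_derivative_works[symmetric])
    from partial_along_line[OF this] show ?thesis by (simp add: V_def)
  qed
  moreover have "((\<lambda>s. V (s *\<^sub>R b)) has_real_derivative V' (s *\<^sub>R b)) (at s)" if "\<bar>s\<bar> < e" for s
  proof -
    have "(V has_derivative frechet_derivative V (at (s *\<^sub>R b) within B)) (at (0 + s *\<^sub>R b))"
      using d(2) B[OF that] by (simp add: differentiable_on_def at frechet_derivative_works[symmetric])
    from partial_along_line[OF this] show ?thesis by (simp add: V'_def)
  qed
  moreover have "continuous_on {-e<..<e} (\<lambda>s. V' (s *\<^sub>R b))"
    by (rule continuous_on_compose2[OF d(3)]) (auto intro!: continuous_intros B)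
  ultimately show ?thesis by (rule that)
qed

text \<open>w is the slope of the profile, set to 0 at r = 0, and \<eta> supplies the mollifier. The
  field is Lipschitz because w is: near 0 by the C^2 condition, up to \<open>l\<^sub>0 / 2\<close>
  by smoothness, beyond by the explicit formula, the pieces being glued where their values
  agree.\<close>

lemma well_potential_gradient:
  fixes u :: "real \<Rightarrow> real" and \<eta> :: "real^'n::finite \<Rightarrow> real"
  assumes l: "0 < l\<^sub>0" "l\<^sub>0 \<le> l\<^sub>1" and wp: "well_potential TYPE('n) l\<^sub>0 l\<^sub>1 u"
    and \<eta>: "test_function \<eta>" "\<And>x. \<eta> x \<ge> 0" "\<eta> 0 > 0"
  obtains w K where "\<And>x::real^'n. GDERIV (radial u) x :> (w (norm x) / norm x) *\<^sub>R x"
    and "K-lipschitz_on UNIV (\<lambda>x::real^'n. (w (norm x) / norm x) *\<^sub>R x)"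
    and "\<And>r. 0 < r \<Longrightarrow> r < l\<^sub>0 \<Longrightarrow> w r < 0"
    and "\<And>r. l\<^sub>0 / 2 \<le> r \<Longrightarrow> w r = 2 * min (r - l\<^sub>0) 0 + 2 * max (r - l\<^sub>1) 0"
proof -
  define c where "c = l\<^sub>0 / 2"
  define P where "P r = 2 * min (r - l\<^sub>0) 0 + 2 * max (r - l\<^sub>1) 0" for r
  have c: "0 < c" "c < l\<^sub>0" using l by (auto simp: c_def)
  have wp': "W_inf_loc 2 (radial u :: real^'n \<Rightarrow> real)" "smooth_on {0<..c} u"
    "\<And>r. r \<in> {0<..c} \<Longrightarrow> vector_derivative u (at r within {0<..c}) < 0"
    "\<And>r. c \<le> r \<Longrightarrow> r \<le> l\<^sub>0 \<Longrightarrow> u r = (r - l\<^sub>0)\<^sup>2"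
    "\<And>r. l\<^sub>0 \<le> r \<Longrightarrow> r \<le> l\<^sub>1 \<Longrightarrow> u r = 0" "\<And>r. r \<ge> l\<^sub>1 \<Longrightarrow> u r = (r - l\<^sub>1)\<^sup>2"
    using wp by (auto simp: well_potential_def c_def power2_commute[of l\<^sub>0])
  obtain e where e: "e > 0" "Ck_on 2 (ball 0 e) (radial u :: real^'n \<Rightarrow> real)"
    using wp by (auto simp: well_potential_def)
  have outer: "u r = well_outer l\<^sub>0 l\<^sub>1 r" if "c \<le> r" for r
  proof -
    consider "r \<le> l\<^sub>0" | "l\<^sub>0 \<le> r" "r \<le> l\<^sub>1" | "l\<^sub>1 \<le> r" "l\<^sub>0 \<le> r" using l by linarith
    then show ?thesis
      by cases (use that l wp'(4-6)[of r] in \<open>auto simp: well_outer_def min_def max_def\<close>)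
  qed
  obtain F F' where F: "\<And>r. r \<in> {0<..c} \<Longrightarrow> (u has_real_derivative F r) (at r within {0<..c})"
    "\<And>r. r \<in> {0<..c} \<Longrightarrow> (F has_real_derivative F' r) (at r within {0<..c})"
    "continuous_on {0<..c} F'"
    by (rule smooth_on_left_half_open[OF wp'(2)]) blast
  have Fneg: "F r < 0" if r: "r \<in> {0<..c}" for r
  proof -
    have "(u has_vector_derivative F r) (at r within {0<..c})"
      using F(1)[OF r] by (simp add: has_real_derivative_iff_has_vector_derivative)
    then have "u differentiable (at r within {0<..c})"
      by (auto simp: has_vector_derivative_def intro: differentiableI)
    then have "(u has_real_derivative vector_derivative u (at r within {0<..c})) (at r within {0<..c})"
      by (simp add: vector_derivative_works has_real_derivative_iff_has_vector_derivative)
    then have "vector_derivative u (at r within {0<..c}) = F r"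
      using r by (intro has_real_derivative_unique_left[OF _ F(1)]) auto
    then show ?thesis using wp'(3)[OF r] by simp
  qed
  obtain b :: "real^'n" where b: "b \<in> Basis" using nonempty_Basis by blast
  have rb: "radial u (s *\<^sub>R b) = u \<bar>s\<bar>" for s using b by (simp add: radial_def)
  obtain V V' where V: "\<And>s. \<bar>s\<bar> < e \<Longrightarrow> ((\<lambda>s. u \<bar>s\<bar>) has_real_derivative V s) (at s)"
    "\<And>s. \<bar>s\<bar> < e \<Longrightarrow> (V has_real_derivative V' s) (at s)" "continuous_on {-e<..<e} V'"
    by (rule Ck_on_2_ray[OF e(2) b, unfolded rb]) blast
  \<comment> \<open>The derivative of an even function vanishes at 0.\<close>
  have V0: "V 0 = 0"
  proof -
    have "((\<lambda>s. u \<bar>- s\<bar>) has_real_derivative V 0 * - 1) (at 0)"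
      by (rule DERIV_chain2[where g = uminus]) (use V(1)[of 0] e in \<open>auto intro!: derivative_eq_intros\<close>)
    then have "V 0 = V 0 * - 1"
      using V(1)[of 0] e by (intro DERIV_unique[of "\<lambda>s. u \<bar>s\<bar>" _ 0]) auto
    then show ?thesis by simp
  qed
  have FV: "F s = V s" if "0 < s" "s \<le> c" "s < e" for s
  proof (rule has_real_derivative_unique_left)
    have "((\<lambda>s. u \<bar>s\<bar>) has_real_derivative V s) (at s within {0<..c})"
      using V(1)[of s] that has_field_derivative_at_within by auto
    then show "(u has_real_derivative V s) (at s within {0<..c})"
      by (rule has_field_derivative_transform_within[OF _ zero_less_one]) (use that in auto)
  qed (use F that in auto)
  have cont: "continuous_on {0..} u"
  proof -
    have "continuous (at r within {0..c}) u" if r: "r \<in> {0..c}" for r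
    proof (cases "r = 0")
      case True
      have "isCont (\<lambda>s. u \<bar>s\<bar>) 0"
        by (rule DERIV_isCont[OF V(1)]) (simp add: e(1))
      then have "continuous (at 0 within {0..c}) (\<lambda>s. u \<bar>s\<bar>)"
        by (rule continuous_at_imp_continuous_at_within)
      then show ?thesis
        unfolding True by (rule continuous_transform_within[OF _ zero_less_one]) (use c in auto)
    next
      case False
      have "at r within {0..c} = at r within {0<..c}"
        using False r by (intro at_within_nhd[of r "{0<..}"]) auto
      moreover have "continuous (at r within {0<..c}) u"
        by (rule DERIV_continuous[OF F(1)]) (use False r in auto)
      ultimately show ?thesis by simp
    qed
    then have "continuous_on {0..c} u" by (simp add: continuous_on_eq_continuous_within)
    moreover have "continuous_on {c..} (well_outer l\<^sub>0 l\<^sub>1)"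
      by (intro continuous_at_imp_continuous_on ballI DERIV_isCont[OF well_outer_derivative])
    then have "continuous_on {c..} u" 
      by (rule continuous_on_eq) (use outer in auto)
    ultimately have "continuous_on ({0..c} \<union> {c..}) u" by (intro continuous_on_closed_Un) auto
    moreover have "{0..c} \<union> {c..} = {0..}" using c by auto
    ultimately show ?thesis by simp
  qed
  have contU: "continuous_on UNIV (radial u :: real^'n \<Rightarrow> real)"
    unfolding radial_def[abs_def]
    by (rule continuous_on_compose2[OF cont]) (auto intro!: continuous_intros)
  \<comment> \<open>The one place where the Sobolev regularity enters: it bounds the second
    difference at the junction c.\<close>
  obtain M where M: "M \<ge> 0" "\<And>h. 0 < h \<Longrightarrow> h \<le> 1 \<Longrightarrow>
      \<bar>radial u (c *\<^sub>R b + h *\<^sub>R b) + radial u (c *\<^sub>R b - h *\<^sub>R b) - 2 * radial u (c *\<^sub>R b)\<bar> \<le> M * h\<^sup>2"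
    using W_inf_loc_2_second_difference[OF wp'(1) contU b \<eta>, of "c *\<^sub>R b"] by blast
  have Fc: "F c = 2 * (c - l\<^sub>0)"
  proof (rule well_outer_slope_at_kink[OF F(1) c(1,2) M(1)])
    fix h :: real assume h: "0 < h" "h \<le> 1" "h < c"
    show "\<bar>u (c + h) + u (c - h) - 2 * u c\<bar> \<le> M * h\<^sup>2"
      using M(2)[OF h(1,2)] c h
      unfolding scaleR_left_distrib[symmetric] scaleR_left_diff_distrib[symmetric] rb by simp
  qed (use c wp'(4) in auto)
  \<comment> \<open>At c the outer formula is used; by \<open>Fc\<close> it agrees with the inner
    slope F.\<close>
  define w where "w r = (if r \<le> 0 then 0 else if r < c then F r else P r)" for r
  have wc: "w r = F r" if "0 < r" "r \<le> c" for r
    using that Fc c l by (auto simp: w_def P_def min_def max_def)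
  have du: "(u has_real_derivative w r) (at r)" if r: "r > 0" for r
  proof -
    have right: "(u has_real_derivative P r) (at r within {r..r + 1})" if "c \<le> r"
    proof -
      have "(well_outer l\<^sub>0 l\<^sub>1 has_real_derivative P r) (at r within {r..r + 1})"
        unfolding P_def by (rule has_field_derivative_at_within[OF well_outer_derivative])
      then show ?thesis
        by (rule has_field_derivative_transform_within[OF _ zero_less_one]) (use outer that in auto)
    qed
    consider "r < c" | "r = c" | "r > c" by linarith
    then show ?thesis
    proof cases
      case 1
      have "(u has_real_derivative F r) (at r within {0<..<c})"
        by (rule DERIV_subset[OF F(1)]) (use r 1 in auto)
      then show ?thesis using r 1 wc[of r] by (simp add: at_within_open[of r "{0<..<c}"])
    next
      case 2
      have "(u has_real_derivative F r) (at r within {r/2..r})"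
        by (rule DERIV_subset[OF F(1)]) (use r 2 in auto)
      then show ?thesis
        using right 2 r wc[of c] by (intro has_derivative_from_sides[of u _ r "r/2" "r + 1"]) (auto simp: w_def)
    next
      case 3
      have "(u has_real_derivative P r) (at r within {c<..})"
        using has_field_derivative_at_within[OF well_outer_derivative] unfolding P_def
        by (rule has_field_derivative_transform_within[OF _ zero_less_one]) (use outer 3 in auto)
      then show ?thesis using 3 r c by (simp add: at_within_open[of r "{c<..}"] w_def)
    qed
  qed
  have "\<exists>K. K-lipschitz_on {0..} w"
  proof -
    \<comment> \<open>Up to \<rho> the C^2 ball controls the slope, from \<rho> to c the smooth
      branch; both ranges are compact and carry a continuous derivative of the slope.\<close>
    define \<rho> where "\<rho> = min (e / 2) (c / 2)"
    have \<rho>: "0 < \<rho>" "\<rho> < e" "\<rho> < c" using e c by (auto simp: \<rho>_def)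
    obtain K1 where "K1-lipschitz_on {0..\<rho>} V"
    proof (rule lipschitz_on_if_C1)
      show "(V has_real_derivative V' x) (at x within {0..\<rho>})" if "x \<in> {0..\<rho>}" for x
        using V(2)[of x] that \<rho> has_field_derivative_at_within by auto
      show "continuous_on {0..\<rho>} V'"
        using V(3) by (rule continuous_on_subset) (use \<rho> in auto)
    qed
    then have K1: "K1-lipschitz_on {0..\<rho>} w"
      by (rule lipschitz_on_transform) (use \<rho> V0 FV in \<open>auto simp: w_def\<close>)
    obtain K2 where "K2-lipschitz_on {\<rho>..c} F"
    proof (rule lipschitz_on_if_C1)
      show "(F has_real_derivative F' x) (at x within {\<rho>..c})" if "x \<in> {\<rho>..c}" for x
        by (rule DERIV_subset[OF F(2)]) (use that \<rho> in auto)
      show "continuous_on {\<rho>..c} F'"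
        using F(3) by (rule continuous_on_subset) (use \<rho> in auto)
    qed
    then have K2: "K2-lipschitz_on {\<rho>..c} w"
      by (rule lipschitz_on_transform) (use \<rho> wc in auto)
    have K3: "4-lipschitz_on {c..R} w" for R
      using well_outer_slope_lipschitz[of "{c..R}" l\<^sub>0 l\<^sub>1]
      by (rule lipschitz_on_transform) (use c in \<open>auto simp: w_def P_def\<close>)
    have K: "(max (max K1 K2) 4)-lipschitz_on {0..R} w" for R
      using lipschitz_on_glue[OF lipschitz_on_glue[OF K1 K2] K3] .
    have "(max (max K1 K2) 4)-lipschitz_on {0..} w"
    proof (rule lipschitz_onI)
      fix x y :: real assume "x \<in> {0..}" "y \<in> {0..}"
      then show "dist (w x) (w y) \<le> max (max K1 K2) 4 * dist x y"
        by (intro lipschitz_onD[OF K[of "max x y"]]) auto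
    qed simp
    then show ?thesis ..
  qed
  then obtain K where K: "K-lipschitz_on {0..} w" ..
  show ?thesis
  proof (rule that[of w "3 * K"])
    show "GDERIV (radial u) x :> (w (norm x) / norm x) *\<^sub>R x" for x :: "real^'n"
    proof (cases "x = 0")
      case True
      have "radial u differentiable at (0::real^'n)"
      proof -
        have "radial u differentiable_on ball (0::real^'n) e"
          using e(2) by (simp add: numeral_2_eq_2)
        then show ?thesis using e(1) by (simp add: differentiable_on_eq_differentiable_at)
      qed
      then have "GDERIV (radial u) (0::real^'n) :> 0"
        by (rule gderiv_zero_if_even) (simp add: radial_def)
      then show ?thesis by (simp add: True)
    next
      case False
      then have "GDERIV (\<lambda>x. u (norm x)) x :> w (norm x) *\<^sub>R sgn x"
        by (intro GDERIV_DERIV_compose GDERIV_norm du) auto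
      then show ?thesis by (simp add: radial_def[abs_def] sgn_div_norm divide_inverse)
    qed
    show "(3 * K)-lipschitz_on UNIV (\<lambda>x::real^'n. (w (norm x) / norm x) *\<^sub>R x)"
      by (rule lipschitz_on_radial_field[OF K]) (simp add: w_def)
    show "w r < 0" if "0 < r" "r < l\<^sub>0" for r
    proof (cases "r < c")
      case True
      then show ?thesis using Fneg[of r] wc[of r] that by simp
    next
      case False
      then show ?thesis using that l c by (simp add: w_def P_def)
    qed
    show "w r = 2 * min (r - l\<^sub>0) 0 + 2 * max (r - l\<^sub>1) 0" if "l\<^sub>0 / 2 \<le> r" for r
      using that c by (auto simp: w_def P_def c_def)
  qed
qed

section \<open>Damped motion in the well\<close>

lemma has_real_derivative_inner:
  fixes f g :: "real \<Rightarrow> 'a::real_inner"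
  assumes "(f has_vector_derivative f') (at t within S)" "(g has_vector_derivative g') (at t within S)"
  shows "((\<lambda>t. f t \<bullet> g t) has_real_derivative (f t \<bullet> g' + f' \<bullet> g t)) (at t within S)"
  using bounded_bilinear.has_vector_derivative[OF bounded_bilinear_inner assms]
  by (simp add: has_real_derivative_iff_has_vector_derivative)

text \<open>The two-sided hypothesis on f' also bounds f from below, which yields uniqueness
  backward in time.\<close>

lemma gronwall_two_sided:
  fixes f :: "real \<Rightarrow> real"
  assumes "\<And>t. t \<ge> 0 \<Longrightarrow> (f has_real_derivative f' t) (at t within {0..})"
    and "\<And>t. t \<ge> 0 \<Longrightarrow> \<bar>f' t\<bar> \<le> C * f t" and "t \<ge> 0"
  shows "f t \<le> exp (C * t) * f 0" "f 0 \<le> exp (C * t) * f t"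
proof -
  have "exp (- C * t) * f t \<le> exp (- C * 0) * f 0"
  proof (rule nonincreasing_if_deriv_nonpos[where f = "\<lambda>t. exp (- C * t) * f t" and a = 0
        and f' = "\<lambda>r. exp (- C * r) * (f' r - C * f r)"])
    show "((\<lambda>t. exp (- C * t) * f t) has_real_derivative exp (- C * r) * (f' r - C * f r)) (at r within {0..})"
      if "r \<ge> 0" for r
      using assms(1)[OF that] by (auto intro!: derivative_eq_intros simp: algebra_simps)
    show "exp (- C * s) * (f' s - C * f s) \<le> 0" if "0 < s" "s < t" for s
      using abs_le_D1[OF assms(2)[of s]] that by (simp add: mult_nonneg_nonpos)
  qed (use assms(3) in auto)
  then have "exp (C * t) * (exp (- C * t) * f t) \<le> exp (C * t) * f 0"
    by (intro mult_left_mono) auto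
  then show "f t \<le> exp (C * t) * f 0"
    by (simp flip: mult.assoc exp_add)
  have "exp (C * 0) * f 0 \<le> exp (C * t) * f t"
  proof (rule nondecreasing_if_deriv_nonneg[where f = "\<lambda>t. exp (C * t) * f t" and a = 0
        and f' = "\<lambda>r. exp (C * r) * (f' r + C * f r)"])
    show "((\<lambda>t. exp (C * t) * f t) has_real_derivative exp (C * r) * (f' r + C * f r)) (at r within {0..})"
      if "r \<ge> 0" for r
      using assms(1)[OF that] by (auto intro!: derivative_eq_intros simp: algebra_simps)
    show "exp (C * s) * (f' s + C * f s) \<ge> 0" if "0 < s" "s < t" for s
      using abs_le_D2[OF assms(2)[of s]] that by simp
  qed (use assms(3) in auto)
  then show "f 0 \<le> exp (C * t) * f t" by simp
qed

lemma nonincreasing_convergent_at_top: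
  fixes f :: "real \<Rightarrow> real"
  assumes "\<And>s t. 0 \<le> s \<Longrightarrow> s \<le> t \<Longrightarrow> f t \<le> f s" "\<And>t. t \<ge> 0 \<Longrightarrow> f t \<ge> m"
  obtains L where "(f \<longlongrightarrow> L) at_top" "L \<ge> m"
proof -
  define L where "L = Inf (f ` {0..})"
  have bdd: "bdd_below (f ` {0..})" using assms(2) by (intro bdd_belowI2[of _ m]) simp
  have L: "L \<le> f t" if "t \<ge> 0" for t
    unfolding L_def by (rule cInf_lower[OF _ bdd]) (use that in auto)
  have "(f \<longlongrightarrow> L) at_top"
  proof (rule order_tendstoI)
    fix y assume "y < L"
    then show "\<forall>\<^sub>F t in at_top. y < f t"
      using L by (intro eventually_at_top_linorderI[of 0]) force
  next
    fix y assume "L < y"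
    then obtain s where s: "s \<ge> 0" "f s < y"
      using cInf_lessD[of "f ` {0..}" y] unfolding L_def by auto
    then show "\<forall>\<^sub>F t in at_top. f t < y"
      using assms(1) by (intro eventually_at_top_linorderI[of s]) force
  qed
  moreover have "L \<ge> m" unfolding L_def using assms(2) by (intro cInf_greatest) auto
  ultimately show ?thesis by (rule that)
qed

lemma has_vector_derivative_shift_atLeast:
  fixes f :: "real \<Rightarrow> 'a::real_normed_vector"
  assumes "(f has_vector_derivative f') (at (t + s) within {0..})" "s \<ge> 0"
  shows "((\<lambda>t. f (t + s)) has_vector_derivative f') (at t within {0..})"
proof -
  have "((\<lambda>t. t + s) has_vector_derivative 1) (at t within {0..})"
    by (auto intro!: derivative_eq_intros)
  moreover have "(f has_vector_derivative f') (at (t + s) within (\<lambda>t. t + s) ` {0..})"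
    by (rule has_vector_derivative_within_subset[OF assms(1)]) (use assms(2) in auto)
  ultimately have "(f \<circ> (\<lambda>t. t + s) has_vector_derivative 1 *\<^sub>R f') (at t within {0..})"
    by (rule vector_diff_chain_within)
  then show ?thesis by (simp add: o_def)
qed

text \<open>The relative motion in an arbitrary Euclidean space, with G the gradient of U, w the
  slope of the profile u, and K, P, B the Lipschitz constants of G and \<phi> and a bound of \<phi>.
  \<open>u_inner\<close> says that small energy keeps the particle out of |x| <=
  \<open>l\<^sub>0 / 2\<close>; \<open>u_max\<close> makes the origin a strict maximum over |x| <=
  \<open>l\<^sub>0\<close>.\<close>

locale damped_well =
  fixes \<phi> U :: "'a::euclidean_space \<Rightarrow> real" and G :: "'a \<Rightarrow> 'a" and u w :: "real \<Rightarrow> real"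
    and r\<^sub>0 l\<^sub>0 l\<^sub>1 K P B :: real
  assumes l: "0 < l\<^sub>0" "l\<^sub>0 \<le> l\<^sub>1" "l\<^sub>0 < r\<^sub>0"
    and U_eq: "U x = u (norm x)"
    and G_eq: "G x = (w (norm x) / norm x) *\<^sub>R x"
    and dU: "GDERIV U x :> G x"
    and G_lip: "K-lipschitz_on UNIV G"
    and \<phi>_lip: "P-lipschitz_on UNIV \<phi>"
    and \<phi>_bounds: "0 \<le> \<phi> x" "\<phi> x \<le> B"
    and \<phi>_even: "\<phi> (- x) = \<phi> x"
    and \<phi>_pos: "norm x < r\<^sub>0 \<Longrightarrow> \<phi> x > 0"
    and \<phi>_zero: "norm x \<ge> r\<^sub>0 \<Longrightarrow> \<phi> x = 0"
    and w_neg: "0 < r \<Longrightarrow> r < l\<^sub>0 \<Longrightarrow> w r < 0"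
    and w_outer: "l\<^sub>0 / 2 \<le> r \<Longrightarrow> w r = 2 * min (r - l\<^sub>0) 0 + 2 * max (r - l\<^sub>1) 0"
    and u_outer: "l\<^sub>0 / 2 \<le> r \<Longrightarrow> u r = (min (r - l\<^sub>0) 0)\<^sup>2 + (max (r - l\<^sub>1) 0)\<^sup>2"
    and u_inner: "0 \<le> r \<Longrightarrow> r \<le> l\<^sub>0 / 2 \<Longrightarrow> (l\<^sub>0 / 2)\<^sup>2 \<le> u r"
    and u_max: "0 < r \<Longrightarrow> r \<le> l\<^sub>0 \<Longrightarrow> u r < u 0"
begin

definition trajectory :: "(real \<Rightarrow> 'a) \<Rightarrow> (real \<Rightarrow> 'a) \<Rightarrow> bool" where
  "trajectory x v \<longleftrightarrow> (\<forall>t\<ge>0. (x has_vector_derivative v t) (at t within {0..}) \<and>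
     (v has_vector_derivative - (\<phi> (x t) *\<^sub>R v t) - G (x t)) (at t within {0..}))"

definition energy :: "'a \<Rightarrow> 'a \<Rightarrow> real" where
  "energy x v = (v \<bullet> v) / 2 + U x"

lemma trajectoryD:
  assumes "trajectory x v" "t \<ge> 0"
  shows "(x has_vector_derivative v t) (at t within {0..})"
    and "(v has_vector_derivative - (\<phi> (x t) *\<^sub>R v t) - G (x t)) (at t within {0..})"
  using assms by (auto simp: trajectory_def)

lemma constants_nonneg: "K \<ge> 0" "P \<ge> 0" "B \<ge> 0"
  using lipschitz_on_nonneg[OF G_lip] lipschitz_on_nonneg[OF \<phi>_lip] order_trans[OF \<phi>_bounds]
  by simp_all

lemma field_lipschitz:
  "norm (G x - G y) \<le> K * norm (x - y)" "\<bar>\<phi> x - \<phi> y\<bar> \<le> P * norm (x - y)"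
  using lipschitz_on_normD[OF G_lip, of x y] lipschitz_on_normD[OF \<phi>_lip, of x y] by simp_all

lemma U_nonneg: "U x \<ge> 0"
proof (cases "norm x \<le> l\<^sub>0 / 2")
  case True
  then have "0 \<le> (l\<^sub>0 / 2)\<^sup>2" "(l\<^sub>0 / 2)\<^sup>2 \<le> U x" using u_inner[of "norm x"] by (auto simp: U_eq)
  then show ?thesis by linarith
next
  case False
  then show ?thesis using u_outer[of "norm x"] by (simp add: U_eq)
qed

lemma continuous_U: "continuous_on S U"
  using has_derivative_continuous[OF dU[unfolded gderiv_def]]
  by (intro continuous_at_imp_continuous_on ballI)

lemma continuous_\<phi>: "continuous_on S \<phi>"
  by (rule continuous_on_subset[OF lipschitz_on_continuous_on[OF \<phi>_lip]]) simp

lemma energy_nonneg: "energy x v \<ge> 0"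
  using U_nonneg[of x] by (simp add: energy_def)

lemma norm_le_energy:
  assumes "energy x v \<le> e"
  shows "norm v \<le> sqrt (2 * e)" "norm x \<le> l\<^sub>1 + sqrt e" "U x \<le> e"
proof -
  have "v \<bullet> v \<le> 2 * e" using assms U_nonneg[of x] by (simp add: energy_def)
  then show "norm v \<le> sqrt (2 * e)" by (simp add: norm_eq_sqrt_inner)
  show U: "U x \<le> e" using assms inner_ge_zero[of v] unfolding energy_def by linarith
  then have e: "e \<ge> 0" using U_nonneg[of x] by linarith
  show "norm x \<le> l\<^sub>1 + sqrt e"
  proof (cases "norm x \<le> l\<^sub>1")
    case False
    then have "(norm x - l\<^sub>1)\<^sup>2 \<le> e" using U u_outer[of "norm x"] l by (simp add: U_eq)
    then have "norm x - l\<^sub>1 \<le> sqrt e" by (rule real_le_rsqrt)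
    then show ?thesis by simp
  qed (use e in \<open>simp add: add_increasing2\<close>)
qed

lemma U_derivative:
  assumes "(x has_vector_derivative x') (at t within S)"
  shows "((\<lambda>t. U (x t)) has_real_derivative (G (x t) \<bullet> x')) (at t within S)"
proof -
  have "(x has_derivative (\<lambda>h. h *\<^sub>R x')) (at t within S)"
    using assms by (simp add: has_vector_derivative_def)
  moreover have "(U has_derivative (\<lambda>h. h \<bullet> G (x t))) (at (x t))"
    using dU by (simp add: gderiv_def)
  ultimately have "((\<lambda>t. U (x t)) has_derivative (\<lambda>h. (h *\<^sub>R x') \<bullet> G (x t))) (at t within S)"
    by (rule has_derivative_compose)
  then show ?thesis
    by (simp add: has_field_derivative_def inner_commute mult_commute_abs)
qed

text \<open>The drag carries a vector y in place of v in order to cover the truncated velocity in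
  \<open>trajectory_exists\<close> as well.\<close>

lemma energy_derivative:
  assumes "(x has_vector_derivative v t) (at t within S)"
    and "(v has_vector_derivative - (\<phi> (x t) *\<^sub>R y) - G (x t)) (at t within S)"
  shows "((\<lambda>t. energy (x t) (v t)) has_real_derivative - (\<phi> (x t) * (v t \<bullet> y))) (at t within S)"
proof -
  have "((\<lambda>t. (v t \<bullet> v t) / 2 + U (x t)) has_real_derivative
      (v t \<bullet> (- (\<phi> (x t) *\<^sub>R y) - G (x t)) + (- (\<phi> (x t) *\<^sub>R y) - G (x t)) \<bullet> v t) / 2
      + G (x t) \<bullet> v t) (at t within S)"
    by (intro DERIV_add DERIV_cdivide has_real_derivative_inner U_derivative assms)
  moreover have "(v t \<bullet> (- (\<phi> (x t) *\<^sub>R y) - G (x t)) + (- (\<phi> (x t) *\<^sub>R y) - G (x t)) \<bullet> v t) / 2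
      + G (x t) \<bullet> v t = - (\<phi> (x t) * (v t \<bullet> y))"
    by (simp add: inner_diff_left inner_diff_right inner_commute field_simps)
  ultimately show ?thesis
    unfolding energy_def by simp
qed

lemma trajectory_energy_derivative:
  assumes "trajectory x v" "t \<ge> 0"
  shows "((\<lambda>t. energy (x t) (v t)) has_real_derivative - (\<phi> (x t) * (v t \<bullet> v t))) (at t within {0..})"
  using energy_derivative[OF trajectoryD[OF assms]] .

lemma trajectory_energy_nonincreasing:
  assumes "trajectory x v" "0 \<le> s" "s \<le> t"
  shows "energy (x t) (v t) \<le> energy (x s) (v s)"
  by (rule nonincreasing_if_deriv_nonpos[OF trajectory_energy_derivative[OF assms(1)]])
    (use assms \<phi>_bounds in auto)

lemma trajectory_shift:
  assumes "trajectory x v" "s \<ge> 0"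
  shows "trajectory (\<lambda>t. x (t + s)) (\<lambda>t. v (t + s))"
  using assms unfolding trajectory_def
  by (auto intro!: has_vector_derivative_shift_atLeast)

lemma trajectory_continuous:
  assumes "trajectory x v"
  shows "continuous_on {0..} x" "continuous_on {0..} v"
  using has_vector_derivative_continuous[OF trajectoryD(1)[OF assms]]
    has_vector_derivative_continuous[OF trajectoryD(2)[OF assms]]
  by (simp_all add: continuous_on_eq_continuous_within)

text \<open>The drag \<phi>(x) v is only locally Lipschitz, since the variation of \<phi> is
  multiplied by v. Projecting v to a ball, which does not increase distances, bounds this
  factor.\<close>

lemma truncated_field_lipschitz:
  assumes "R \<ge> 0"
  shows "\<exists>L. L-lipschitz_on UNIV (\<lambda>z. (snd z, - (\<phi> (fst z) *\<^sub>R closest_point (cball 0 R) (snd z)) - G (fst z)))"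
proof -
  define cl where "cl = closest_point (cball (0::'a) R)"
  have ne: "cball (0::'a) R \<noteq> {}" using assms by simp
  have cl: "norm (cl v) \<le> R" "norm (cl v - cl v') \<le> norm (v - v')" for v v'
  proof -
    have "cl v \<in> cball 0 R" unfolding cl_def by (rule closest_point_in_set[OF _ ne]) simp
    then show "norm (cl v) \<le> R" by simp
    show "norm (cl v - cl v') \<le> norm (v - v')"
      using closest_point_lipschitz[of "cball (0::'a) R" v v'] ne by (simp add: cl_def dist_norm)
  qed
  have D: "(B + P * R)-lipschitz_on UNIV (\<lambda>z. \<phi> (fst z) *\<^sub>R cl (snd z))"
  proof (rule lipschitz_onI)
    fix z z' :: "'a \<times> 'a"
    have n: "norm (fst z - fst z') \<le> norm (z - z')" "norm (snd z - snd z') \<le> norm (z - z')"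
      using dist_fst_le[of z z'] dist_snd_le[of z z'] by (simp_all add: dist_norm)
    have "\<phi> (fst z) *\<^sub>R cl (snd z) - \<phi> (fst z') *\<^sub>R cl (snd z')
        = \<phi> (fst z) *\<^sub>R (cl (snd z) - cl (snd z')) + (\<phi> (fst z) - \<phi> (fst z')) *\<^sub>R cl (snd z')"
      by (simp add: algebra_simps)
    also have "norm \<dots> \<le> \<phi> (fst z) * norm (cl (snd z) - cl (snd z')) + \<bar>\<phi> (fst z) - \<phi> (fst z')\<bar> * norm (cl (snd z'))"
      using \<phi>_bounds(1)[of "fst z"] by (intro order_trans[OF norm_triangle_ineq]) simp
    also have "\<dots> \<le> B * norm (z - z') + (P * norm (z - z')) * R"
    proof (intro add_mono mult_mono)
      show "norm (cl (snd z) - cl (snd z')) \<le> norm (z - z')" using cl(2) n(2) order_trans by blast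
      show "\<bar>\<phi> (fst z) - \<phi> (fst z')\<bar> \<le> P * norm (z - z')"
        using field_lipschitz(2)[of "fst z" "fst z'"] mult_left_mono[OF n(1) constants_nonneg(2)] by linarith
    qed (use \<phi>_bounds cl constants_nonneg in auto)
    finally show "dist (\<phi> (fst z) *\<^sub>R cl (snd z)) (\<phi> (fst z') *\<^sub>R cl (snd z')) \<le> (B + P * R) * dist z z'"
      by (simp add: dist_norm algebra_simps)
  qed (use constants_nonneg assms in auto)
  have s: "1-lipschitz_on UNIV (snd :: 'a \<times> 'a \<Rightarrow> 'a)"
    by (rule lipschitz_onI) (auto simp: dist_snd_le)
  have g: "K-lipschitz_on UNIV (\<lambda>z::'a \<times> 'a. G (fst z))"
  proof (rule lipschitz_onI)
    fix z z' :: "'a \<times> 'a"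
    show "dist (G (fst z)) (G (fst z')) \<le> K * dist z z'"
      using field_lipschitz(1)[of "fst z" "fst z'"] mult_left_mono[OF dist_fst_le[of z z'] constants_nonneg(1)]
      by (simp add: dist_norm)
  qed (rule constants_nonneg)
  have "(sqrt (1\<^sup>2 + ((B + P * R) + K)\<^sup>2))-lipschitz_on UNIV (\<lambda>z. (snd z, - (\<phi> (fst z) *\<^sub>R cl (snd z)) - G (fst z)))"
    by (rule lipschitz_on_Pair[OF s lipschitz_on_diff[OF lipschitz_on_minus[OF D] g]])
  then show ?thesis unfolding cl_def by blast
qed

text \<open>The truncated drag still satisfies v \<bullet> cl v >= 0, so the energy does not
  increase and |v| stays within the radius \<open>sqrt (2 * energy a b)\<close>. With this radius
  the truncation is never active.\<close>

lemma trajectory_exists: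
  obtains x v where "trajectory x v" "x 0 = a" "v 0 = b"
proof -
  define R where "R = sqrt (2 * energy a b)"
  have R: "R \<ge> 0" using energy_nonneg by (simp add: R_def)
  define cl where "cl = closest_point (cball (0::'a) R)"
  obtain L where L: "L-lipschitz_on UNIV (\<lambda>z. (snd z, - (\<phi> (fst z) *\<^sub>R cl (snd z)) - G (fst z)))"
    using truncated_field_lipschitz[OF R] unfolding cl_def by blast
  obtain z where z: "z 0 = (a, b)" "\<And>t. t \<ge> 0 \<Longrightarrow> (z has_vector_derivative
      (snd (z t), - (\<phi> (fst (z t)) *\<^sub>R cl (snd (z t))) - G (fst (z t)))) (at t within {0..})"
    by (rule lipschitz_ode_global_solution[OF L, of "(a, b)"]) blast
  define x v where "x t = fst (z t)" and "v t = snd (z t)" for t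
  have dx: "(x has_vector_derivative v t) (at t within {0..})"
    and dv: "(v has_vector_derivative - (\<phi> (x t) *\<^sub>R cl (v t)) - G (x t)) (at t within {0..})"
    if "t \<ge> 0" for t
    using bounded_linear.has_vector_derivative[OF bounded_linear_fst z(2)[OF that]]
      bounded_linear.has_vector_derivative[OF bounded_linear_snd z(2)[OF that]]
    by (simp_all add: x_def[abs_def] v_def[abs_def])
  have pos: "y \<bullet> cl y \<ge> 0" for y
  proof -
    have "(y - cl y) \<bullet> (0 - cl y) \<le> 0"
      unfolding cl_def by (rule closest_point_dot) (use R in auto)
    then have "cl y \<bullet> cl y \<le> y \<bullet> cl y" by (simp add: inner_diff_left)
    then show ?thesis using inner_ge_zero[of "cl y"] by linarith
  qed
  have "energy (x t) (v t) \<le> energy (x 0) (v 0)" if "t \<ge> 0" for t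
    by (rule nonincreasing_if_deriv_nonpos[OF energy_derivative[OF dx dv]])
      (use that pos \<phi>_bounds in \<open>auto intro!: mult_nonneg_nonneg\<close>)
  then have "norm (v t) \<le> R" if "t \<ge> 0" for t
    unfolding R_def using that z(1) by (intro norm_le_energy) (auto simp: x_def v_def)
  then have "cl (v t) = v t" if "t \<ge> 0" for t
    unfolding cl_def using that by (intro closest_point_self) auto
  then have "trajectory x v"
    unfolding trajectory_def using dx dv by metis
  then show ?thesis
    by (rule that) (use z(1) in \<open>auto simp: x_def v_def\<close>)
qed

text \<open>Splitting the drag difference into \<phi>(x) (v - z) and (\<phi>(x) - \<phi>(y)) z
  requires a velocity bound for one of the two trajectories only.\<close>

lemma trajectory_gronwall:
  assumes "trajectory x v" "trajectory y z" "\<And>t. t \<ge> 0 \<Longrightarrow> norm (z t) \<le> R" "t \<ge> 0"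
  defines "D \<equiv> \<lambda>t. (norm (x t - y t))\<^sup>2 + (norm (v t - z t))\<^sup>2"
  shows "D t \<le> exp ((1 + 2 * B + P * R + K) * t) * D 0"
    and "D 0 \<le> exp ((1 + 2 * B + P * R + K) * t) * D t"
proof -
  define f where "f t = - (\<phi> (x t) *\<^sub>R v t) - G (x t) - (- (\<phi> (y t) *\<^sub>R z t) - G (y t))" for t
  define D' where "D' t = 2 * ((x t - y t) \<bullet> (v t - z t)) + 2 * ((v t - z t) \<bullet> f t)" for t
  have D: "D = (\<lambda>t. (x t - y t) \<bullet> (x t - y t) + (v t - z t) \<bullet> (v t - z t))"
    by (simp add: D_def power2_norm_eq_inner)
  have d: "(D has_real_derivative D' t) (at t within {0..})" if t: "t \<ge> 0" for t
  proof -
    have 1: "((\<lambda>t. x t - y t) has_vector_derivative v t - z t) (at t within {0..})"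
      by (intro has_vector_derivative_diff trajectoryD assms t)
    have 2: "((\<lambda>t. v t - z t) has_vector_derivative f t) (at t within {0..})"
      unfolding f_def by (intro has_vector_derivative_diff trajectoryD assms t)
    show ?thesis
      using DERIV_add[OF has_real_derivative_inner[OF 1 1] has_real_derivative_inner[OF 2 2]]
      by (simp add: D D'_def inner_commute)
  qed
  have R: "R \<ge> 0" using assms(3)[of 0] norm_ge_zero[of "z 0"] by linarith
  have b: "\<bar>D' t\<bar> \<le> (1 + 2 * B + P * R + K) * D t" if t: "t \<ge> 0" for t
  proof -
    define p q where "p = norm (x t - y t)" and "q = norm (v t - z t)"
    have pq: "p \<ge> 0" "q \<ge> 0" "D t = p\<^sup>2 + q\<^sup>2" "2 * (p * q) \<le> p\<^sup>2 + q\<^sup>2"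
      using sum_squares_bound[of p q] by (auto simp: p_def q_def D_def)
    have "f t = - (\<phi> (x t) *\<^sub>R (v t - z t)) - (\<phi> (x t) - \<phi> (y t)) *\<^sub>R z t - (G (x t) - G (y t))"
      by (simp add: f_def algebra_simps)
    also have "norm \<dots> \<le> \<phi> (x t) * q + \<bar>\<phi> (x t) - \<phi> (y t)\<bar> * norm (z t) + norm (G (x t) - G (y t))"
      using norm_triangle_ineq4[of "- (\<phi> (x t) *\<^sub>R (v t - z t)) - (\<phi> (x t) - \<phi> (y t)) *\<^sub>R z t" "G (x t) - G (y t)"]
        norm_triangle_ineq4[of "- (\<phi> (x t) *\<^sub>R (v t - z t))" "(\<phi> (x t) - \<phi> (y t)) *\<^sub>R z t"]
        \<phi>_bounds(1)[of "x t"]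
      unfolding norm_minus_cancel norm_scaleR q_def by simp
    also have "\<dots> \<le> B * q + (P * p) * R + K * p"
      unfolding p_def using \<phi>_bounds field_lipschitz assms(3)[OF t] pq constants_nonneg
      by (intro add_mono mult_mono) (auto simp: q_def)
    finally have f: "norm (f t) \<le> B * q + (P * p) * R + K * p" .
    have "\<bar>(x t - y t) \<bullet> (v t - z t)\<bar> \<le> p * q"
      unfolding p_def q_def by (rule Cauchy_Schwarz_ineq2)
    moreover have "\<bar>(v t - z t) \<bullet> f t\<bar> \<le> q * (B * q + (P * p) * R + K * p)"
      using Cauchy_Schwarz_ineq2[of "v t - z t" "f t"] mult_left_mono[OF f pq(2)] by (simp add: q_def)
    ultimately have "\<bar>D' t\<bar> \<le> 2 * (p * q) + 2 * (q * (B * q + (P * p) * R + K * p))"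
      unfolding D'_def using abs_triangle_ineq[of "2 * ((x t - y t) \<bullet> (v t - z t))" "2 * ((v t - z t) \<bullet> f t)"]
      by (simp add: abs_mult)
    also have "\<dots> = (1 + P * R + K) * (2 * (p * q)) + 2 * B * q\<^sup>2"
      by (simp add: algebra_simps power2_eq_square)
    also have "\<dots> \<le> (1 + P * R + K) * (p\<^sup>2 + q\<^sup>2) + 2 * B * (p\<^sup>2 + q\<^sup>2)"
      using pq(4) constants_nonneg R by (intro add_mono mult_left_mono) auto
    finally show ?thesis by (simp add: pq(3) algebra_simps)
  qed
  show "D t \<le> exp ((1 + 2 * B + P * R + K) * t) * D 0"
    by (rule gronwall_two_sided(1)[OF d b assms(4)])
  show "D 0 \<le> exp ((1 + 2 * B + P * R + K) * t) * D t"
    by (rule gronwall_two_sided(2)[OF d b assms(4)])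
qed

lemma trajectory_bounds:
  assumes "trajectory x v" "t \<ge> 0"
  shows "norm (v t) \<le> sqrt (2 * energy (x 0) (v 0))" "norm (x t) \<le> l\<^sub>1 + sqrt (energy (x 0) (v 0))"
  using trajectory_energy_nonincreasing[OF assms(1) order_refl assms(2)] by (rule norm_le_energy)+

lemma trajectory_unique_forward:
  assumes "trajectory x v" "trajectory y z" "x 0 = y 0" "v 0 = z 0" "t \<ge> 0"
  shows "x t = y t" "v t = z t"
proof -
  have "(norm (x t - y t))\<^sup>2 + (norm (v t - z t))\<^sup>2 \<le> 0"
    using trajectory_gronwall(1)[OF assms(1,2) trajectory_bounds(1)[OF assms(2)] assms(5)] assms(3,4) by simp
  then show "x t = y t" "v t = z t"
    by (simp_all add: sum_power2_le_zero_iff)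
qed

lemma trajectory_unique_backward:
  assumes "trajectory x v" "trajectory y z" "x t = y t" "v t = z t" "t \<ge> 0"
  shows "x 0 = y 0" "v 0 = z 0"
proof -
  have "(norm (x 0 - y 0))\<^sup>2 + (norm (v 0 - z 0))\<^sup>2 \<le> 0"
    using trajectory_gronwall(2)[OF assms(1,2) trajectory_bounds(1)[OF assms(2)] assms(5)] assms(3,4) by simp
  then show "x 0 = y 0" "v 0 = z 0"
    by (simp_all add: sum_power2_le_zero_iff)
qed

text \<open>Continuous dependence on the data: the velocity bound in Gronwall's inequality is that
  of the limit trajectory, so the constant is the same for all n.\<close>

lemma limit_trajectory:
  assumes "trajectory x v" "\<And>n. \<tau> n \<ge> 0" "(\<lambda>n. x (\<tau> n)) \<longlonglongrightarrow> a" "(\<lambda>n. v (\<tau> n)) \<longlonglongrightarrow> b"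
  obtains X V where "trajectory X V" "X 0 = a" "V 0 = b"
    "\<And>s. s \<ge> 0 \<Longrightarrow> (\<lambda>n. x (s + \<tau> n)) \<longlonglongrightarrow> X s" "\<And>s. s \<ge> 0 \<Longrightarrow> (\<lambda>n. v (s + \<tau> n)) \<longlonglongrightarrow> V s"
proof -
  obtain X V where XV: "trajectory X V" "X 0 = a" "V 0 = b" by (rule trajectory_exists)
  have lim: "(\<lambda>n. x (s + \<tau> n)) \<longlonglongrightarrow> X s" "(\<lambda>n. v (s + \<tau> n)) \<longlonglongrightarrow> V s" if s: "s \<ge> 0" for s
  proof -
    define C where "C = exp ((1 + 2 * B + P * sqrt (2 * energy (X 0) (V 0)) + K) * s)"
    have le: "(norm (x (s + \<tau> n) - X s))\<^sup>2 + (norm (v (s + \<tau> n) - V s))\<^sup>2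
        \<le> C * ((norm (x (\<tau> n) - a))\<^sup>2 + (norm (v (\<tau> n) - b))\<^sup>2)" for n
      using trajectory_gronwall(1)[OF trajectory_shift[OF assms(1,2)] XV(1) trajectory_bounds(1)[OF XV(1)] s]
      by (simp add: C_def XV(2,3))
    have "(\<lambda>n. C * ((norm (x (\<tau> n) - a))\<^sup>2 + (norm (v (\<tau> n) - b))\<^sup>2))
        \<longlonglongrightarrow> C * ((norm (a - a))\<^sup>2 + (norm (b - b))\<^sup>2)"
      by (intro tendsto_intros assms)
    then have z: "(\<lambda>n. C * ((norm (x (\<tau> n) - a))\<^sup>2 + (norm (v (\<tau> n) - b))\<^sup>2)) \<longlonglongrightarrow> 0" by simp
    have "(\<lambda>n. (norm (x (s + \<tau> n) - X s))\<^sup>2) \<longlonglongrightarrow> 0"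
      by (rule tendsto_sandwich[OF _ _ tendsto_const z])
        (use le zero_le_power2 order_trans[OF _ le] in \<open>auto intro!: always_eventually\<close>)
    then have "(\<lambda>n. sqrt ((norm (x (s + \<tau> n) - X s))\<^sup>2)) \<longlonglongrightarrow> sqrt 0" by (rule tendsto_real_sqrt)
    then show "(\<lambda>n. x (s + \<tau> n)) \<longlonglongrightarrow> X s"
      by (simp add: tendsto_norm_zero_iff LIM_zero_iff)
    have "(\<lambda>n. (norm (v (s + \<tau> n) - V s))\<^sup>2) \<longlonglongrightarrow> 0"
      by (rule tendsto_sandwich[OF _ _ tendsto_const z])
        (use le zero_le_power2 order_trans[OF _ le] in \<open>auto intro!: always_eventually\<close>)
    then have "(\<lambda>n. sqrt ((norm (v (s + \<tau> n) - V s))\<^sup>2)) \<longlonglongrightarrow> sqrt 0" by (rule tendsto_real_sqrt)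
    then show "(\<lambda>n. v (s + \<tau> n)) \<longlonglongrightarrow> V s"
      by (simp add: tendsto_norm_zero_iff LIM_zero_iff)
  qed
  show ?thesis by (rule that[OF XV lim])
qed

text \<open>Q restricts the times along which the limit is taken, for instance to those at which |x|
  is at most b.\<close>

lemma limit_point_exists:
  assumes "trajectory x v" "\<And>T. \<exists>t\<ge>T. Q t"
  obtains \<tau> a b where "filterlim \<tau> at_top sequentially" "\<And>n. \<tau> n \<ge> 0" "\<And>n. Q (\<tau> n)"
    "(\<lambda>n::nat. x (\<tau> n)) \<longlonglongrightarrow> a" "(\<lambda>n. v (\<tau> n)) \<longlonglongrightarrow> b"
proof -
  have "\<forall>n::nat. \<exists>t. t \<ge> real n \<and> Q t" using assms(2) by blast
  then obtain t where t: "\<And>n::nat. t n \<ge> real n" "\<And>n. Q (t n)"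
    by (auto dest!: choice)
  then have t0: "t n \<ge> 0" for n using of_nat_0_le_iff[of n] order_trans by blast
  define M where "M = l\<^sub>1 + sqrt (energy (x 0) (v 0))"
  define N where "N = sqrt (2 * energy (x 0) (v 0))"
  have mem: "(x (t n), v (t n)) \<in> cball 0 M \<times> cball 0 N" for n
    using trajectory_bounds[OF assms(1) t0] by (simp add: M_def N_def)
  have "compact (cball (0::'a) M \<times> cball (0::'a) N)" by (intro compact_Times) auto
  then obtain p r where r: "strict_mono (r :: nat \<Rightarrow> nat)" "((\<lambda>n. (x (t n), v (t n))) \<circ> r) \<longlonglongrightarrow> p"
    unfolding compact_def using mem by (elim allE[of _ "\<lambda>n. (x (t n), v (t n))"]) blast
  show ?thesis
  proof (rule that[of "t \<circ> r" "fst p" "snd p"])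
    have "filterlim t at_top sequentially"
      by (rule filterlim_at_top_mono[OF filterlim_real_sequentially always_eventually]) (use t(1) in simp)
    then show "filterlim (t \<circ> r) at_top sequentially"
      unfolding o_def by (rule filterlim_compose[OF _ filterlim_subseq[OF r(1)]])
    show "(\<lambda>n. x ((t \<circ> r) n)) \<longlonglongrightarrow> fst p" "(\<lambda>n. v ((t \<circ> r) n)) \<longlonglongrightarrow> snd p"
      using tendsto_fst[OF r(2)] tendsto_snd[OF r(2)] by (simp_all add: o_def)
  qed (use t t0 in auto)
qed

end

section \<open>Limits of positive energy\<close>

lemma last_time_above:
  fixes f :: "real \<Rightarrow> real"
  assumes "continuous_on {s..t} f" "s \<le> t" "f s \<ge> c"
  obtains r where "s \<le> r" "r \<le> t" "f r \<ge> c" "\<And>q. r < q \<Longrightarrow> q \<le> t \<Longrightarrow> f q < c"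
proof -
  define S where "S = {r \<in> {s..t}. c \<le> f r}"
  have "closed S"
    unfolding S_def by (intro continuous_on_closed_Collect_le assms continuous_on_const) auto
  moreover have "S \<subseteq> {s..t}" by (auto simp: S_def)
  ultimately have "compact S" using compact_Icc compact_Int_closed[of "{s..t}" S] by (simp add: Int_absorb1)
  moreover have "S \<noteq> {}" using assms by (auto simp: S_def)
  ultimately have "\<exists>r\<in>S. \<forall>q\<in>S. q \<le> r" by (rule compact_attains_sup)
  then obtain r where r: "r \<in> S" "\<And>q. q \<in> S \<Longrightarrow> q \<le> r" by blast
  show ?thesis
  proof (rule that)
    show "s \<le> r" "r \<le> t" "f r \<ge> c" using r(1) by (auto simp: S_def)
    show "f q < c" if "r < q" "q \<le> t" for q
    proof (rule ccontr)
      assume "\<not> f q < c"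
      then have "q \<in> S" using that \<open>s \<le> r\<close> by (simp add: S_def)
      then show False using r(2)[of q] that by simp
    qed
  qed
qed

lemma has_real_derivative_continuous_on_Icc:
  fixes f :: "real \<Rightarrow> real"
  assumes "\<And>t. t \<ge> a \<Longrightarrow> (f has_real_derivative f' t) (at t within {a..})" "a \<le> s"
  shows "continuous_on {s..t} f"
proof (rule DERIV_continuous_on)
  show "(f has_real_derivative f' r) (at r within {s..t})" if "r \<in> {s..t}" for r
    by (rule DERIV_subset[OF assms(1)]) (use that assms(2) in auto)
qed

text \<open>After the last time at which f is nonnegative its derivative is nonnegative, so f cannot
  have dropped below 0.\<close>

lemma nonneg_preserved:
  fixes f :: "real \<Rightarrow> real"
  assumes "\<And>t. t \<ge> a \<Longrightarrow> (f has_real_derivative f' t) (at t within {a..})"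
    and "\<And>t. s < t \<Longrightarrow> f t < 0 \<Longrightarrow> f' t \<ge> 0" and "a \<le> s" "s \<le> t" "f s \<ge> 0"
  shows "f t \<ge> 0"
proof (rule ccontr)
  assume neg: "\<not> f t \<ge> 0"
  have cf: "continuous_on {s..t} f"
    by (rule has_real_derivative_continuous_on_Icc[OF assms(1,3)])
  obtain r where r: "s \<le> r" "r \<le> t" "f r \<ge> 0" "\<And>q. r < q \<Longrightarrow> q \<le> t \<Longrightarrow> f q < 0"
    by (rule last_time_above[OF cf assms(4,5)]) (rule that)
  have "f r \<le> f t"
    by (rule nondecreasing_if_deriv_nonneg[OF assms(1)]) (use assms(2,3) r in auto)
  then show False using neg r(3) by linarith
qed

lemma no_linear_decay:
  fixes f :: "real \<Rightarrow> real"
  assumes "\<And>t. t \<ge> a \<Longrightarrow> (f has_real_derivative f' t) (at t within {a..})"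
    and "\<And>t. t \<ge> s \<Longrightarrow> f' t \<le> - \<delta>" and "\<And>t. t \<ge> s \<Longrightarrow> f t \<ge> m" and "a \<le> s" "\<delta> > 0"
  shows False
proof -
  \<comment> \<open>The time at which a line of slope - \<delta> through f s has fallen to m -
    1.\<close>
  define t where "t = s + (f s - m + 1) / \<delta>"
  have "f s \<ge> m" using assms(3) by simp
  then have t: "s \<le> t" "\<delta> * (t - s) = f s - m + 1" using assms(5) by (auto simp: t_def)
  have "f t + \<delta> * t \<le> f s + \<delta> * s"
  proof (rule nonincreasing_if_deriv_nonpos[where f = "\<lambda>t. f t + \<delta> * t" and a = a
        and f' = "\<lambda>t. f' t + \<delta>"])
    show "((\<lambda>t. f t + \<delta> * t) has_real_derivative f' r + \<delta>) (at r within {a..})" if "r \<ge> a" for r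
      using assms(1)[OF that] by (auto intro!: derivative_eq_intros)
    show "f' r + \<delta> \<le> 0" if "s < r" for r using assms(2)[of r] that by simp
  qed (use assms t in auto)
  moreover have "f t \<ge> m" using assms(3) t by simp
  ultimately show False using t(2) by (simp add: algebra_simps)
qed

text \<open>Quantifies the convexity, in the variable \<open>r\<^sup>2\<close>, of \<open>r\<^sup>2\<close> times the potential for \<open>r \<ge> l\<^sub>0\<close>.\<close>

lemma outer_branch_convexity:
  fixes a r l :: real
  assumes "0 < a" "a < r" "0 \<le> l"
  defines "m \<equiv> max (r - l) 0" and "k \<equiv> max (a - l) 0"
  shows "(r\<^sup>2 - a\<^sup>2) * (2 * m * r) - 2 * a\<^sup>2 * (m\<^sup>2 - k\<^sup>2) \<ge> 2 * m * (r - a)\<^sup>2 * r"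
proof -
  consider "r \<le> l" | "l < r" "a \<le> l" | "l < a" by linarith
  then show ?thesis
  proof cases
    case 1
    then show ?thesis using assms by (simp add: m_def k_def)
  next
    case 2
    then have m: "m = r - l" "k = 0" "0 < m" "m \<le> r - a" by (auto simp: m_def k_def)
    have "(r\<^sup>2 - a\<^sup>2) * (2 * m * r) - 2 * a\<^sup>2 * (m\<^sup>2 - k\<^sup>2) - 2 * m * (r - a)\<^sup>2 * r
        = 2 * m * (a\<^sup>2 * (r - a - m) + (r - a) * a * (2 * r - a))"
      by (simp add: m(2) power2_eq_square algebra_simps)
    also have "\<dots> \<ge> 0" using assms m by (intro mult_nonneg_nonneg add_nonneg_nonneg) auto
    finally show ?thesis by simp
  next
    case 3
    then have m: "m = r - l" "k = m - (r - a)" "m > 0" using assms by (auto simp: m_def k_def)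
    have "(r\<^sup>2 - a\<^sup>2) * (2 * m * r) - 2 * a\<^sup>2 * (m\<^sup>2 - k\<^sup>2) - 2 * m * (r - a)\<^sup>2 * r
        = 2 * (r - a)\<^sup>2 * (2 * m * a + a\<^sup>2)"
      by (simp add: m(2) power2_eq_square algebra_simps)
    also have "\<dots> \<ge> 0" using assms m by (intro mult_nonneg_nonneg add_nonneg_nonneg) auto
    finally show ?thesis by simp
  qed
qed

section \<open>Angular momentum and limit trajectories of constant energy\<close>

context damped_well
begin

text \<open>The squared angular momentum, by Lagrange's identity.\<close>

definition angsq :: "'a \<Rightarrow> 'a \<Rightarrow> real" where
  "angsq x v = (x \<bullet> x) * (v \<bullet> v) - (x \<bullet> v)\<^sup>2"

lemma inner_G: "y \<bullet> G x = w (norm x) / norm x * (y \<bullet> x)"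
  by (subst G_eq) simp

lemma inner_self_G: "x \<bullet> G x = w (norm x) * norm x"
  by (simp add: inner_G flip: power2_norm_eq_inner power2_eq_square) (simp add: power2_eq_square)

lemma trajectory_inner_derivatives:
  assumes "trajectory x v" "t \<ge> 0"
  shows "((\<lambda>t. x t \<bullet> x t) has_real_derivative 2 * (x t \<bullet> v t)) (at t within {0..})"
    and "((\<lambda>t. x t \<bullet> v t) has_real_derivative v t \<bullet> v t - \<phi> (x t) * (x t \<bullet> v t) - x t \<bullet> G (x t)) (at t within {0..})"
    and "((\<lambda>t. v t \<bullet> v t) has_real_derivative - 2 * \<phi> (x t) * (v t \<bullet> v t) - 2 * (v t \<bullet> G (x t))) (at t within {0..})"
proof -
  note dx = trajectoryD(1)[OF assms] and dv = trajectoryD(2)[OF assms]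
  show "((\<lambda>t. x t \<bullet> x t) has_real_derivative 2 * (x t \<bullet> v t)) (at t within {0..})"
    using has_real_derivative_inner[OF dx dx] by (simp add: inner_commute)
  show "((\<lambda>t. x t \<bullet> v t) has_real_derivative v t \<bullet> v t - \<phi> (x t) * (x t \<bullet> v t) - x t \<bullet> G (x t)) (at t within {0..})"
    using has_real_derivative_inner[OF dx dv] by (simp add: inner_diff_right algebra_simps)
  show "((\<lambda>t. v t \<bullet> v t) has_real_derivative - 2 * \<phi> (x t) * (v t \<bullet> v t) - 2 * (v t \<bullet> G (x t))) (at t within {0..})"
    using has_real_derivative_inner[OF dv dv] by (simp add: inner_diff_right inner_diff_left inner_commute algebra_simps)
qed

text \<open>The force is parallel to x and drops out; the drag damps angular momentum at rate
  \<phi>, hence its square at rate 2 \<phi>.\<close>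

lemma trajectory_angsq_derivative:
  assumes "trajectory x v" "t \<ge> 0"
  shows "((\<lambda>t. angsq (x t) (v t)) has_real_derivative - 2 * \<phi> (x t) * angsq (x t) (v t)) (at t within {0..})"
proof -
  note d = trajectory_inner_derivatives[OF assms]
  define g where "g = w (norm (x t)) / norm (x t)"
  have G: "x t \<bullet> G (x t) = g * (x t \<bullet> x t)" "v t \<bullet> G (x t) = g * (x t \<bullet> v t)"
    by (simp_all add: inner_G g_def inner_commute)
  define X V Q p where "X = x t \<bullet> x t" and "V = v t \<bullet> v t" and "Q = x t \<bullet> v t" and "p = \<phi> (x t)"
  have "((\<lambda>t. (x t \<bullet> x t) * (v t \<bullet> v t) - (x t \<bullet> v t) * (x t \<bullet> v t)) has_real_derivative
      (2 * Q * V + (- 2 * p * V - 2 * (g * Q)) * X) - ((V - p * Q - g * X) * Q + (V - p * Q - g * X) * Q)) (at t within {0..})"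
    unfolding X_def V_def Q_def p_def
    using d unfolding G by (intro DERIV_diff DERIV_mult)
  moreover have "(2 * Q * V + (- 2 * p * V - 2 * (g * Q)) * X) - ((V - p * Q - g * X) * Q + (V - p * Q - g * X) * Q)
      = - 2 * p * (X * V - Q\<^sup>2)"
    by (simp add: algebra_simps power2_eq_square)
  ultimately show ?thesis
    by (simp add: angsq_def[abs_def] X_def V_def Q_def p_def power2_eq_square)
qed

lemma energy_limit:
  assumes "trajectory x v"
  obtains e where "((\<lambda>t. energy (x t) (v t)) \<longlongrightarrow> e) at_top" "e \<ge> 0"
  by (rule nonincreasing_convergent_at_top[of "\<lambda>t. energy (x t) (v t)" 0,
        OF trajectory_energy_nonincreasing[OF assms] energy_nonneg])
    (assumption | rule that)+

lemma tendsto_energy: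
  assumes "(x \<longlongrightarrow> a) F" "(v \<longlongrightarrow> b) F"
  shows "((\<lambda>n. energy (x n) (v n)) \<longlongrightarrow> energy a b) F"
proof -
  have "isCont U a" using continuous_U[of UNIV] by (simp add: continuous_on_eq_continuous_at)
  then have "((\<lambda>n. U (x n)) \<longlongrightarrow> U a) F" using assms(1) by (rule isCont_tendsto_compose)
  then show ?thesis unfolding energy_def by (intro tendsto_intros assms) auto
qed

text \<open>The energy is continuous and converges along the trajectory, so every state of the limit
  trajectory carries the limit value e.\<close>

lemma omega_limit:
  assumes "trajectory x v" "((\<lambda>t. energy (x t) (v t)) \<longlongrightarrow> e) at_top" "\<And>T. \<exists>t\<ge>T. Q t"
  obtains \<tau> X V where "filterlim \<tau> at_top sequentially" "\<And>n::nat. \<tau> n \<ge> 0" "\<And>n. Q (\<tau> n)"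
    "trajectory X V" "\<And>s. s \<ge> 0 \<Longrightarrow> energy (X s) (V s) = e"
    "\<And>s. s \<ge> 0 \<Longrightarrow> (\<lambda>n. x (s + \<tau> n)) \<longlonglongrightarrow> X s" "\<And>s. s \<ge> 0 \<Longrightarrow> (\<lambda>n. v (s + \<tau> n)) \<longlonglongrightarrow> V s"
proof -
  obtain \<tau> a b where \<tau>: "filterlim \<tau> at_top sequentially" "\<And>n. \<tau> n \<ge> 0" "\<And>n. Q (\<tau> n)"
    "(\<lambda>n::nat. x (\<tau> n)) \<longlonglongrightarrow> a" "(\<lambda>n. v (\<tau> n)) \<longlonglongrightarrow> b"
    by (rule limit_point_exists[OF assms(1,3)]) (rule that)
  obtain X V where XV: "trajectory X V" "X 0 = a" "V 0 = b"
    "\<And>s. s \<ge> 0 \<Longrightarrow> (\<lambda>n. x (s + \<tau> n)) \<longlonglongrightarrow> X s" "\<And>s. s \<ge> 0 \<Longrightarrow> (\<lambda>n. v (s + \<tau> n)) \<longlonglongrightarrow> V s"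
    by (rule limit_trajectory[OF assms(1) \<tau>(2,4,5)]) (rule that)
  have "energy (X s) (V s) = e" if s: "s \<ge> 0" for s
  proof (rule LIMSEQ_unique)
    show "(\<lambda>n. energy (x (s + \<tau> n)) (v (s + \<tau> n))) \<longlonglongrightarrow> energy (X s) (V s)"
      by (intro tendsto_energy XV s)
    have "filterlim (\<lambda>n. s + \<tau> n) at_top sequentially"
      by (rule filterlim_tendsto_add_at_top[OF tendsto_const \<tau>(1)])
    then show "(\<lambda>n. energy (x (s + \<tau> n)) (v (s + \<tau> n))) \<longlonglongrightarrow> e"
      by (rule filterlim_compose[OF assms(2)])
  qed
  then show ?thesis by (intro that[OF \<tau>(1-3) XV(1) _ XV(4,5)])
qed

text \<open>The slope is negative inside \<open>l\<^sub>0\<close> and positive beyond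
  \<open>l\<^sub>1\<close>, so off the origin the force vanishes only on the flat bottom of the
  well.\<close>

lemma G_eq_zero_imp:
  assumes "G x = 0" "x \<noteq> 0"
  shows "U x = 0"
proof -
  have "w (norm x) = 0" using assms G_eq[of x] by simp
  then have "\<not> norm x < l\<^sub>0" using w_neg[of "norm x"] assms(2) by force
  then show ?thesis
    using \<open>w (norm x) = 0\<close> w_outer[of "norm x"] u_outer[of "norm x"] l by (auto simp: U_eq min_def max_def split: if_splits)
qed

lemma constant_energy_dissipation:
  assumes "trajectory X V" "\<And>s. s \<ge> 0 \<Longrightarrow> energy (X s) (V s) = e" "s \<ge> 0"
  shows "\<phi> (X s) * (V s \<bullet> V s) = 0"
proof -
  have "((\<lambda>t. energy (X t) (V t)) has_vector_derivative - (\<phi> (X s) * (V s \<bullet> V s))) (at s within {0..s + 1})"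
    unfolding has_real_derivative_iff_has_vector_derivative[symmetric]
    by (rule DERIV_subset[OF trajectory_energy_derivative[OF assms(1,3)]]) auto
  moreover have "((\<lambda>t. energy (X t) (V t)) has_real_derivative 0) (at s within {0..s + 1})"
    by (rule has_field_derivative_transform_within[OF DERIV_const[of e] zero_less_one]) (use assms in auto)
  then have "((\<lambda>t. energy (X t) (V t)) has_vector_derivative 0) (at s within {0..s + 1})"
    by (simp add: has_real_derivative_iff_has_vector_derivative)
  ultimately have "- (\<phi> (X s) * (V s \<bullet> V s)) = 0"
    using assms(3) by (intro vector_derivative_unique_within_closed_interval[of 0 "s + 1" s "\<lambda>t. energy (X t) (V t)"]) auto
  then show ?thesis by simp
qed

text \<open>For a short time the particle stays where \<phi> > 0, and constant energy forces V = 0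
  there. Then the acceleration at time 0 vanishes too, and of the rest points only the origin has
  positive energy.\<close>

lemma constant_energy_rest:
  assumes "trajectory X V" "\<And>s. s \<ge> 0 \<Longrightarrow> energy (X s) (V s) = e" "e > 0" "norm (X 0) < r\<^sub>0"
  shows "X 0 = 0" "V 0 = 0"
proof -
  have "((\<lambda>s. norm (X s)) \<longlongrightarrow> norm (X 0)) (at 0 within {0..})"
    using trajectory_continuous(1)[OF assms(1)] by (intro tendsto_norm) (simp add: continuous_on_def)
  then have "\<forall>\<^sub>F s in at 0 within {0..}. norm (X s) < r\<^sub>0"
    using assms(4) by (rule order_tendstoD)
  then obtain d where d: "d > 0" "\<And>s. s \<ge> 0 \<Longrightarrow> s \<noteq> 0 \<Longrightarrow> \<bar>s\<bar> < d \<Longrightarrow> norm (X s) < r\<^sub>0"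
    unfolding eventually_at by (auto simp: dist_real_def)
  have V: "V s = 0" if "s \<ge> 0" "s < d" for s
  proof -
    have "norm (X s) < r\<^sub>0" using d(2)[of s] assms(4) that by (cases "s = 0") auto
    then show ?thesis
      using constant_energy_dissipation[OF assms(1,2) that(1)] \<phi>_pos[of "X s"] by simp
  qed
  show V0: "V 0 = 0" using V d by simp
  have "(V has_vector_derivative - (\<phi> (X 0) *\<^sub>R V 0) - G (X 0)) (at 0 within {0..d / 2})"
    by (rule has_vector_derivative_within_subset[OF trajectoryD(2)[OF assms(1)]]) auto
  moreover have "(V has_vector_derivative 0) (at 0 within {0..d / 2})"
    by (rule has_vector_derivative_transform[OF _ _ has_vector_derivative_const[of 0]]) (use d V in auto)
  ultimately have "- (\<phi> (X 0) *\<^sub>R V 0) - G (X 0) = 0"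
    using d by (intro vector_derivative_unique_within_closed_interval[of 0 "d / 2" 0 V]) auto
  then have "G (X 0) = 0" by (simp add: V0)
  then show "X 0 = 0"
    using G_eq_zero_imp[of "X 0"] assms(2)[of 0] assms(3) V0 by (auto simp: energy_def)
qed

text \<open>With \<open>Y = |X|\<^sup>2 - a\<^sup>2\<close>, the angular momentum bound makes \<open>\<surd>Y\<close> concave. It is positive and bounded,
  so its slope \<open>F\<close> is nonnegative and \<open>|X|\<close> is nondecreasing.\<close>

lemma no_exterior_constant_energy:
  assumes tr: "trajectory X V" and en: "\<And>s. s \<ge> 0 \<Longrightarrow> energy (X s) (V s) = e" and "e > 0"
    and out: "\<And>s. s \<ge> 0 \<Longrightarrow> norm (X s) \<ge> r\<^sub>0" and a: "l\<^sub>0 \<le> a" "a < r\<^sub>0"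
    and ang: "angsq (X 0) (V 0) \<le> 2 * a\<^sup>2 * (e - u a)"
  shows False
proof -
  define r where "r s = norm (X s)" for s
  define q where "q s = X s \<bullet> V s" for s
  define q' where "q' s = V s \<bullet> V s - w (r s) * r s" for s
  define S where "S s = sqrt ((r s)\<^sup>2 - a\<^sup>2)" for s
  define F where "F s = q s / S s" for s
  have a0: "0 < a" using a l by linarith
  have r: "r s \<ge> r\<^sub>0" "r s > a" "r s > 0" if "s \<ge> 0" for s
    using out[OF that] a a0 by (auto simp: r_def)
  have \<phi>0: "\<phi> (X s) = 0" if "s \<ge> 0" for s using \<phi>_zero out[OF that] by simp
  have w: "w (r s) = 2 * max (r s - l\<^sub>1) 0" and u: "U (X s) = (max (r s - l\<^sub>1) 0)\<^sup>2" if "s \<ge> 0" for s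
    using r[OF that] w_outer[of "r s"] u_outer[of "r s"] l by (auto simp: U_eq r_def)
  have ua: "u a = (max (a - l\<^sub>1) 0)\<^sup>2" using u_outer[of a] a l by simp
  have vv: "V s \<bullet> V s = 2 * (e - U (X s))" if "s \<ge> 0" for s
    using en[OF that] by (simp add: energy_def)
  have dq: "(q has_real_derivative q' s) (at s within {0..})" if "s \<ge> 0" for s
    using trajectory_inner_derivatives(2)[OF tr that]
    by (simp add: q_def[abs_def] q'_def \<phi>0[OF that] inner_self_G r_def)
  have dr: "((\<lambda>s. (r s)\<^sup>2) has_real_derivative 2 * q s) (at s within {0..})" if "s \<ge> 0" for s
    using trajectory_inner_derivatives(1)[OF tr that] by (simp add: r_def power2_norm_eq_inner q_def)
  have A: "angsq (X s) (V s) = angsq (X 0) (V 0)" if "s \<ge> 0" for s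
  proof (rule constant_if_deriv_zero[where f = "\<lambda>s. angsq (X s) (V s)"])
    show "((\<lambda>s. angsq (X s) (V s)) has_vector_derivative 0) (at t within {0..})" if "t \<ge> 0" for t
      using trajectory_angsq_derivative[OF tr that]
      by (simp add: \<phi>0[OF that] has_real_derivative_iff_has_vector_derivative)
  qed (rule that)
  \<comment> \<open>The numerator of F': since S' = F = q / S, one has F' = (q' S^2 - q^2) / S^3.
    Constancy of energy and angular momentum turns it into a function of the radius.\<close>
  have key: "q' s * (S s)\<^sup>2 - (q s)\<^sup>2 \<le> - (2 * max (r s - l\<^sub>1) 0 * (r s - a)\<^sup>2 * r s)" if s: "s \<ge> 0" for s
  proof -
    have S2: "(S s)\<^sup>2 = (r s)\<^sup>2 - a\<^sup>2"
      unfolding S_def using r[OF s] a0 by (intro real_sqrt_pow2) (simp add: power_mono)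
    have "(q s)\<^sup>2 = (r s)\<^sup>2 * (V s \<bullet> V s) - angsq (X s) (V s)"
      by (simp add: angsq_def q_def r_def power2_norm_eq_inner)
    then have "q' s * (S s)\<^sup>2 - (q s)\<^sup>2 = angsq (X s) (V s) - a\<^sup>2 * (V s \<bullet> V s) - w (r s) * r s * ((r s)\<^sup>2 - a\<^sup>2)"
      by (simp add: S2 q'_def algebra_simps)
    also have "\<dots> \<le> 2 * a\<^sup>2 * (e - u a) - a\<^sup>2 * (2 * (e - U (X s))) - w (r s) * r s * ((r s)\<^sup>2 - a\<^sup>2)"
      using ang by (simp add: A[OF s] vv[OF s])
    also have "\<dots> = - (((r s)\<^sup>2 - a\<^sup>2) * (2 * max (r s - l\<^sub>1) 0 * r s) - 2 * a\<^sup>2 * ((max (r s - l\<^sub>1) 0)\<^sup>2 - (max (a - l\<^sub>1) 0)\<^sup>2))"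
      unfolding u[OF s] ua w[OF s] by (simp add: algebra_simps)
    also have "\<dots> \<le> - (2 * max (r s - l\<^sub>1) 0 * (r s - a)\<^sup>2 * r s)"
      using outer_branch_convexity[of a "r s" l\<^sub>1] a0 r[OF s] l by simp
    finally show ?thesis .
  qed
  have S: "S s > 0" if "s \<ge> 0" for s
    unfolding S_def using r[OF that] a0 by (simp add: power_strict_mono)
  have dS: "(S has_real_derivative F s) (at s within {0..})" if s: "s \<ge> 0" for s
  proof -
    have pos: "(r s)\<^sup>2 - a\<^sup>2 > 0" using r[OF s] a0 by (simp add: power_strict_mono)
    have "((\<lambda>s. (r s)\<^sup>2 - a\<^sup>2) has_real_derivative 2 * q s) (at s within {0..})"
      using DERIV_diff[OF dr[OF s] DERIV_const] by simp
    from DERIV_chain2[OF DERIV_real_sqrt[OF pos] this] show ?thesis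
      by (simp add: S_def[abs_def] F_def field_simps)
  qed
  define F' where "F' s = (q' s * (S s)\<^sup>2 - (q s)\<^sup>2) / (S s) ^ 3" for s
  have dF: "(F has_real_derivative F' s) (at s within {0..})" if s: "s \<ge> 0" for s
  proof -
    have "((\<lambda>s. q s / S s) has_real_derivative (q' s * S s - q s * F s) / (S s * S s)) (at s within {0..})"
      using S[OF s] by (intro DERIV_divide dq dS s) auto
    moreover have "(q' s * S s - q s * F s) / (S s * S s) = F' s"
      using S[OF s] by (simp add: F_def F'_def field_simps power2_eq_square power3_eq_cube)
    ultimately show ?thesis by (simp add: F_def[abs_def])
  qed
  have F'0: "F' s \<le> 0" if s: "s \<ge> 0" for s
  proof -
    have "0 \<le> 2 * max (r s - l\<^sub>1) 0 * (r s - a)\<^sup>2 * r s" using r[OF s] by simp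
    then have "q' s * (S s)\<^sup>2 - (q s)\<^sup>2 \<le> 0" using key[OF s] by linarith
    then show ?thesis unfolding F'_def using S[OF s] by (simp add: divide_nonpos_pos)
  qed
  have Fmono: "F t \<le> F s" if "0 \<le> s" "s \<le> t" for s t
    by (rule nonincreasing_if_deriv_nonpos[OF dF]) (use that F'0 in auto)
  have F0: "F s \<ge> 0" if s: "s \<ge> 0" for s
  proof (rule ccontr)
    assume "\<not> F s \<ge> 0"
    then have pos: "- F s > 0" by simp
    show False
      by (rule no_linear_decay[OF dS _ _ s pos, of 0])
        (use Fmono[OF s] S s in \<open>auto intro: less_imp_le\<close>)
  qed
  have q0: "q s \<ge> 0" if "s \<ge> 0" for s
    using F0[OF that] S[OF that] by (simp add: F_def zero_le_divide_iff)
  have rmono: "r s \<le> r t" if "0 \<le> s" "s \<le> t" for s t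
  proof -
    have "(r s)\<^sup>2 \<le> (r t)\<^sup>2"
      by (rule nondecreasing_if_deriv_nonneg[OF dr]) (use that q0 in auto)
    moreover have "0 \<le> r t" by (simp add: r_def)
    ultimately show ?thesis by (rule power2_le_imp_le)
  qed
  define M where "M = l\<^sub>1 + sqrt (energy (X 0) (V 0))"
  define N where "N = sqrt (2 * energy (X 0) (V 0))"
  have MN: "r s \<le> M" "norm (V s) \<le> N" if "s \<ge> 0" for s
    using trajectory_bounds[OF tr that] by (auto simp: M_def N_def r_def)
  show False
  \<comment> \<open>Without any excursion beyond \<open>l\<^sub>1\<close> no force acts and q grows
    linearly, though it is bounded. After an excursion the radius never returns, and F decreases at
    a fixed rate, though it is nonnegative.\<close>
  proof (cases "\<exists>s\<ge>0. r s > l\<^sub>1")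
    case False
    have "q' s = 2 * e" if s: "s \<ge> 0" for s
    proof -
      have "max (r s - l\<^sub>1) 0 = 0" using False s by (simp add: max_def not_less)
      then show ?thesis by (simp add: q'_def vv[OF s] w[OF s] u[OF s])
    qed
    moreover have "- q s \<ge> - (M * N)" if "s \<ge> 0" for s
    proof -
      have "q s \<le> norm (X s) * norm (V s)" unfolding q_def by (rule norm_cauchy_schwarz)
      also have "\<dots> \<le> M * N" using MN[OF that] by (intro mult_mono) (auto simp: r_def intro: order_trans[OF norm_ge_zero])
      finally show ?thesis by simp
    qed
    ultimately show False
      using no_linear_decay[of 0 "\<lambda>s. - q s" "\<lambda>s. - q' s" 0 "2 * e" "- (M * N)"] DERIV_minus[OF dq] \<open>e > 0\<close> by simp
  next
    case True
    then obtain s1 where s1: "s1 \<ge> 0" "r s1 > l\<^sub>1" by blast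
    \<comment> \<open>The least value of the convexity gain from time s1 on, as the radius is
      nondecreasing and at least \<open>r\<^sub>0\<close> > a.\<close>
    define d where "d = 2 * (r s1 - l\<^sub>1) * (r\<^sub>0 - a)\<^sup>2 * r\<^sub>0"
    have d: "d > 0" using s1 a l by (simp add: d_def)
    have M: "M > 0" using MN(1)[of 0] r(3)[of 0] by simp
    have dec: "F' s \<le> - (d / M ^ 3)" if s: "s \<ge> s1" for s
    proof -
      have s0: "s \<ge> 0" using s s1 by simp
      have "d \<le> 2 * max (r s - l\<^sub>1) 0 * (r s - a)\<^sup>2 * r s"
        unfolding d_def using r[OF s0] rmono[OF s1(1) s] s1 a l
        by (intro mult_mono power_mono) auto
      then have "q' s * (S s)\<^sup>2 - (q s)\<^sup>2 \<le> - d" using key[OF s0] by linarith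
      then have "F' s \<le> - d / (S s) ^ 3"
        unfolding F'_def using S[OF s0] by (intro divide_right_mono) auto
      also have "\<dots> \<le> - (d / M ^ 3)"
      proof -
        have "S s \<le> sqrt ((r s)\<^sup>2)"
          unfolding S_def by (rule real_sqrt_le_mono) simp
        then have "S s \<le> M" using MN(1)[OF s0] r(3)[OF s0] by simp
        then have "d / M ^ 3 \<le> d / (S s) ^ 3"
          using S[OF s0] M d by (intro divide_left_mono power_mono) auto
        then show ?thesis by simp
      qed
      finally show ?thesis .
    qed
    show False
      by (rule no_linear_decay[OF dF dec _ s1(1), where m = 0]) (use F0 s1 d M in auto)
  qed
qed

end

text \<open>While f is positive, 1/f grows at rate at least \<delta>. The product form of the
  conclusion also covers t = a and f t <= 0.\<close>

lemma riccati_decay: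
  fixes f :: "real \<Rightarrow> real"
  assumes "\<And>t. t \<ge> a \<Longrightarrow> (f has_real_derivative f' t) (at t within {a..})"
    and "\<And>t. t \<ge> a \<Longrightarrow> f' t \<le> - \<delta> * (f t)\<^sup>2" and "a \<le> t" "\<delta> > 0"
  shows "f t * (\<delta> * (t - a)) \<le> 1"
proof (cases "f t \<le> 0")
  case True
  then have "f t * (\<delta> * (t - a)) \<le> 0" using assms(3,4) by (intro mult_nonpos_nonneg) auto
  then show ?thesis by simp
next
  case False
  have f'0: "f' s \<le> 0" if "s \<ge> a" for s
    using assms(2)[OF that] assms(4) zero_le_power2[of "f s"] mult_nonneg_nonneg[of \<delta> "(f s)\<^sup>2"] by linarith
  have pos: "f s > 0" if "a \<le> s" "s \<le> t" for s
    using nonincreasing_if_deriv_nonpos[OF assms(1), of s t] f'0 that False by force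
  define g where "g s = inverse (f s) - \<delta> * s" for s
  have "\<exists>g'. (g has_real_derivative g') (at s within {a..t}) \<and> g' \<ge> 0" if s: "s \<in> {a..t}" for s
  proof (intro exI conjI)
    have "(f has_real_derivative f' s) (at s within {a..t})"
      by (rule DERIV_subset[OF assms(1)]) (use s in auto)
    then show "(g has_real_derivative - (f' s) / (f s)\<^sup>2 - \<delta>) (at s within {a..t})"
      unfolding g_def[abs_def] using pos[of s] s
      by (auto intro!: derivative_eq_intros simp: power2_eq_square field_simps)
    have "\<delta> * (f s)\<^sup>2 \<le> - f' s" using assms(2)[of s] s by simp
    then have "\<delta> \<le> - (f' s) / (f s)\<^sup>2" using pos[of s] s by (subst pos_le_divide_eq) auto
    then show "- (f' s) / (f s)\<^sup>2 - \<delta> \<ge> 0" by linarith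
  qed
  then obtain g' where g': "\<And>s. s \<in> {a..t} \<Longrightarrow> (g has_real_derivative g' s) (at s within {a..t})"
    "\<And>s. s \<in> {a..t} \<Longrightarrow> g' s \<ge> 0" by metis
  have "g a \<le> g t"
  proof (cases "a = t")
    case False
    then have "a < t" using assms(3) by simp
    then obtain s where "s \<in> {a<..<t}" "g t - g a = g' s * (t - a)"
      using mvt_simple[of a t g "\<lambda>s. (*) (g' s)"] g'(1) by (auto simp: has_field_derivative_def)
    moreover from this have "0 \<le> g' s * (t - a)" using g'(2)[of s] by (intro mult_nonneg_nonneg) auto
    ultimately show ?thesis by linarith
  qed simp
  moreover have "inverse (f a) > 0" using pos[of a] assms(3) by simp
  ultimately have "\<delta> * (t - a) \<le> inverse (f t)" 
    unfolding g_def right_diff_distrib by linarith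
  then have "f t * (\<delta> * (t - a)) \<le> f t * inverse (f t)" using False by (intro mult_left_mono) auto
  then show ?thesis using False by simp
qed

section \<open>Positive limit energy and convergence to the rest point\<close>

context damped_well
begin

text \<open>The slack \<open>H\<close> of this inequality satisfies \<open>H' = -2 \<phi> (H + u b - U)\<close>, and \<open>U \<ge> u b\<close> outside
  radius \<open>b\<close>; at time \<open>t\<^sub>1\<close> it is half the squared radial velocity.\<close>

lemma exterior_angsq_bound:
  assumes tr: "trajectory x v" and "t\<^sub>1 \<ge> 0" and b: "l\<^sub>0 \<le> b" "norm (x t\<^sub>1) = b"
    and out: "\<And>t. t \<ge> t\<^sub>1 \<Longrightarrow> norm (x t) \<ge> b" and "t \<ge> t\<^sub>1"
  shows "angsq (x t) (v t) \<le> 2 * b\<^sup>2 * (energy (x t) (v t) - u b)"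
proof -
  define H where "H t = energy (x t) (v t) - u b - angsq (x t) (v t) / (2 * b\<^sup>2)" for t
  define H' where "H' t = - (\<phi> (x t) * (v t \<bullet> v t)) - 0 - (- 2 * \<phi> (x t) * angsq (x t) (v t)) / (2 * b\<^sup>2)" for t
  have b0: "b > 0" using b l by linarith
  have dH: "(H has_real_derivative H' t) (at t within {0..})" if "t \<ge> 0" for t
    unfolding H_def[abs_def] H'_def
    by (intro DERIV_diff DERIV_cdivide DERIV_const trajectory_angsq_derivative trajectory_energy_derivative tr that)
  have "H t \<ge> 0"
  proof (rule nonneg_preserved[OF dH, of t\<^sub>1 t])
    have "(x t\<^sub>1 \<bullet> x t\<^sub>1) = b\<^sup>2" using b(2) by (simp flip: power2_norm_eq_inner)
    then have "angsq (x t\<^sub>1) (v t\<^sub>1) \<le> b\<^sup>2 * (v t\<^sub>1 \<bullet> v t\<^sub>1)" by (simp add: angsq_def)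
    then have "angsq (x t\<^sub>1) (v t\<^sub>1) / (2 * b\<^sup>2) \<le> (v t\<^sub>1 \<bullet> v t\<^sub>1) / 2" using b0 by (simp add: field_simps)
    then show "H t\<^sub>1 \<ge> 0" by (simp add: H_def energy_def U_eq b(2))
    show "H' s \<ge> 0" if "t\<^sub>1 < s" "H s < 0" for s
    proof -
      have "norm (x s) \<ge> b" using out that by simp
      then have "(max (b - l\<^sub>1) 0)\<^sup>2 \<le> (max (norm (x s) - l\<^sub>1) 0)\<^sup>2" by (intro power_mono) auto
      then have "u b \<le> U (x s)"
        using u_outer[of b] u_outer[of "norm (x s)"] \<open>norm (x s) \<ge> b\<close> b l by (simp add: U_eq min_def)
      moreover have "H' s = - 2 * \<phi> (x s) * (H s + u b - U (x s))"
        using b0 by (simp add: H'_def H_def energy_def field_simps)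
      ultimately show ?thesis
        using \<phi>_bounds(1)[of "x s"] that(2) by (simp add: mult_nonneg_nonpos)
    qed
  qed (use assms in auto)
  then show ?thesis using b0 by (simp add: H_def field_simps)
qed

text \<open>If the particle left radius b for good, the bound of \<open>exterior_angsq_bound\<close>
  would hold from the exit time on and pass to a limit trajectory. That limit stays beyond b, so it
  cannot rest at the origin and must stay beyond \<open>r\<^sub>0\<close>, which
  \<open>no_exterior_constant_energy\<close> forbids.\<close>

lemma frequently_inner:
  assumes tr: "trajectory x v" and lim: "((\<lambda>t. energy (x t) (v t)) \<longlongrightarrow> e) at_top" "e > 0"
    and b: "l\<^sub>0 \<le> b" "b < r\<^sub>0" and t0: "t\<^sub>0 \<ge> 0" "norm (x t\<^sub>0) \<le> b"
  shows "\<exists>t\<ge>T. norm (x t) \<le> b"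
proof (rule ccontr)
  assume "\<not> (\<exists>t\<ge>T. norm (x t) \<le> b)"
  then have T: "norm (x t) > b" if "t \<ge> T" for t using that by force
  have b0: "b > 0" using b l by linarith
  have cn: "continuous_on {s..t} (\<lambda>t. norm (x t))" if "s \<ge> 0" for s t
    using that by (intro continuous_on_norm continuous_on_subset[OF trajectory_continuous(1)[OF tr]]) auto
  define T' where "T' = max T t\<^sub>0"
  have "continuous_on {t\<^sub>0..T'} (\<lambda>t. - norm (x t))" using cn[OF t0(1)] by (rule continuous_on_minus)
  then obtain t1 where t1: "t\<^sub>0 \<le> t1" "t1 \<le> T'" "- norm (x t1) \<ge> - b"
    "\<And>q. t1 < q \<Longrightarrow> q \<le> T' \<Longrightarrow> - norm (x q) < - b"
    by (rule last_time_above[of t\<^sub>0 T' "\<lambda>t. - norm (x t)" "- b"])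
      (use t0 that in \<open>simp_all add: T'_def\<close>)
  have t10: "t1 \<ge> 0" using t1 t0 by simp
  have after: "norm (x t) > b" if "t > t1" for t
    using t1(4)[of t] T[of t] that by (cases "t \<le> T'") (auto simp: T'_def)
  have "T' > t1" using t1(2,3) T[of T'] by (cases "T' = t1") (auto simp: T'_def)
  have eq: "norm (x t1) = b"
  proof -
    obtain s where "t1 \<le> s" "s \<le> T'" "norm (x s) = b"
      using IVT'[of "\<lambda>t. norm (x t)" t1 b T'] t1(2,3) T[of T'] cn[OF t10] by (auto simp: T'_def)
    then show ?thesis using after[of s] by (cases "s = t1") auto
  qed
  have ge: "norm (x t) \<ge> b" if "t \<ge> t1" for t using after[of t] eq that by (cases "t = t1") auto
  obtain \<tau> X V where \<tau>: "filterlim \<tau> at_top sequentially" "\<And>n::nat. \<tau> n \<ge> 0"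
    "trajectory X V" "\<And>s. s \<ge> 0 \<Longrightarrow> energy (X s) (V s) = e"
    "\<And>s. s \<ge> 0 \<Longrightarrow> (\<lambda>n. x (s + \<tau> n)) \<longlonglongrightarrow> X s" "\<And>s. s \<ge> 0 \<Longrightarrow> (\<lambda>n. v (s + \<tau> n)) \<longlonglongrightarrow> V s"
    by (rule omega_limit[OF tr lim(1), of "\<lambda>_. True"]) (use that in auto)
  have ev: "\<forall>\<^sub>F n in sequentially. \<tau> n \<ge> t1"
    using \<tau>(1) by (simp add: filterlim_at_top)
  have Xb: "norm (X s) \<ge> b" if s: "s \<ge> 0" for s
  proof (rule tendsto_lowerbound)
    show "(\<lambda>n. norm (x (s + \<tau> n))) \<longlonglongrightarrow> norm (X s)" by (intro tendsto_norm \<tau>(5) s)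
    show "\<forall>\<^sub>F n in sequentially. b \<le> norm (x (s + \<tau> n))"
      using ev by eventually_elim (use ge s in auto)
  qed simp
  have out: "norm (X s) \<ge> r\<^sub>0" if s: "s \<ge> 0" for s
  proof (rule ccontr)
    assume "\<not> norm (X s) \<ge> r\<^sub>0"
    then have "X (0 + s) = 0"
      using constant_energy_rest(1)[OF trajectory_shift[OF \<tau>(3) s], of e] \<tau>(4) lim(2) s by simp
    then show False using Xb[OF s] b0 by simp
  qed
  have "angsq (X 0) (V 0) \<le> 2 * b\<^sup>2 * (e - u b)"
  proof (rule tendsto_le)
    have lims: "(\<lambda>n. x (\<tau> n)) \<longlonglongrightarrow> X 0" "(\<lambda>n. v (\<tau> n)) \<longlonglongrightarrow> V 0"
      using \<tau>(5)[of 0] \<tau>(6)[of 0] by simp_all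
    show "(\<lambda>n. angsq (x (\<tau> n)) (v (\<tau> n))) \<longlonglongrightarrow> angsq (X 0) (V 0)"
      unfolding angsq_def by (intro tendsto_intros lims)
    have "(\<lambda>n. energy (x (\<tau> n)) (v (\<tau> n))) \<longlonglongrightarrow> e"
      by (rule filterlim_compose[OF lim(1) \<tau>(1)])
    then show "(\<lambda>n. 2 * b\<^sup>2 * (energy (x (\<tau> n)) (v (\<tau> n)) - u b)) \<longlonglongrightarrow> 2 * b\<^sup>2 * (e - u b)"
      by (intro tendsto_intros)
    show "\<forall>\<^sub>F n in sequentially. angsq (x (\<tau> n)) (v (\<tau> n)) \<le> 2 * b\<^sup>2 * (energy (x (\<tau> n)) (v (\<tau> n)) - u b)"
      using ev by eventually_elim (use exterior_angsq_bound[OF tr t10 b(1) eq ge] in auto)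
  qed simp
  then show False
    using no_exterior_constant_energy[OF \<tau>(3,4) lim(2) out b] by blast
qed

text \<open>Infinitely many visits to |x| <= b produce a limit state in the damped region, which can
  only be the particle at rest in the origin, with energy U 0.\<close>

lemma positive_energy_limit_imp_rest:
  assumes tr: "trajectory x v" and lim: "((\<lambda>t. energy (x t) (v t)) \<longlongrightarrow> e) at_top" "e > 0"
    and t0: "t\<^sub>0 \<ge> 0" "norm (x t\<^sub>0) < r\<^sub>0"
  shows "(x \<longlongrightarrow> 0) at_top" "e = U 0"
proof -
  define b where "b = max (norm (x t\<^sub>0)) l\<^sub>0"
  have b: "l\<^sub>0 \<le> b" "b < r\<^sub>0" "norm (x t\<^sub>0) \<le> b" "b > 0" using t0 l by (auto simp: b_def)
  obtain \<tau> X V where \<tau>: "filterlim \<tau> at_top sequentially" "\<And>n::nat. norm (x (\<tau> n)) \<le> b"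
    "trajectory X V" "\<And>s. s \<ge> 0 \<Longrightarrow> energy (X s) (V s) = e"
    "\<And>s. s \<ge> 0 \<Longrightarrow> (\<lambda>n. x (s + \<tau> n)) \<longlonglongrightarrow> X s"
    by (rule omega_limit[OF tr lim(1) frequently_inner[OF tr lim b(1,2) t0(1) b(3)]]) (rule that)
  have lx: "(\<lambda>n. x (\<tau> n)) \<longlonglongrightarrow> X 0" using \<tau>(5)[of 0] by simp
  have "norm (X 0) \<le> b"
    by (rule tendsto_upperbound[OF tendsto_norm[OF lx]]) (use \<tau>(2) in auto)
  then have XV: "X 0 = 0" "V 0 = 0"
    using constant_energy_rest[OF \<tau>(3,4) lim(2)] b by auto
  show "e = U 0" using \<tau>(4)[of 0] XV by (simp add: energy_def)
  show "(x \<longlongrightarrow> 0) at_top"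
  proof (rule ccontr)
    assume "\<not> (x \<longlongrightarrow> 0) at_top"
    then obtain \<delta>0 where \<delta>0: "\<delta>0 > 0" "\<And>T. \<exists>t\<ge>T. norm (x t) \<ge> \<delta>0"
      unfolding tendsto_iff eventually_at_top_linorder by (auto simp: not_less)
    define \<delta> where "\<delta> = min \<delta>0 b"
    have \<delta>: "\<delta> > 0" "\<delta> < r\<^sub>0" using \<delta>0 b by (auto simp: \<delta>_def)
    \<comment> \<open>The particle is near 0 at the times \<tau> n and outside \<delta> at
      arbitrarily late times, so it keeps crossing the sphere of radius \<delta>. A limit state on
      that sphere would again have to rest at 0.\<close>
    have "\<exists>t\<ge>T. norm (x t) = \<delta>" for T
    proof -
      obtain t1 where t1: "t1 \<ge> max T 0" "norm (x t1) \<ge> \<delta>"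
        using \<delta>0(2)[of "max T 0"] by (auto simp: \<delta>_def min_le_iff_disj)
      have "\<forall>\<^sub>F n in sequentially. norm (x (\<tau> n)) < \<delta>"
        using order_tendstoD(2)[OF tendsto_norm[OF lx]] XV \<delta> by simp
      moreover have "\<forall>\<^sub>F n in sequentially. \<tau> n \<ge> t1"
        using \<tau>(1) by (simp add: filterlim_at_top)
      ultimately have "\<forall>\<^sub>F n in sequentially. norm (x (\<tau> n)) < \<delta> \<and> \<tau> n \<ge> t1"
        by eventually_elim simp
      then obtain n where n: "norm (x (\<tau> n)) < \<delta>" "\<tau> n \<ge> t1"
        by (auto simp: eventually_sequentially)
      have "continuous_on {t1..\<tau> n} (\<lambda>t. norm (x t))"
        using t1 by (intro continuous_on_norm continuous_on_subset[OF trajectory_continuous(1)[OF tr]]) auto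
      then obtain s where "t1 \<le> s" "s \<le> \<tau> n" "norm (x s) = \<delta>"
        using IVT2'[of "\<lambda>t. norm (x t)" "\<tau> n" \<delta> t1] t1 n by auto
      then show ?thesis using t1 by (intro exI[of _ s]) auto
    qed
    from omega_limit[OF tr lim(1) this] obtain \<sigma> X' V' where \<sigma>: "\<And>n::nat. norm (x (\<sigma> n)) = \<delta>"
      "trajectory X' V'" "\<And>s. s \<ge> 0 \<Longrightarrow> energy (X' s) (V' s) = e"
      "\<And>s. s \<ge> 0 \<Longrightarrow> (\<lambda>n. x (s + \<sigma> n)) \<longlonglongrightarrow> X' s"
      by metis
    have "(\<lambda>n. norm (x (\<sigma> n))) \<longlonglongrightarrow> norm (X' 0)" using tendsto_norm[OF \<sigma>(4)[of 0]] by simp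
    then have "norm (X' 0) = \<delta>" unfolding \<sigma>(1) by (simp add: LIMSEQ_const_iff)
    then show False
      using constant_energy_rest(1)[OF \<sigma>(2,3) lim(2)] \<delta> by auto
  qed
qed

text \<open>A component \<open>L\<close> of the angular momentum decays like \<open>L' = - \<phi> L\<close>. If it is nonzero while
  \<open>x \<rightarrow> 0\<close>, then \<open>|x|\<^sup>2 = O(L)\<close>, hence \<open>|v|\<^sup>2 / L\<close> is bounded below, and \<open>x \<bullet> v / L\<close>, whose derivative
  dominates \<open>|v|\<^sup>2 / L\<close>, becomes positive: the particle moves away from the origin.\<close>

lemma angular_momentum_nonpos_if_tendsto_zero:
  assumes tr: "trajectory x v" and lim: "(x \<longlongrightarrow> 0) at_top" and bc: "b \<in> Basis" "c \<in> Basis"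
  shows "(x 0 \<bullet> b) * (v 0 \<bullet> c) - (x 0 \<bullet> c) * (v 0 \<bullet> b) \<le> 0"
proof (rule ccontr)
  define L where "L t = (x t \<bullet> b) * (v t \<bullet> c) - (x t \<bullet> c) * (v t \<bullet> b)" for t
  define q where "q t = x t \<bullet> v t" for t
  assume "\<not> (x 0 \<bullet> b) * (v 0 \<bullet> c) - (x 0 \<bullet> c) * (v 0 \<bullet> b) \<le> 0"
  then have L0: "L 0 > 0" by (simp add: L_def)
  have dL: "(L has_real_derivative - (\<phi> (x t) * L t)) (at t within {0..})" if t: "t \<ge> 0" for t
  proof -
    have i: "((\<lambda>t. y t \<bullet> d) has_real_derivative y' \<bullet> d) (at t within {0..})"
      if "(y has_vector_derivative y') (at t within {0..})" for y :: "real \<Rightarrow> 'a" and y' d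
      using has_real_derivative_inner[OF that has_vector_derivative_const[of d]] by simp
    note dx = i[OF trajectoryD(1)[OF tr t]] and dv = i[OF trajectoryD(2)[OF tr t]]
    define g where "g = w (norm (x t)) / norm (x t)"
    have G: "G (x t) = g *\<^sub>R x t" by (simp add: G_eq g_def)
    show ?thesis
      unfolding L_def[abs_def]
      using DERIV_diff[OF DERIV_mult[OF dx[of b] dv[of c]] DERIV_mult[OF dx[of c] dv[of b]]]
      by (simp add: G inner_diff_left algebra_simps)
  qed
  have Lpos: "L t > 0" if t: "t \<ge> 0" for t
  proof -
    have nn: "L s \<ge> 0" if "s \<ge> 0" for s
      by (rule nonneg_preserved[OF dL, of 0]) (use that L0 \<phi>_bounds(1) in \<open>auto intro: mult_nonneg_nonpos\<close>)
    \<comment> \<open>As \<phi> <= B, L decays no faster than exp (- B t) and never reaches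
      0.\<close>
    have "exp (B * 0) * L 0 \<le> exp (B * t) * L t"
    proof (rule nondecreasing_if_deriv_nonneg[where f = "\<lambda>t. exp (B * t) * L t" and a = 0
          and f' = "\<lambda>s. exp (B * s) * ((B - \<phi> (x s)) * L s)"])
      show "((\<lambda>t. exp (B * t) * L t) has_real_derivative exp (B * s) * ((B - \<phi> (x s)) * L s)) (at s within {0..})" if "s \<ge> 0" for s
        using dL[OF that] by (auto intro!: derivative_eq_intros simp: algebra_simps)
      show "exp (B * s) * ((B - \<phi> (x s)) * L s) \<ge> 0" if "0 < s" for s
        using nn[of s] \<phi>_bounds(2)[of "x s"] that by (intro mult_nonneg_nonneg) auto
    qed (use t in auto)
    then have "exp (B * t) * L t > 0" using L0 by simp
    then show ?thesis by (simp add: zero_less_mult_iff)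
  qed
  define c0 where "c0 = \<phi> 0 / 2"
  have "\<phi> 0 > 0" using \<phi>_pos[of 0] l by simp
  then have c0: "c0 > 0" "c0 < \<phi> 0" by (auto simp: c0_def)
  have "isCont \<phi> 0" using continuous_\<phi>[of UNIV] by (simp add: continuous_on_eq_continuous_at)
  then have "((\<lambda>t. \<phi> (x t)) \<longlongrightarrow> \<phi> 0) at_top" using lim by (rule isCont_tendsto_compose)
  then have e1: "\<forall>\<^sub>F t in at_top. c0 < \<phi> (x t)" using c0(2) by (rule order_tendstoD)
  have e2: "\<forall>\<^sub>F t in at_top. norm (x t) < l\<^sub>0"
    using order_tendstoD(2)[OF tendsto_norm[OF lim]] l by simp
  from eventually_conj[OF e1 e2] obtain T' where T': "\<And>t. t \<ge> T' \<Longrightarrow> c0 < \<phi> (x t) \<and> norm (x t) < l\<^sub>0"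
    unfolding eventually_at_top_linorder by blast
  define T where "T = max T' 0"
  have T: "T \<ge> 0" "\<And>t. t \<ge> T \<Longrightarrow> c0 \<le> \<phi> (x t)" "\<And>t. t \<ge> T \<Longrightarrow> norm (x t) < l\<^sub>0"
    using T' by (force simp: T_def)+
  have xx0: "((\<lambda>t. x t \<bullet> x t) \<longlongrightarrow> 0) at_top"
    using tendsto_inner[OF lim lim] by simp
  define p where "p t = q t / L t" for t
  define p' where "p' t = (v t \<bullet> v t - x t \<bullet> G (x t)) / L t" for t
  have dp: "(p has_real_derivative p' t) (at t within {0..})" if t: "t \<ge> 0" for t
  proof -
    define q' where "q' = v t \<bullet> v t - \<phi> (x t) * (x t \<bullet> v t) - x t \<bullet> G (x t)"
    have "((\<lambda>t. (x t \<bullet> v t) / L t) has_real_derivative (q' * L t - (x t \<bullet> v t) * (- (\<phi> (x t) * L t))) / (L t * L t)) (at t within {0..})"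
      unfolding q'_def using Lpos[OF t]
      by (intro DERIV_divide trajectory_inner_derivatives[OF tr t] dL t) auto
    moreover have "(q' * L t - (x t \<bullet> v t) * (- (\<phi> (x t) * L t))) / (L t * L t) = p' t"
      using Lpos[OF t] by (simp add: p'_def q'_def field_simps)
    ultimately show ?thesis by (simp add: p_def[abs_def] q_def)
  qed
  have p': "p' t \<ge> (v t \<bullet> v t) / L t" if t: "t \<ge> T" for t
  proof -
    have "x t \<bullet> G (x t) \<le> 0"
      using w_neg[of "norm (x t)"] T(3)[OF t] unfolding inner_self_G
      by (cases "x t = 0") (auto intro!: mult_neg_pos less_imp_le)
    then show ?thesis unfolding p'_def using Lpos[of t] T(1) t by (intro divide_right_mono) auto
  qed
  have p'0: "p' t \<ge> 0" if "t \<ge> T" for t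
    using p'[OF that] Lpos[of t] T(1) that by (intro order_trans[OF _ p'[OF that]]) auto
  have dxx: "((\<lambda>t. x t \<bullet> x t) has_real_derivative 2 * q t) (at t within {0..})" if "t \<ge> 0" for t
    unfolding q_def by (rule trajectory_inner_derivatives(1)[OF tr that])
  \<comment> \<open>Once p >= 0 it stays so, and |x| no longer decreases; with x -> 0 this leaves x
    t = 0, where L vanishes.\<close>
  have pneg: "p t < 0" if t: "t \<ge> T" for t
  proof (rule ccontr)
    assume "\<not> p t < 0"
    have pn: "p s \<ge> 0" if "s \<ge> t" for s
    proof -
      have "p t \<le> p s"
        by (rule nondecreasing_if_deriv_nonneg[OF dp]) (use that t T(1) p'0 in auto)
      then show ?thesis using \<open>\<not> p t < 0\<close> by simp
    qed
    have qn: "q s \<ge> 0" if "s \<ge> t" for s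
      using pn[OF that] Lpos[of s] t T(1) that by (simp add: p_def zero_le_divide_iff)
    have "x t \<bullet> x t \<le> x s \<bullet> x s" if "s \<ge> t" for s
      by (rule nondecreasing_if_deriv_nonneg[OF dxx]) (use that t T(1) qn in auto)
    then have "x t \<bullet> x t \<le> 0"
      by (intro tendsto_lowerbound[OF xx0] eventually_at_top_linorderI[of t]) auto
    then have "x t \<bullet> x t = 0" using inner_ge_zero[of "x t"] by linarith
    then have "x t = 0" by simp
    then show False using Lpos[of t] t T(1) by (simp add: L_def)
  qed
  define C where "C = - p T"
  have C: "C > 0" using pneg[of T] by (simp add: C_def)
  have qC: "q t \<ge> - (C * L t)" if t: "t \<ge> T" for t
  proof -
    have "p T \<le> p t"
      by (rule nondecreasing_if_deriv_nonneg[OF dp]) (use t T(1) p'0 in auto)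
    then show ?thesis using Lpos[of t] t T(1) by (simp add: C_def p_def field_simps)
  qed
  \<comment> \<open>Makes |x|^2 - \<kappa> L nondecreasing: its derivative is 2 q + \<kappa> \<phi>
    L, with q >= - C L and \<phi> >= c0. As it stays below |x|^2 -> 0, it is never positive.\<close>
  define \<kappa> where "\<kappa> = 2 * C / c0"
  have \<kappa>: "\<kappa> > 0" using C c0 by (simp add: \<kappa>_def)
  have xL: "x t \<bullet> x t \<le> \<kappa> * L t" if t: "t \<ge> T" for t
  proof -
    have mono: "x t \<bullet> x t - \<kappa> * L t \<le> x s \<bullet> x s - \<kappa> * L s" if s: "s \<ge> t" for s
    proof (rule nondecreasing_if_deriv_nonneg[where f = "\<lambda>r. x r \<bullet> x r - \<kappa> * L r" and a = 0
          and f' = "\<lambda>r. 2 * q r - \<kappa> * (- (\<phi> (x r) * L r))"])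
      show "((\<lambda>r. x r \<bullet> x r - \<kappa> * L r) has_real_derivative 2 * q r - \<kappa> * (- (\<phi> (x r) * L r))) (at r within {0..})"
        if "r \<ge> 0" for r
        by (intro DERIV_diff DERIV_cmult dxx dL that)
      show "2 * q r - \<kappa> * (- (\<phi> (x r) * L r)) \<ge> 0" if "t < r" for r
      proof -
        have r: "r \<ge> T" using t that by simp
        have "2 * (C * L r) = \<kappa> * (c0 * L r)" using c0 by (simp add: \<kappa>_def)
        also have "\<dots> \<le> \<kappa> * (\<phi> (x r) * L r)"
          using T(2)[OF r] \<kappa> Lpos[of r] r T(1) by (intro mult_left_mono mult_right_mono) auto
        finally show ?thesis using qC[OF r] by simp
      qed
    qed (use s t T(1) in auto)
    have "x t \<bullet> x t - \<kappa> * L t \<le> x s \<bullet> x s" if s: "s \<ge> t" for s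
    proof -
      have "\<kappa> * L s \<ge> 0" using \<kappa> Lpos[of s] s t T(1) by simp
      then show ?thesis using mono[OF s] by linarith
    qed
    then have "x t \<bullet> x t - \<kappa> * L t \<le> 0"
      by (intro tendsto_lowerbound[OF xx0] eventually_at_top_linorderI[of t]) auto
    then show ?thesis by simp
  qed
  have lower: "p' t \<ge> 1 / (4 * \<kappa>)" if t: "t \<ge> T" for t
  proof -
    have Lt: "L t > 0" using Lpos[of t] t T(1) by simp
    have c: "\<bar>y \<bullet> d\<bar> \<le> norm y" if "d \<in> Basis" for y d :: 'a using Basis_le_norm[OF that] .
    have "L t \<le> \<bar>x t \<bullet> b\<bar> * \<bar>v t \<bullet> c\<bar> + \<bar>x t \<bullet> c\<bar> * \<bar>v t \<bullet> b\<bar>"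
      unfolding L_def abs_mult[symmetric] by linarith
    also have "\<dots> \<le> norm (x t) * norm (v t) + norm (x t) * norm (v t)"
      by (intro add_mono mult_mono c bc) auto
    finally have "(L t)\<^sup>2 \<le> (2 * (norm (x t) * norm (v t)))\<^sup>2" using Lt
      by (intro power_mono) (simp_all add: mult.commute[of "norm (v t)"])
    also have "\<dots> = 4 * ((x t \<bullet> x t) * (v t \<bullet> v t))"
      by (simp add: power_mult_distrib power2_norm_eq_inner)
    also have "\<dots> \<le> 4 * ((\<kappa> * L t) * (v t \<bullet> v t))"
      using xL[OF t] by (intro mult_left_mono mult_right_mono) auto
    finally have "L t * L t \<le> (4 * \<kappa> * (v t \<bullet> v t)) * L t" by (simp add: power2_eq_square mult_ac)
    then have "L t \<le> 4 * \<kappa> * (v t \<bullet> v t)" using Lt by simp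
    then have "1 / (4 * \<kappa>) \<le> (v t \<bullet> v t) / L t" using Lt \<kappa> by (simp add: field_simps)
    then show ?thesis using p'[OF t] by linarith
  qed
  show False
    by (rule no_linear_decay[of 0 "\<lambda>t. - p t" "\<lambda>t. - p' t" T "1 / (4 * \<kappa>)" 0])
      (use DERIV_minus[OF dp] lower pneg T(1) \<kappa> in \<open>auto simp: less_imp_le\<close>)
qed

lemma angular_momentum_zero_if_tendsto_zero:
  assumes "trajectory x v" "(x \<longlongrightarrow> 0) at_top" "b \<in> Basis" "c \<in> Basis"
  shows "(x 0 \<bullet> b) * (v 0 \<bullet> c) = (x 0 \<bullet> c) * (v 0 \<bullet> b)"
  using angular_momentum_nonpos_if_tendsto_zero[OF assms]
    angular_momentum_nonpos_if_tendsto_zero[OF assms(1,2,4,3)] by linarith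

end

section \<open>Trajectories that tend to the unstable rest point\<close>

text \<open>Pick a member of A above every rational that has one. Only a greatest element can
  escape, and M adds it.\<close>

lemma countable_cofinal_real:
  fixes A :: "real set"
  obtains D where "countable D" "D \<subseteq> A" "\<And>a. a \<in> A \<Longrightarrow> \<exists>d\<in>D. a \<le> d"
proof -
  define pick where "pick q = (SOME d. d \<in> A \<and> d \<ge> q)" for q :: real
  define Q where "Q = {q \<in> \<rat>. \<exists>d\<in>A. d \<ge> q}"
  have pick: "pick q \<in> A \<and> pick q \<ge> q" if "q \<in> Q" for q
    unfolding pick_def by (rule someI_ex) (use that in \<open>auto simp: Q_def\<close>)
  define M where "M = {m \<in> A. \<forall>a\<in>A. a \<le> m}"
  show ?thesis
  proof (rule that[of "pick ` Q \<union> M"])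
    have "M = {} \<or> (\<exists>m. M = {m})" by (force simp: M_def)
    then have "countable M" by auto
    moreover have "countable Q" by (rule countable_subset[OF _ countable_rat]) (auto simp: Q_def)
    ultimately show "countable (pick ` Q \<union> M)" by simp
    show "pick ` Q \<union> M \<subseteq> A" using pick by (auto simp: M_def)
    show "\<exists>d\<in>pick ` Q \<union> M. a \<le> d" if a: "a \<in> A" for a
    proof (cases "a \<in> M")
      case False
      then obtain b where "b \<in> A" "a < b" using a by (auto simp: M_def not_le)
      moreover obtain q where "q \<in> \<rat>" "a < q" "q < b" using Rats_dense_in_real[OF \<open>a < b\<close>] by blast
      ultimately have "q \<in> Q" by (auto simp: Q_def intro: less_imp_le)
      then show ?thesis using pick[OF \<open>q \<in> Q\<close>] \<open>a < q\<close> by (intro bexI[of _ "pick q"]) auto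
    qed auto
  qed
qed

text \<open>The position falls strictly to 0, so time is a function g of position with derivative
  1/velocity, and the limit of infinite time becomes the limit at position 0. Velocities of
  different trajectories can then be compared at equal positions.\<close>

lemma position_parametrisation:
  fixes \<xi> \<eta> :: "real \<Rightarrow> real"
  assumes d: "\<And>t. t \<ge> 0 \<Longrightarrow> (\<xi> has_real_derivative \<eta> t) (at t within {0..})"
    and neg: "\<And>t. t \<ge> 0 \<Longrightarrow> \<eta> t < 0" and pos: "\<And>t. t \<ge> 0 \<Longrightarrow> \<xi> t > 0" and lim: "(\<xi> \<longlongrightarrow> 0) at_top"
  obtains g where "\<And>y. 0 < y \<Longrightarrow> y < \<xi> 0 \<Longrightarrow> g y > 0 \<and> \<xi> (g y) = y"
    and "\<And>y. 0 < y \<Longrightarrow> y < \<xi> 0 \<Longrightarrow> (g has_real_derivative inverse (\<eta> (g y))) (at y)"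
    and "filterlim g at_top (at_right 0)"
proof -
  have cont: "continuous_on {s..t} \<xi>" if "s \<ge> 0" for s t
    by (rule has_real_derivative_continuous_on_Icc[OF d that])
  have strict: "\<xi> t < \<xi> s" if "0 \<le> s" "s < t" for s t
  proof -
    have "(\<xi> has_derivative (*) (\<eta> r)) (at r within {s..t})" if "s \<le> r" "r \<le> t" for r
      using DERIV_subset[OF d[of r], of "{s..t}"] that \<open>0 \<le> s\<close> by (simp add: has_field_derivative_def)
    from mvt_simple[OF that(2) this] obtain r where r: "s < r" "\<xi> t - \<xi> s = \<eta> r * (t - s)"
      by auto
    have "\<eta> r * (t - s) < 0" using neg[of r] r that by (intro mult_neg_pos) auto
    then show ?thesis using r by linarith
  qed
  have inj: "s = t" if "\<xi> s = \<xi> t" "s \<ge> 0" "t \<ge> 0" for s t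
    using strict[of s t] strict[of t s] that by (cases s t rule: linorder_cases) auto
  have D: "(\<xi> has_real_derivative \<eta> t) (at t)" if "t > 0" for t
  proof -
    have "(\<xi> has_real_derivative \<eta> t) (at t within {0<..})"
      by (rule DERIV_subset[OF d]) (use that in auto)
    then show ?thesis using that at_within_open[of t "{0<..}"] by simp
  qed
  have ex: "\<exists>t>0. \<xi> t = y" if y: "0 < y" "y < \<xi> 0" for y
  proof -
    have "\<forall>\<^sub>F t in at_top. \<xi> t < y" using lim y(1) by (rule order_tendstoD)
    then obtain N where "\<And>t. t \<ge> N \<Longrightarrow> \<xi> t < y" unfolding eventually_at_top_linorder by blast
    then have N: "\<xi> (max N 0) \<le> y" by (simp add: less_imp_le)
    have "\<exists>t\<ge>0. t \<le> max N 0 \<and> \<xi> t = y"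
      by (rule IVT2'[OF N less_imp_le[OF y(2)] _ cont]) simp_all
    then obtain t where "0 \<le> t" "\<xi> t = y" by blast
    then show ?thesis using y by (intro exI[of _ t]) (cases "t = 0", auto)
  qed
  define g where "g y = (SOME t. t > 0 \<and> \<xi> t = y)" for y
  have g: "g y > 0 \<and> \<xi> (g y) = y" if "0 < y" "y < \<xi> 0" for y
    unfolding g_def by (rule someI_ex) (use ex[OF that] in auto)
  have g\<xi>: "g (\<xi> t) = t" if "t > 0" for t
    using inj[of "g (\<xi> t)" t] g[of "\<xi> t"] pos[of t] strict[of 0 t] that by simp
  have gc: "isCont g y" if y: "0 < y" "y < \<xi> 0" for y
  proof -
    have "isCont g (\<xi> (g y))"
    proof (rule isCont_inverse_function2[of "g y / 2" "g y" "g y + 1"])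
      show "isCont \<xi> z" if "g y / 2 \<le> z" for z
        by (rule DERIV_isCont[OF D]) (use g[OF y] that in auto)
    qed (use g[OF y] g\<xi> in auto)
    then show ?thesis using g[OF y] by simp
  qed
  show ?thesis
  proof (rule that[of g])
    show "(g has_real_derivative inverse (\<eta> (g y))) (at y)" if y: "0 < y" "y < \<xi> 0" for y
    proof (rule DERIV_inverse_function[where f = \<xi> and a = 0 and b = "\<xi> 0"])
      have gy: "g y > 0" using g[OF y] by simp
      show "(\<xi> has_real_derivative \<eta> (g y)) (at (g y))" by (rule D[OF gy])
      show "\<eta> (g y) \<noteq> 0" using neg[of "g y"] gy by simp
    qed (use y g gc[OF y] in auto)
    show "filterlim g at_top (at_right 0)"
      unfolding filterlim_at_top
    proof
      fix Z :: real
      define Z' where "Z' = max Z 1"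
      have "\<xi> Z' > 0" "\<xi> Z' < \<xi> 0" using pos[of Z'] strict[of 0 Z'] by (auto simp: Z'_def)
      have "g y \<ge> Z" if y: "0 < y" "y < \<xi> Z'" for y
      proof (rule ccontr)
        assume "\<not> g y \<ge> Z"
        then have "g y < Z'" by (auto simp: Z'_def)
        then have "\<xi> Z' < \<xi> (g y)" using strict[of "g y" Z'] g[of y] y \<open>\<xi> Z' < \<xi> 0\<close> by simp
        then show False using g[of y] y \<open>\<xi> Z' < \<xi> 0\<close> by simp
      qed
      then show "\<forall>\<^sub>F y in at_right 0. Z \<le> g y"
        using \<open>\<xi> Z' > 0\<close> unfolding eventually_at_right_field by blast
    qed
  qed (rule g)
qed

text \<open>In the phase plane the two velocities \<open>V\<^sub>1\<close>, \<open>V\<^sub>2\<close> at position \<open>y\<close> satisfy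
  \<open>(V\<^sub>1 - V\<^sub>2)' = w (V\<^sub>1 - V\<^sub>2) / (V\<^sub>1 V\<^sub>2)\<close> with \<open>w < 0\<close>, so their distance can only shrink away from \<open>0\<close>,
  where it vanishes.\<close>

lemma scalar_sinks_meet:
  fixes \<xi>1 \<eta>1 \<xi>2 \<eta>2 f w :: "real \<Rightarrow> real"
  assumes d1: "\<And>t. t \<ge> 0 \<Longrightarrow> (\<xi>1 has_real_derivative \<eta>1 t) (at t within {0..})"
      "\<And>t. t \<ge> 0 \<Longrightarrow> (\<eta>1 has_real_derivative - f (\<xi>1 t) * \<eta>1 t - w (\<xi>1 t)) (at t within {0..})"
    and d2: "\<And>t. t \<ge> 0 \<Longrightarrow> (\<xi>2 has_real_derivative \<eta>2 t) (at t within {0..})"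
      "\<And>t. t \<ge> 0 \<Longrightarrow> (\<eta>2 has_real_derivative - f (\<xi>2 t) * \<eta>2 t - w (\<xi>2 t)) (at t within {0..})"
    and s1: "\<And>t. t \<ge> 0 \<Longrightarrow> \<xi>1 t > 0" "\<And>t. t \<ge> 0 \<Longrightarrow> \<eta>1 t < 0"
    and s2: "\<And>t. t \<ge> 0 \<Longrightarrow> \<xi>2 t > 0" "\<And>t. t \<ge> 0 \<Longrightarrow> \<eta>2 t < 0"
    and l1: "(\<xi>1 \<longlongrightarrow> 0) at_top" "(\<eta>1 \<longlongrightarrow> 0) at_top"
    and l2: "(\<xi>2 \<longlongrightarrow> 0) at_top" "(\<eta>2 \<longlongrightarrow> 0) at_top"
    and w: "\<And>y. 0 < y \<Longrightarrow> y < \<xi>1 0 \<Longrightarrow> w y \<le> 0"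
  obtains t1 t2 where "t1 \<ge> 0" "t2 \<ge> 0" "\<xi>1 t1 = \<xi>2 t2" "\<eta>1 t1 = \<eta>2 t2"
proof -
  obtain g1 where g1: "\<And>y. 0 < y \<Longrightarrow> y < \<xi>1 0 \<Longrightarrow> g1 y > 0 \<and> \<xi>1 (g1 y) = y"
    "\<And>y. 0 < y \<Longrightarrow> y < \<xi>1 0 \<Longrightarrow> (g1 has_real_derivative inverse (\<eta>1 (g1 y))) (at y)"
    "filterlim g1 at_top (at_right 0)"
    by (rule position_parametrisation[OF d1(1) s1(2,1) l1(1)]) (assumption | rule that)+
  obtain g2 where g2: "\<And>y. 0 < y \<Longrightarrow> y < \<xi>2 0 \<Longrightarrow> g2 y > 0 \<and> \<xi>2 (g2 y) = y"
    "\<And>y. 0 < y \<Longrightarrow> y < \<xi>2 0 \<Longrightarrow> (g2 has_real_derivative inverse (\<eta>2 (g2 y))) (at y)"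
    "filterlim g2 at_top (at_right 0)"
    by (rule position_parametrisation[OF d2(1) s2(2,1) l2(1)]) (assumption | rule that)+
  \<comment> \<open>All positions below y0 are visited by both trajectories.\<close>
  define y0 where "y0 = min (\<xi>1 0) (\<xi>2 0)"
  have y0: "y0 > 0" using s1(1)[of 0] s2(1)[of 0] by (simp add: y0_def)
  have at: "(h has_real_derivative h') (at t)" if "(h has_real_derivative h') (at t within {0..})" "t > 0" for h :: "real \<Rightarrow> real" and h' t
  proof -
    have "(h has_real_derivative h') (at t within {0<..})"
      by (rule DERIV_subset[OF that(1)]) auto
    then show ?thesis using that(2) at_within_open[of t "{0<..}"] by simp
  qed
  define V1 V2 where "V1 y = \<eta>1 (g1 y)" and "V2 y = \<eta>2 (g2 y)" for y
  have V: "V1 y < 0" "V2 y < 0" if "0 < y" "y < y0" for y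
    using s1(2) s2(2) g1(1)[of y] g2(1)[of y] that by (auto simp: V1_def V2_def y0_def less_imp_le)
  have dV1: "(V1 has_real_derivative - f y - w y / V1 y) (at y)" if y: "0 < y" "y < y0" for y
  proof -
    have g: "g1 y > 0" "\<xi>1 (g1 y) = y" using g1(1)[of y] y by (auto simp: y0_def)
    have "(V1 has_real_derivative (- f y * V1 y - w y) * inverse (V1 y)) (at y)"
      unfolding V1_def[abs_def]
      using DERIV_chain2[OF at[OF d1(2)[of "g1 y"] g(1)] g1(2)[of y]] g y by (simp add: y0_def)
    moreover have "(- f y * V1 y - w y) * inverse (V1 y) = - f y - w y / V1 y"
      using V[OF y] by (simp add: field_simps)
    ultimately show ?thesis by simp
  qed
  have dV2: "(V2 has_real_derivative - f y - w y / V2 y) (at y)" if y: "0 < y" "y < y0" for y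
  proof -
    have g: "g2 y > 0" "\<xi>2 (g2 y) = y" using g2(1)[of y] y by (auto simp: y0_def)
    have "(V2 has_real_derivative (- f y * V2 y - w y) * inverse (V2 y)) (at y)"
      unfolding V2_def[abs_def]
      using DERIV_chain2[OF at[OF d2(2)[of "g2 y"] g(1)] g2(2)[of y]] g y by (simp add: y0_def)
    moreover have "(- f y * V2 y - w y) * inverse (V2 y) = - f y - w y / V2 y"
      using V[OF y] by (simp add: field_simps)
    ultimately show ?thesis by simp
  qed
  define Q where "Q y = (V1 y - V2 y)\<^sup>2" for y
  define Q' where "Q' y = 2 * (V1 y - V2 y) * ((- f y - w y / V1 y) - (- f y - w y / V2 y))" for y
  have dQ: "(Q has_real_derivative Q' y) (at y)" if "0 < y" "y < y0" for y
    unfolding Q_def[abs_def] Q'_def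
    by (rule derivative_eq_intros dV1 dV2 that refl | simp add: that)+
  have Q': "Q' y \<le> 0" if y: "0 < y" "y < y0" for y
  proof -
    have "Q' y = 2 * (w y * ((V1 y - V2 y)\<^sup>2 / (V1 y * V2 y)))"
      using V[OF y] by (simp add: Q'_def field_simps power2_eq_square)
    moreover have nn: "(V1 y - V2 y)\<^sup>2 / (V1 y * V2 y) \<ge> 0"
      using V[OF y] by (intro divide_nonneg_pos) (auto simp: mult_neg_neg)
    moreover have "w y * ((V1 y - V2 y)\<^sup>2 / (V1 y * V2 y)) \<le> 0"
      using w[of y] y by (intro mult_nonpos_nonneg nn) (simp add: y0_def)
    ultimately show ?thesis by linarith
  qed
  have mono: "Q z \<le> Q y" if "0 < y" "y \<le> z" "z < y0" for y z
  proof (rule DERIV_nonpos_imp_nonincreasing[OF that(2)])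
    show "\<exists>d. (Q has_real_derivative d) (at x) \<and> d \<le> 0" if "y \<le> x" "x \<le> z" for x
      using dQ[of x] Q'[of x] that \<open>0 < y\<close> \<open>z < y0\<close> by (intro exI[of _ "Q' x"]) auto
  qed
  define y where "y = y0 / 2"
  have y: "0 < y" "y < y0" using y0 by (auto simp: y_def)
  have "((\<lambda>z. (\<eta>1 (g1 z) - \<eta>2 (g2 z))\<^sup>2) \<longlongrightarrow> (0 - 0)\<^sup>2) (at_right 0)"
    by (intro tendsto_intros filterlim_compose[OF l1(2) g1(3)] filterlim_compose[OF l2(2) g2(3)])
  then have "(Q \<longlongrightarrow> 0) (at_right 0)" by (simp add: Q_def[abs_def] V1_def V2_def)
  moreover have "\<forall>\<^sub>F z in at_right 0. Q y \<le> Q z"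
    unfolding eventually_at_right_field using y mono[of _ y] by (intro exI[of _ y]) auto
  ultimately have "Q y \<le> 0" by (rule tendsto_lowerbound) simp
  then have "V1 y = V2 y" by (simp add: Q_def)
  then show ?thesis
    using g1(1)[of y] g2(1)[of y] y by (intro that[of "g1 y" "g2 y"]) (auto simp: V1_def V2_def y0_def)
qed

section \<open>Trajectories on the line that sink into the origin\<close>

context damped_well
begin

definition sink :: "(real \<Rightarrow> 'a) \<Rightarrow> (real \<Rightarrow> 'a) \<Rightarrow> bool" where
  "sink x v \<longleftrightarrow> trajectory x v \<and> (x \<longlongrightarrow> 0) at_top \<and> (v \<longlongrightarrow> 0) at_top"

lemma sinkD: "sink x v \<Longrightarrow> trajectory x v" "sink x v \<Longrightarrow> (x \<longlongrightarrow> 0) at_top" "sink x v \<Longrightarrow> (v \<longlongrightarrow> 0) at_top"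
  by (auto simp: sink_def)

lemma energy_limit_rest_imp_sink:
  assumes "trajectory x v" "(x \<longlongrightarrow> 0) at_top" "((\<lambda>t. energy (x t) (v t)) \<longlongrightarrow> U 0) at_top"
  shows "sink x v"
proof -
  have "isCont U 0" using continuous_U[of UNIV] by (simp add: continuous_on_eq_continuous_at)
  then have "((\<lambda>t. U (x t)) \<longlongrightarrow> U 0) at_top" using assms(2) by (rule isCont_tendsto_compose)
  with assms(3) have "((\<lambda>t. sqrt (2 * (energy (x t) (v t) - U (x t)))) \<longlongrightarrow> sqrt (2 * (U 0 - U 0))) at_top"
    by (intro tendsto_intros)
  then have "((\<lambda>t. norm (v t)) \<longlongrightarrow> 0) at_top"
    by (simp add: energy_def norm_eq_sqrt_inner)
  then show ?thesis using assms by (simp add: sink_def tendsto_norm_zero_iff)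
qed

lemma trajectory_uminus: "trajectory x v \<Longrightarrow> trajectory (\<lambda>t. - x t) (\<lambda>t. - v t)"
proof -
  assume tr: "trajectory x v"
  have G: "G (- y) = - G y" for y using G_eq[of y] G_eq[of "- y"] by simp
  show ?thesis
    unfolding trajectory_def
  proof (intro allI impI conjI)
    fix t :: real assume t: "0 \<le> t"
    show "((\<lambda>t. - x t) has_vector_derivative - v t) (at t within {0..})"
      by (rule has_vector_derivative_minus[OF trajectoryD(1)[OF tr t]])
    show "((\<lambda>t. - v t) has_vector_derivative - (\<phi> (- x t) *\<^sub>R - v t) - G (- x t)) (at t within {0..})"
      using has_vector_derivative_minus[OF trajectoryD(2)[OF tr t]] by (simp add: G \<phi>_even algebra_simps)
  qed
qed

lemma trajectory_zero: "trajectory (\<lambda>_. 0) (\<lambda>_. 0)"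
  using G_eq[of 0] by (simp add: trajectory_def)

text \<open>The bound by \<open>l\<^sub>0\<close> keeps the particle where w < 0, as the comparison
  in \<open>scalar_sinks_meet\<close> demands.\<close>

definition pos_sink :: "'a \<Rightarrow> (real \<Rightarrow> 'a) \<Rightarrow> (real \<Rightarrow> 'a) \<Rightarrow> bool" where
  "pos_sink b x v \<longleftrightarrow> sink x v \<and> (\<exists>T\<ge>0. \<forall>t\<ge>T. 0 < x t \<bullet> b \<and> x t \<bullet> b < l\<^sub>0 \<and> v t \<bullet> b < 0)"

lemma sink_eventually_small:
  assumes "sink x v"
  obtains T where "T \<ge> 0" "\<And>t. t \<ge> T \<Longrightarrow> norm (x t) < l\<^sub>0"
proof -
  have "\<forall>\<^sub>F t in at_top. norm (x t) < l\<^sub>0"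
    using order_tendstoD(2)[OF tendsto_norm[OF sinkD(2)[OF assms]]] l by simp
  then obtain N where "\<And>t. t \<ge> N \<Longrightarrow> norm (x t) < l\<^sub>0" unfolding eventually_at_top_linorder by blast
  then show ?thesis by (intro that[of "max N 0"]) auto
qed

lemma sink_energy_ge:
  assumes "sink x v" "t \<ge> 0"
  shows "U 0 \<le> energy (x t) (v t)"
proof (rule tendsto_upperbound)
  show "((\<lambda>t. energy (x t) (v t)) \<longlongrightarrow> U 0) at_top"
    using tendsto_energy[OF sinkD(2,3)[OF assms(1)]] by (simp add: energy_def)
  show "\<forall>\<^sub>F s in at_top. energy (x s) (v s) \<le> energy (x t) (v t)"
    using trajectory_energy_nonincreasing[OF sinkD(1)[OF assms(1)] assms(2)]
    by (intro eventually_at_top_linorderI[of t])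
qed simp

lemma one_dim_norm:
  assumes "DIM('a) = 1" "b \<in> Basis"
  shows "(y :: 'a) = (y \<bullet> b) *\<^sub>R b" "norm (y :: 'a) = \<bar>y \<bullet> b\<bar>"
proof -
  have B: "(Basis :: 'a set) = {b}"
    using assms by (metis card_1_singletonE singletonD)
  show y: "y = (y \<bullet> b) *\<^sub>R b"
    using euclidean_representation[of y] by (simp add: B)
  have "norm y = \<bar>y \<bullet> b\<bar> * norm b" by (subst y) (simp only: norm_scaleR)
  then show "norm y = \<bar>y \<bullet> b\<bar>" using assms(2) by simp
qed

text \<open>A sink has energy at least U 0, whereas U < U 0 for 0 < |x| <= \<open>l\<^sub>0\<close>.
  So near the end its velocity vanishes only at rest in the origin, and a sink found there was there
  from the start by backward uniqueness. Otherwise the velocity keeps its sign and the approach to 0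
  is monotone from one side.\<close>

lemma sink_one_dim_cases:
  assumes dim: "DIM('a) = 1" "b \<in> Basis" and sk: "sink x v"
  shows "(x 0 = 0 \<and> v 0 = 0) \<or> pos_sink b x v \<or> pos_sink b (\<lambda>t. - x t) (\<lambda>t. - v t)"
proof (cases "\<exists>t\<ge>0. x t = 0 \<and> v t = 0")
  case True
  then show ?thesis
    using trajectory_unique_backward[OF sinkD(1)[OF sk] trajectory_zero] by blast
next
  case False
  obtain T where T: "T \<ge> 0" "\<And>t. t \<ge> T \<Longrightarrow> norm (x t) < l\<^sub>0" by (rule sink_eventually_small[OF sk]) (rule that)
  note tr = sinkD(1)[OF sk]
  have vnz: "v t \<bullet> b \<noteq> 0" if t: "t \<ge> T" for t
  proof
    assume "v t \<bullet> b = 0"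
    then have v0: "v t = 0" using one_dim_norm(1)[OF dim, of "v t"] by simp
    then have "x t \<noteq> 0" using False t T(1) by auto
    then have "U (x t) < U 0" using u_max[of "norm (x t)"] T(2)[OF t] by (simp add: U_eq)
    then show False using sink_energy_ge[OF sk, of t] t T(1) v0 by (simp add: energy_def)
  qed
  have aux: "pos_sink b y z"
    if y: "sink y z" "\<And>t. t \<ge> T \<Longrightarrow> norm (y t) < l\<^sub>0" "\<And>t. t \<ge> T \<Longrightarrow> z t \<bullet> b \<noteq> 0" "z T \<bullet> b < 0" for y z
  proof -
    note ty = sinkD(1)[OF y(1)]
    have zc: "continuous_on {T..t} (\<lambda>t. z t \<bullet> b)" for t
      using T(1) by (intro continuous_intros continuous_on_subset[OF trajectory_continuous(2)[OF ty]]) auto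
    have zneg: "z t \<bullet> b < 0" if t: "t \<ge> T" for t
    proof (rule ccontr)
      assume "\<not> z t \<bullet> b < 0"
      then obtain s where "T \<le> s" "z s \<bullet> b = 0"
        using IVT'[of "\<lambda>t. z t \<bullet> b" T 0 t] y(4) t zc by auto
      then show False using y(3) by blast
    qed
    have dy: "((\<lambda>t. y t \<bullet> b) has_real_derivative z t \<bullet> b) (at t within {0..})" if "t \<ge> 0" for t
      using has_real_derivative_inner[OF trajectoryD(1)[OF ty that] has_vector_derivative_const[of b]] by simp
    have dec: "y t \<bullet> b \<le> y s \<bullet> b" if "T \<le> s" "s \<le> t" for s t
      by (rule nonincreasing_if_deriv_nonpos[OF dy]) (use that T(1) zneg in \<open>auto simp: less_imp_le\<close>)
    have y0: "((\<lambda>t. y t \<bullet> b) \<longlongrightarrow> 0) at_top"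
      using tendsto_inner[OF sinkD(2)[OF y(1)] tendsto_const[of b]] by simp
    have ypos: "y t \<bullet> b > 0" if t: "t \<ge> T" for t
    proof (rule ccontr)
      assume "\<not> y t \<bullet> b > 0"
      have le: "y s \<bullet> b \<le> 0" if "s \<ge> t" for s using dec[OF t that] \<open>\<not> y t \<bullet> b > 0\<close> by simp
      have ge: "y s \<bullet> b \<ge> 0" if "s \<ge> t" for s
      proof (rule tendsto_upperbound[OF y0])
        show "\<forall>\<^sub>F r in at_top. y r \<bullet> b \<le> y s \<bullet> b"
          using dec[of s] t that by (intro eventually_at_top_linorderI[of s]) auto
      qed simp
      have "((\<lambda>t. y t \<bullet> b) has_vector_derivative z t \<bullet> b) (at t within {t..t + 1})"
        unfolding has_real_derivative_iff_has_vector_derivative[symmetric]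
        by (rule DERIV_subset[OF dy]) (use t T(1) in auto)
      moreover have "((\<lambda>t. y t \<bullet> b) has_vector_derivative 0) (at t within {t..t + 1})"
        by (rule has_vector_derivative_transform[OF _ _ has_vector_derivative_const[of 0]])
          (use le ge in \<open>auto intro: antisym\<close>)
      ultimately have "z t \<bullet> b = 0"
        by (intro vector_derivative_unique_within_closed_interval[of t "t + 1" t "\<lambda>t. y t \<bullet> b"]) auto
      then show False using y(3)[OF t] by simp
    qed
    have "0 < y t \<bullet> b \<and> y t \<bullet> b < l\<^sub>0 \<and> z t \<bullet> b < 0" if "t \<ge> T" for t
      using ypos[OF that] zneg[OF that] y(2)[OF that] one_dim_norm(2)[OF dim, of "y t"] by simp
    then show ?thesis using y(1) T(1) unfolding pos_sink_def by blast
  qed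
  show ?thesis
  proof (cases "v T \<bullet> b < 0")
    case True
    then show ?thesis using aux[OF sk T(2) vnz] by simp
  next
    case False
    then have "- v T \<bullet> b < 0" using vnz[of T] by simp
    moreover have "sink (\<lambda>t. - x t) (\<lambda>t. - v t)"
      using sk trajectory_uminus tendsto_minus[OF sinkD(2)[OF sk]] tendsto_minus[OF sinkD(3)[OF sk]]
      by (simp add: sink_def)
    ultimately show ?thesis using aux[of "\<lambda>t. - x t" "\<lambda>t. - v t"] T(2) vnz by simp
  qed
qed

lemma pos_sinks_meet:
  assumes dim: "DIM('a) = 1" "b \<in> Basis" and ps: "pos_sink b x v" "pos_sink b y z"
  obtains s t where "s \<ge> 0" "t \<ge> 0" "x s = y t" "v s = z t"
proof -
  obtain T where T: "T \<ge> 0" "\<And>t. t \<ge> T \<Longrightarrow> 0 < x t \<bullet> b \<and> x t \<bullet> b < l\<^sub>0 \<and> v t \<bullet> b < 0"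
    using ps(1) by (auto simp: pos_sink_def)
  obtain T' where T': "T' \<ge> 0" "\<And>t. t \<ge> T' \<Longrightarrow> 0 < y t \<bullet> b \<and> y t \<bullet> b < l\<^sub>0 \<and> z t \<bullet> b < 0"
    using ps(2) by (auto simp: pos_sink_def)
  have d: "((\<lambda>t. X (t + S) \<bullet> b) has_real_derivative V (t + S) \<bullet> b) (at t within {0..})"
    "((\<lambda>t. V (t + S) \<bullet> b) has_real_derivative - \<phi> ((X (t + S) \<bullet> b) *\<^sub>R b) * (V (t + S) \<bullet> b) - w (X (t + S) \<bullet> b)) (at t within {0..})"
    if X: "trajectory X V" "S \<ge> 0" "\<And>t. t \<ge> S \<Longrightarrow> 0 < X t \<bullet> b \<and> X t \<bullet> b < l\<^sub>0 \<and> V t \<bullet> b < 0" "t \<ge> 0"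
    for X V :: "real \<Rightarrow> 'a" and S t
  proof -
    note D = trajectoryD[OF trajectory_shift[OF X(1,2)] X(4)]
    show "((\<lambda>t. X (t + S) \<bullet> b) has_real_derivative V (t + S) \<bullet> b) (at t within {0..})"
      using has_real_derivative_inner[OF D(1) has_vector_derivative_const[of b]] by simp
    have "0 < X (t + S) \<bullet> b" using X by simp
    then have "G (X (t + S)) \<bullet> b = w (X (t + S) \<bullet> b)"
      using G_eq[of "X (t + S)"] one_dim_norm(2)[OF dim, of "X (t + S)"] by simp
    then show "((\<lambda>t. V (t + S) \<bullet> b) has_real_derivative - \<phi> ((X (t + S) \<bullet> b) *\<^sub>R b) * (V (t + S) \<bullet> b) - w (X (t + S) \<bullet> b)) (at t within {0..})"
      using has_real_derivative_inner[OF D(2) has_vector_derivative_const[of b]]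
        one_dim_norm(1)[OF dim, of "X (t + S)"]
      by (simp add: inner_diff_left)
  qed
  have lim: "((\<lambda>t. X (t + S) \<bullet> b) \<longlongrightarrow> 0) at_top" if "(X \<longlongrightarrow> 0) at_top" for X :: "real \<Rightarrow> 'a" and S
  proof -
    have "filterlim (\<lambda>t::real. S + t) at_top at_top"
      by (rule filterlim_tendsto_add_at_top[OF tendsto_const filterlim_ident])
    then have "((\<lambda>t. X (t + S)) \<longlongrightarrow> 0) at_top"
      using filterlim_compose[OF that] by (simp add: add.commute)
    from tendsto_inner[OF this tendsto_const[of b]] show ?thesis by simp
  qed
  have sx: "sink x v" and sy: "sink y z" using ps by (auto simp: pos_sink_def)
  obtain t1 t2 where t: "t1 \<ge> 0" "t2 \<ge> 0" "x (t1 + T) \<bullet> b = y (t2 + T') \<bullet> b" "v (t1 + T) \<bullet> b = z (t2 + T') \<bullet> b"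
  proof (rule scalar_sinks_meet[OF d[OF sinkD(1)[OF sx] T] d[OF sinkD(1)[OF sy] T']])
    show "w r \<le> 0" if "0 < r" "r < x (0 + T) \<bullet> b" for r
      using w_neg[of r] T(2)[of T] that by simp
  qed (use T T' lim sinkD[OF sx] sinkD[OF sy] that in auto)
  then show ?thesis
    using T(1) T'(1) one_dim_norm(1)[OF dim] by (intro that[of "t1 + T" "t2 + T'"]) (simp, simp, metis+)
qed

definition orbit :: "(real \<Rightarrow> 'a) \<times> (real \<Rightarrow> 'a) \<Rightarrow> ('a \<times> 'a) set" where
  "orbit p = (\<lambda>t. (fst p t, snd p t)) ` {0..}"

text \<open>By backward uniqueness, the trajectory that takes longer to reach the common state has
  passed through the datum of the other.\<close>

lemma orbit_if_meet_later:
  assumes "trajectory x v" "trajectory y z" "0 \<le> s" "s \<le> t" "x s = y t" "v s = z t"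
  shows "(x 0, v 0) \<in> orbit (y, z)"
proof -
  have "x 0 = y (0 + (t - s))" "v 0 = z (0 + (t - s))"
    by (rule trajectory_unique_backward[OF assms(1) trajectory_shift[OF assms(2)], of "t - s" s]; use assms in simp)+
  then show ?thesis using assms by (auto simp: orbit_def intro!: image_eqI[of _ _ "t - s"])
qed

text \<open>Of two positive sinks one passes through the datum of the other. Countably many of them, passing
  through the datum of a fixed one at cofinal times, therefore cover all.\<close>

lemma pos_sinks_countable_orbits:
  assumes dim: "DIM('a) = 1" "b \<in> Basis"
  obtains D where "countable D" "\<And>y z. (y, z) \<in> D \<Longrightarrow> trajectory y z"
    "\<And>x v. pos_sink b x v \<Longrightarrow> \<exists>p\<in>D. (x 0, v 0) \<in> orbit p"
proof (cases "\<exists>x v. pos_sink b x v")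
  case False
  then show ?thesis by (intro that[of "{}"]) auto
next
  case True
  then obtain x\<^sub>r v\<^sub>r where ref: "pos_sink b x\<^sub>r v\<^sub>r" by blast
  have tr: "trajectory x v" if "pos_sink b x v" for x v using that by (simp add: pos_sink_def sink_def)
  define passes where "passes p t \<longleftrightarrow> pos_sink b (fst p) (snd p) \<and> fst p t = x\<^sub>r 0 \<and> snd p t = v\<^sub>r 0" for p t
  define A where "A = {t. t \<ge> 0 \<and> (\<exists>p. passes p t)}"
  obtain E where E: "countable E" "E \<subseteq> A" "\<And>a. a \<in> A \<Longrightarrow> \<exists>d\<in>E. a \<le> d"
    by (rule countable_cofinal_real[of A]) (rule that)
  define pick where "pick t = (SOME p. passes p t)" for t
  have pick: "passes (pick t) t" if "t \<in> E" for t
    unfolding pick_def by (rule someI_ex) (use that E(2) in \<open>auto simp: A_def\<close>)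
  show ?thesis
  proof (rule that[of "insert (x\<^sub>r, v\<^sub>r) (pick ` E)"])
    show "countable (insert (x\<^sub>r, v\<^sub>r) (pick ` E))" using E(1) by simp
    show "trajectory y z" if "(y, z) \<in> insert (x\<^sub>r, v\<^sub>r) (pick ` E)" for y z
      using that ref pick by (auto simp: passes_def dest!: tr) (metis fst_conv snd_conv tr)
    show "\<exists>p\<in>insert (x\<^sub>r, v\<^sub>r) (pick ` E). (x 0, v 0) \<in> orbit p" if xv: "pos_sink b x v" for x v
    proof -
      obtain s t where st: "s \<ge> 0" "t \<ge> 0" "x s = x\<^sub>r t" "v s = v\<^sub>r t"
        by (rule pos_sinks_meet[OF dim xv ref]) (rule that)
      show ?thesis
      proof (cases "s \<le> t")
        case True
        then have "(x 0, v 0) \<in> orbit (x\<^sub>r, v\<^sub>r)"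
          by (intro orbit_if_meet_later[OF tr[OF xv] tr[OF ref] st(1) _ st(3,4)])
        then show ?thesis by blast
      next
        case False
        have "x\<^sub>r 0 = x (0 + (s - t))" "v\<^sub>r 0 = v (0 + (s - t))"
          by (rule trajectory_unique_backward[OF tr[OF ref] trajectory_shift[OF tr[OF xv]], of "s - t" t];
              use False st in simp)+
        then have "passes (x, v) (s - t)" using xv by (simp add: passes_def)
        then have "s - t \<in> A" using False by (auto simp: A_def)
        \<comment> \<open>\<open>pick d\<close> takes at least as long as x to reach the reference
          datum, so it has passed through the datum of x.\<close>
        then obtain d where d: "d \<in> E" "s - t \<le> d" using E(3) by blast
        have "passes (pick d) d" by (rule pick[OF d(1)])
        then have "(x 0, v 0) \<in> orbit (fst (pick d), snd (pick d))"
          using \<open>passes (x, v) (s - t)\<close> d(2) False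
          by (intro orbit_if_meet_later[of x v _ _ "s - t" d]) (auto simp: passes_def tr)
        then show ?thesis using d(1) by auto
      qed
    qed
  qed
qed

lemma sinks_countable_orbits:
  assumes dim: "DIM('a) = 1"
  obtains D where "countable D" "\<And>y z. (y, z) \<in> D \<Longrightarrow> trajectory y z"
    "\<And>x v. sink x v \<Longrightarrow> \<exists>p\<in>D. (x 0, v 0) \<in> orbit p"
proof -
  obtain b :: 'a where b: "b \<in> Basis" using nonempty_Basis by blast
  obtain D where D: "countable D" "\<And>y z. (y, z) \<in> D \<Longrightarrow> trajectory y z"
    "\<And>x v. pos_sink b x v \<Longrightarrow> \<exists>p\<in>D. (x 0, v 0) \<in> orbit p"
    by (rule pos_sinks_countable_orbits[OF dim b]) (rule that)
  define m where "m p = ((\<lambda>t. - fst p t), (\<lambda>t. - snd p t))" for p :: "(real \<Rightarrow> 'a) \<times> (real \<Rightarrow> 'a)"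
  show ?thesis
  proof (rule that[of "insert ((\<lambda>_. 0), (\<lambda>_. 0)) (D \<union> m ` D)"])
    show "countable (insert ((\<lambda>_. 0), (\<lambda>_. 0)) (D \<union> m ` D))" using D(1) by simp
    show "trajectory y z" if "(y, z) \<in> insert ((\<lambda>_. 0), (\<lambda>_. 0)) (D \<union> m ` D)" for y z
      using that trajectory_zero D(2) trajectory_uminus by (auto simp: m_def)
    show "\<exists>p\<in>insert ((\<lambda>_. 0), (\<lambda>_. 0)) (D \<union> m ` D). (x 0, v 0) \<in> orbit p" if xv: "sink x v" for x v
      using sink_one_dim_cases[OF dim b xv]
    proof (elim disjE)
      assume "x 0 = 0 \<and> v 0 = 0"
      then have "(x 0, v 0) \<in> orbit ((\<lambda>_. 0), (\<lambda>_. 0))" by (auto simp: orbit_def)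
      then show ?thesis by blast
    next
      assume "pos_sink b x v"
      then show ?thesis using D(3) by blast
    next
      assume "pos_sink b (\<lambda>t. - x t) (\<lambda>t. - v t)"
      then obtain p where p: "p \<in> D" "(- x 0, - v 0) \<in> orbit p" using D(3) by blast
      have "(x 0, v 0) \<in> orbit (m p)"
      proof -
        obtain t where t: "t \<ge> 0" "- x 0 = fst p t" "- v 0 = snd p t" using p(2) by (auto simp: orbit_def)
        show ?thesis
          unfolding orbit_def by (rule image_eqI[of _ _ t]) (use t(1) in \<open>simp_all add: m_def flip: t(2,3)\<close>)
      qed
      then show ?thesis using p(1) by blast
    qed
  qed
qed

end

section \<open>The decay rate\<close>

context damped_well
begin

text \<open>On |x| <= \<open>l\<^sub>0 / 2\<close> the potential is at least
  \<open>(l\<^sub>0 / 2)\<^sup>2\<close>, so this region is out of reach; outside it U is the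
  squared distance of |x| to the well. The constant 3 is 1 for that distance plus 2, a bound for the
  root of 2, for the velocity.\<close>

lemma flocking_bound_energy:
  assumes "energy x v < (l\<^sub>0 / 2)\<^sup>2"
  shows "infdist (norm x) {l\<^sub>0..l\<^sub>1} + norm v \<le> 3 * sqrt (energy x v)" "l\<^sub>0 / 2 < norm x"
    and "U x = (min (norm x - l\<^sub>0) 0 + max (norm x - l\<^sub>1) 0)\<^sup>2"
proof -
  have U: "U x \<le> energy x v" by (rule norm_le_energy(3)[OF order_refl])
  show r: "l\<^sub>0 / 2 < norm x"
  proof (rule ccontr)
    assume "\<not> l\<^sub>0 / 2 < norm x"
    then have "(l\<^sub>0 / 2)\<^sup>2 \<le> U x" using u_inner[of "norm x"] by (simp add: U_eq)
    then show False using U assms by linarith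
  qed
  define \<rho> where "\<rho> = min (norm x - l\<^sub>0) 0 + max (norm x - l\<^sub>1) 0"
  have "min (norm x - l\<^sub>0) 0 = 0 \<or> max (norm x - l\<^sub>1) 0 = 0" using l by (auto simp: min_def max_def)
  then show Ux: "U x = (min (norm x - l\<^sub>0) 0 + max (norm x - l\<^sub>1) 0)\<^sup>2"
    using u_outer[of "norm x"] r by (auto simp: U_eq)
  have "infdist (norm x) {l\<^sub>0..l\<^sub>1} \<le> dist (norm x) (max l\<^sub>0 (min (norm x) l\<^sub>1))"
    by (rule infdist_le) (use l in auto)
  also have "\<dots> = \<bar>\<rho>\<bar>"
    using l by (auto simp: \<rho>_def dist_real_def min_def max_def)
  also have "\<dots> = sqrt (U x)" by (simp add: Ux \<rho>_def)
  also have "\<dots> \<le> sqrt (energy x v)" using U by simp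
  finally have 1: "infdist (norm x) {l\<^sub>0..l\<^sub>1} \<le> sqrt (energy x v)" .
  have "norm v \<le> sqrt (2 * energy x v)" by (rule norm_le_energy(1)[OF order_refl])
  also have "\<dots> \<le> sqrt (2\<^sup>2 * energy x v)" using energy_nonneg[of x v] by (intro real_sqrt_le_mono) simp
  also have "\<dots> = 2 * sqrt (energy x v)" by (simp add: real_sqrt_mult)
  finally show "infdist (norm x) {l\<^sub>0..l\<^sub>1} + norm v \<le> 3 * sqrt (energy x v)" using 1 by simp
qed

text \<open>Controls the initial time span, before the decay estimate sets in.\<close>

lemma flocking_bounded:
  assumes "trajectory x v"
  obtains M where "M > 0" "\<And>t. t \<ge> 0 \<Longrightarrow> infdist (norm (x t)) {l\<^sub>0..l\<^sub>1} + norm (v t) \<le> M"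
proof (rule that)
  define M where "M = l\<^sub>0 + (l\<^sub>1 + sqrt (energy (x 0) (v 0))) + sqrt (2 * energy (x 0) (v 0))"
  show "M > 0" using l energy_nonneg[of "x 0" "v 0"] by (simp add: M_def add_pos_nonneg)
  fix t :: real assume t: "t \<ge> 0"
  have "infdist (norm (x t)) {l\<^sub>0..l\<^sub>1} \<le> dist (norm (x t)) l\<^sub>0"
    by (rule infdist_le) (use l in auto)
  also have "\<dots> \<le> l\<^sub>0 + norm (x t)" 
    unfolding dist_real_def using l norm_ge_zero[of "x t"] by linarith
  finally show "infdist (norm (x t)) {l\<^sub>0..l\<^sub>1} + norm (v t) \<le> M"
    using trajectory_bounds[OF assms t] by (simp add: M_def)
qed

lemma flocking_tendsto:
  assumes "trajectory x v" "((\<lambda>t. energy (x t) (v t)) \<longlongrightarrow> 0) at_top"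
  shows "((\<lambda>t. infdist (norm (x t)) {l\<^sub>0..l\<^sub>1} + norm (v t)) \<longlongrightarrow> 0) at_top"
proof (rule tendsto_sandwich[where f = "\<lambda>_. 0" and h = "\<lambda>t. 3 * sqrt (energy (x t) (v t))"])
  have "0 < (l\<^sub>0 / 2)\<^sup>2" using l by simp
  then have "\<forall>\<^sub>F t in at_top. energy (x t) (v t) < (l\<^sub>0 / 2)\<^sup>2" by (rule order_tendstoD(2)[OF assms(2)])
  then show "\<forall>\<^sub>F t in at_top. infdist (norm (x t)) {l\<^sub>0..l\<^sub>1} + norm (v t) \<le> 3 * sqrt (energy (x t) (v t))"
    by eventually_elim (rule flocking_bound_energy(1))
  have "((\<lambda>t. 3 * sqrt (energy (x t) (v t))) \<longlongrightarrow> 3 * sqrt 0) at_top" by (intro tendsto_intros assms)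
  then show "((\<lambda>t. 3 * sqrt (energy (x t) (v t))) \<longlongrightarrow> 0) at_top" by simp
  show "\<forall>\<^sub>F t in at_top. 0 \<le> infdist (norm (x t)) {l\<^sub>0..l\<^sub>1} + norm (v t)"
    by (intro always_eventually allI add_nonneg_nonneg infdist_nonneg norm_ge_zero)
qed (rule tendsto_const)

lemma norm_derivative:
  assumes "trajectory x v" "t \<ge> 0" "x t \<noteq> 0"
  shows "((\<lambda>t. norm (x t)) has_real_derivative (x t \<bullet> v t) / norm (x t)) (at t within {0..})"
proof -
  have pos: "x t \<bullet> x t > 0" using assms(3) by simp
  have "((\<lambda>t. sqrt (x t \<bullet> x t)) has_real_derivative (inverse (sqrt (x t \<bullet> x t)) / 2) * (2 * (x t \<bullet> v t))) (at t within {0..})"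
    by (rule DERIV_chain2[OF DERIV_real_sqrt[OF pos] trajectory_inner_derivatives(1)[OF assms(1,2)]])
  moreover have "inverse s / 2 * (2 * y) = y / s" for s y :: real by (simp add: field_simps)
  ultimately show ?thesis by (simp only: norm_eq_sqrt_inner)
qed

text \<open>For a <= b one of the summands is always 0, so the cube splits into (r - a) and (r - b)
  times squares with known derivatives.\<close>

lemma cubic_defect_derivative:
  fixes r a b :: real
  assumes "a \<le> b"
  shows "((\<lambda>r. (min (r - a) 0 + max (r - b) 0) ^ 3) has_real_derivative 3 * (min (r - a) 0 + max (r - b) 0)\<^sup>2) (at r)"
proof -
  have z: "min (r - a) 0 = 0 \<or> max (r - b) 0 = 0" for r using assms by (auto simp: min_def max_def)
  have m: "(r - a) * (min (r - a) 0)\<^sup>2 = (min (r - a) 0) ^ 3" "(r - b) * (max (r - b) 0)\<^sup>2 = (max (r - b) 0) ^ 3" for r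
    by (auto simp: min_def max_def power2_eq_square power3_eq_cube)
  have e: "(\<lambda>r. (min (r - a) 0 + max (r - b) 0) ^ 3) = (\<lambda>r. (r - a) * (min (r - a) 0)\<^sup>2 + (r - b) * (max (r - b) 0)\<^sup>2)"
    unfolding m using z by (intro ext) (metis add.left_neutral add.right_neutral power_zero_numeral)
  have "((\<lambda>r. (r - a) * (min (r - a) 0)\<^sup>2 + (r - b) * (max (r - b) 0)\<^sup>2) has_real_derivative
      (1 * (min (r - a) 0)\<^sup>2 + 2 * min (r - a) 0 * (r - a)) + (1 * (max (r - b) 0)\<^sup>2 + 2 * max (r - b) 0 * (r - b))) (at r)"
    by (intro DERIV_add DERIV_mult min_squared_derivative max_squared_derivative) (auto intro!: derivative_eq_intros)
  moreover have "(1 * (min (r - a) 0)\<^sup>2 + 2 * min (r - a) 0 * (r - a)) + (1 * (max (r - b) 0)\<^sup>2 + 2 * max (r - b) 0 * (r - b))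
      = 3 * (min (r - a) 0 + max (r - b) 0)\<^sup>2"
    using assms by (auto simp: min_def max_def power2_eq_square)
  ultimately show ?thesis unfolding e by simp
qed

text \<open>The cross term \<open>\<rho>\<^sup>3 (x \<bullet> v)\<close>, with \<open>\<rho>\<close> the signed distance of \<open>|x|\<close> to \<open>[l\<^sub>0, l\<^sub>1]\<close>, supplies the
  dissipation \<open>\<rho>\<^sup>4\<close> that the energy lacks; the cube makes it differentiable at the edges of the well.\<close>

lemma energy_rate:
  assumes tr: "trajectory x v" and lim: "((\<lambda>t. energy (x t) (v t)) \<longlongrightarrow> 0) at_top" and r01: "l\<^sub>1 < r\<^sub>0"
  obtains T \<delta> where "T \<ge> 0" "\<delta> > 0"
    "\<And>t. t \<ge> T \<Longrightarrow> energy (x t) (v t) * (\<delta> * (t - T)) \<le> 2"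
    "\<And>t. t \<ge> T \<Longrightarrow> energy (x t) (v t) < (l\<^sub>0 / 2)\<^sup>2"
proof -
  define E where "E t = energy (x t) (v t)" for t
  define y where "y t = v t \<bullet> v t" for t
  define \<rho> where "\<rho> t = min (norm (x t) - l\<^sub>0) 0 + max (norm (x t) - l\<^sub>1) 0" for t
  define q where "q t = x t \<bullet> v t" for t
  \<comment> \<open>While the energy is below \<eta>^2, the radius stays between
    \<open>l\<^sub>0 / 2\<close> and R = \<open>l\<^sub>1 + \<eta>\<close> <
    \<open>r\<^sub>0\<close>. There the drag is bounded below; this is where
    \<open>l\<^sub>1 < r\<^sub>0\<close> enters.\<close>
  define \<eta> where "\<eta> = min (l\<^sub>0 / 2) ((r\<^sub>0 - l\<^sub>1) / 2)"
  have \<eta>: "\<eta> > 0" "\<eta> \<le> l\<^sub>0 / 2" "l\<^sub>1 + \<eta> < r\<^sub>0" using l r01 by (auto simp: \<eta>_def min_def field_simps)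
  define R where "R = l\<^sub>1 + \<eta>"
  have R: "R > 0" "R < r\<^sub>0" using \<eta> l by (auto simp: R_def)
  have "0 < \<eta>\<^sup>2" using \<eta> by simp
  then have "\<forall>\<^sub>F t in at_top. E t < \<eta>\<^sup>2"
    unfolding E_def by (rule order_tendstoD(2)[OF lim])
  then obtain N where N: "\<And>t. t \<ge> N \<Longrightarrow> E t < \<eta>\<^sup>2" unfolding eventually_at_top_linorder by blast
  define T where "T = max N 0"
  have T: "T \<ge> 0" and ET: "\<And>t. t \<ge> T \<Longrightarrow> E t < \<eta>\<^sup>2" using N by (auto simp: T_def)
  have \<eta>2: "\<eta>\<^sup>2 \<le> (l\<^sub>0 / 2)\<^sup>2" using \<eta> by (intro power_mono) auto
  have E: "energy (x t) (v t) < (l\<^sub>0 / 2)\<^sup>2" if "t \<ge> T" for t using ET[OF that] \<eta>2 by (simp add: E_def)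
  have r: "l\<^sub>0 / 2 < norm (x t)" "x t \<noteq> 0" if "t \<ge> T" for t
    using flocking_bound_energy(2)[OF E[OF that]] l by auto
  have Eeq: "E t = y t / 2 + (\<rho> t)\<^sup>2" if "t \<ge> T" for t
    using flocking_bound_energy(3)[OF E[OF that]] by (simp add: E_def energy_def y_def \<rho>_def)
  have y0: "y t \<ge> 0" for t by (simp add: y_def)
  have \<rho>\<eta>: "\<bar>\<rho> t\<bar> \<le> \<eta>" "(\<rho> t)\<^sup>2 \<le> \<eta>\<^sup>2" if "t \<ge> T" for t
  proof -
    show "(\<rho> t)\<^sup>2 \<le> \<eta>\<^sup>2" using Eeq[OF that] ET[OF that] y0[of t] by simp
    then show "\<bar>\<rho> t\<bar> \<le> \<eta>" using \<eta>(1) abs_le_square_iff[of "\<rho> t" \<eta>] by simp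
  qed
  have rR: "norm (x t) \<le> R" if "t \<ge> T" for t
    using \<rho>\<eta>(1)[OF that] l \<eta>(1) by (auto simp: \<rho>_def R_def min_def max_def split: if_splits)
  obtain c where c: "c > 0" "\<And>z. norm z \<le> R \<Longrightarrow> c \<le> \<phi> z"
  proof -
    have "\<exists>z\<in>cball 0 R. \<forall>z'\<in>cball 0 R. \<phi> z \<le> \<phi> z'"
      by (rule continuous_attains_inf) (use R continuous_\<phi> in auto)
    then obtain z where "norm z \<le> R" "\<And>z'. norm z' \<le> R \<Longrightarrow> \<phi> z \<le> \<phi> z'" by auto
    then show ?thesis using that[of "\<phi> z"] \<phi>_pos[of z] R by auto
  qed
  have qb: "(q t)\<^sup>2 \<le> R * norm (x t) * y t" "\<bar>q t\<bar> \<le> R * norm (v t)" if "t \<ge> T" for t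
  proof -
    have "(q t)\<^sup>2 \<le> (norm (x t) * norm (x t)) * y t"
      using Cauchy_Schwarz_ineq[of "x t" "v t"] by (simp add: q_def y_def power2_norm_eq_inner flip: power2_eq_square)
    also have "\<dots> \<le> (R * norm (x t)) * y t"
      using rR[OF that] y0 by (intro mult_right_mono) auto
    finally show "(q t)\<^sup>2 \<le> R * norm (x t) * y t" .
    have "\<bar>q t\<bar> \<le> norm (x t) * norm (v t)" unfolding q_def by (rule Cauchy_Schwarz_ineq2)
    also have "\<dots> \<le> R * norm (v t)" using rR[OF that] by (intro mult_right_mono) auto
    finally show "\<bar>q t\<bar> \<le> R * norm (v t)" .
  qed
  define F where "F t = (\<rho> t) ^ 3 * q t" for t
  define F' where "F' t = (3 * (\<rho> t)\<^sup>2 * (q t / norm (x t))) * q t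
    + (y t - \<phi> (x t) * q t - 2 * \<rho> t * norm (x t)) * (\<rho> t) ^ 3" for t
  have dF: "(F has_real_derivative F' t) (at t within {0..})" if t: "t \<ge> T" for t
  proof -
    have t0: "t \<ge> 0" using t T by simp
    have "((\<lambda>t. (\<rho> t) ^ 3) has_real_derivative 3 * (\<rho> t)\<^sup>2 * (q t / norm (x t))) (at t within {0..})"
      using DERIV_chain2[OF cubic_defect_derivative[OF l(2)] norm_derivative[OF tr t0 r(2)[OF t]]]
      by (simp add: \<rho>_def q_def)
    moreover have "(q has_real_derivative y t - \<phi> (x t) * q t - 2 * \<rho> t * norm (x t)) (at t within {0..})"
      using trajectory_inner_derivatives(2)[OF tr t0] w_outer[of "norm (x t)"] r(1)[OF t]
      by (simp add: q_def[abs_def] y_def inner_self_G \<rho>_def distrib_left)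
    ultimately show ?thesis
      unfolding F_def[abs_def] F'_def by (rule DERIV_mult)
  qed
  \<comment> \<open>One summand for each term of F' that the drag must absorb: from the derivative
    of \<rho>^3, from |v|^2, and from the drag part of q'.\<close>
  define C1 where "C1 = 3 * \<eta>\<^sup>2 * R + \<eta> ^ 3 + (B * R)\<^sup>2 * \<eta>\<^sup>2 / (2 * l\<^sub>0)"
  have C1: "C1 > 0"
  proof -
    have "3 * \<eta>\<^sup>2 * R > 0" "\<eta> ^ 3 > 0" using \<eta>(1) R(1) by simp_all
    moreover have "(B * R)\<^sup>2 * \<eta>\<^sup>2 / (2 * l\<^sub>0) \<ge> 0" using l(1) by simp
    ultimately show ?thesis unfolding C1_def by linarith
  qed
  have F'b: "F' t \<le> C1 * y t - l\<^sub>0 / 2 * (\<rho> t) ^ 4" if t: "t \<ge> T" for t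
  proof -
    have rp: "norm (x t) > 0" using r[OF t] by simp
    have "3 * (\<rho> t)\<^sup>2 * ((q t)\<^sup>2 / norm (x t)) \<le> 3 * \<eta>\<^sup>2 * (R * y t)"
    proof (intro mult_mono)
      show "(q t)\<^sup>2 / norm (x t) \<le> R * y t" using qb(1)[OF t] rp by (simp add: field_simps)
    qed (use \<rho>\<eta>(2)[OF t] rp in auto)
    then have 1: "(3 * (\<rho> t)\<^sup>2 * (q t / norm (x t))) * q t \<le> 3 * \<eta>\<^sup>2 * R * y t"
      by (simp add: power2_eq_square mult_ac)
    have "(\<rho> t) ^ 3 \<le> \<bar>\<rho> t\<bar> ^ 3" by (metis abs_ge_self power_abs)
    also have "\<dots> \<le> \<eta> ^ 3" using \<rho>\<eta>(1)[OF t] by (intro power_mono) auto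
    finally have 2: "y t * (\<rho> t) ^ 3 \<le> \<eta> ^ 3 * y t" using y0[of t] by (simp add: mult.commute mult_left_mono)
    have 3: "- (\<phi> (x t) * q t) * (\<rho> t) ^ 3 \<le> l\<^sub>0 / 2 * (\<rho> t) ^ 4 + (B * R)\<^sup>2 * \<eta>\<^sup>2 / (2 * l\<^sub>0) * y t"
    proof -
      \<comment> \<open>Young's inequality: the term is s \<rho>^2, and half of the gain
        \<open>l\<^sub>0\<close> \<rho>^4 pays for it.\<close>
      define s where "s = - (\<phi> (x t) * q t) * \<rho> t"
      have "\<bar>\<phi> (x t) * q t\<bar> \<le> B * (R * norm (v t))"
        unfolding abs_mult using \<phi>_bounds[of "x t"] qb(2)[OF t] constants_nonneg
        by (intro mult_mono) auto
      then have "\<bar>\<phi> (x t) * q t\<bar> * \<bar>\<rho> t\<bar> \<le> B * (R * norm (v t)) * \<eta>"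
        by (rule mult_mono[OF _ \<rho>\<eta>(1)[OF t]]) (use constants_nonneg R(1) in auto)
      then have "\<bar>s\<bar> \<le> B * (R * norm (v t)) * \<eta>" by (simp add: s_def abs_mult)
      then have "s\<^sup>2 \<le> (B * (R * norm (v t)) * \<eta>)\<^sup>2" by (rule abs_le_square_iff[THEN iffD1, OF order_trans[OF _ abs_ge_self]])
      also have "\<dots> = (B * R)\<^sup>2 * \<eta>\<^sup>2 * y t" by (simp add: power_mult_distrib y_def power2_norm_eq_inner)
      finally have s2: "s\<^sup>2 \<le> (B * R)\<^sup>2 * \<eta>\<^sup>2 * y t" .
      have "0 \<le> (l\<^sub>0 * (\<rho> t)\<^sup>2 - s)\<^sup>2 / (2 * l\<^sub>0)" using l by simp
      also have "\<dots> = l\<^sub>0 / 2 * (\<rho> t) ^ 4 + s\<^sup>2 / (2 * l\<^sub>0) - s * (\<rho> t)\<^sup>2"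
        using l by (simp add: power2_eq_square power4_eq_xxxx field_simps)
      finally have "s * (\<rho> t)\<^sup>2 \<le> l\<^sub>0 / 2 * (\<rho> t) ^ 4 + s\<^sup>2 / (2 * l\<^sub>0)" by simp
      moreover have "s\<^sup>2 / (2 * l\<^sub>0) \<le> (B * R)\<^sup>2 * \<eta>\<^sup>2 / (2 * l\<^sub>0) * y t"
        using s2 l by (simp add: divide_right_mono)
      moreover have "s * (\<rho> t)\<^sup>2 = - (\<phi> (x t) * q t) * (\<rho> t) ^ 3"
        by (simp add: s_def power2_eq_square power3_eq_cube)
      ultimately show ?thesis by linarith
    qed
    have 4: "2 * \<rho> t * norm (x t) * (\<rho> t) ^ 3 \<ge> l\<^sub>0 * (\<rho> t) ^ 4"
    proof -
      have "l\<^sub>0 * (\<rho> t) ^ 4 \<le> (2 * norm (x t)) * (\<rho> t) ^ 4"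
        using r(1)[OF t] by (intro mult_right_mono) auto
      also have "\<dots> = 2 * \<rho> t * norm (x t) * (\<rho> t) ^ 3" by (simp add: power3_eq_cube power4_eq_xxxx)
      finally show ?thesis .
    qed
    have "F' t = (3 * (\<rho> t)\<^sup>2 * (q t / norm (x t))) * q t + y t * (\<rho> t) ^ 3
        + - (\<phi> (x t) * q t) * (\<rho> t) ^ 3 - 2 * \<rho> t * norm (x t) * (\<rho> t) ^ 3"
      by (simp add: F'_def left_diff_distrib)
    also have "\<dots> \<le> 3 * \<eta>\<^sup>2 * R * y t + \<eta> ^ 3 * y t
        + (l\<^sub>0 / 2 * (\<rho> t) ^ 4 + (B * R)\<^sup>2 * \<eta>\<^sup>2 / (2 * l\<^sub>0) * y t) - l\<^sub>0 * (\<rho> t) ^ 4"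
      by (intro diff_mono add_mono 1 2 3 4)
    also have "\<dots> = C1 * y t - l\<^sub>0 / 2 * (\<rho> t) ^ 4" by (simp add: C1_def algebra_simps)
    finally show ?thesis .
  qed
  have Fb: "\<bar>F t\<bar> \<le> \<eta>\<^sup>2 * R * E t" if t: "t \<ge> T" for t
  proof -
    have "\<bar>F t\<bar> = (\<rho> t)\<^sup>2 * (\<bar>\<rho> t\<bar> * \<bar>q t\<bar>)"
      by (simp add: F_def abs_mult power_abs power2_eq_square power3_eq_cube)
    also have "\<dots> \<le> \<eta>\<^sup>2 * (\<bar>\<rho> t\<bar> * (R * norm (v t)))"
      using \<rho>\<eta>(2)[OF t] qb(2)[OF t] by (intro mult_mono) auto
    also have "\<dots> = \<eta>\<^sup>2 * R * (\<bar>\<rho> t\<bar> * norm (v t))" by simp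
    also have "\<dots> \<le> \<eta>\<^sup>2 * R * E t"
    proof (intro mult_left_mono)
      have "2 * \<bar>\<rho> t\<bar> * norm (v t) \<le> (\<rho> t)\<^sup>2 + y t"
        using sum_squares_bound[of "\<bar>\<rho> t\<bar>" "norm (v t)"] by (simp add: y_def power2_norm_eq_inner)
      then show "\<bar>\<rho> t\<bar> * norm (v t) \<le> E t" using Eeq[OF t] zero_le_power2[of "\<rho> t"] by linarith
    qed (use R in auto)
    finally show ?thesis .
  qed
  \<comment> \<open>The first bound leaves half of the dissipation c |v|^2, the second makes W
    comparable with E.\<close>
  define \<epsilon> where "\<epsilon> = min (c / (2 * C1)) (1 / (2 * (\<eta>\<^sup>2 * R)))"
  have \<epsilon>: "\<epsilon> > 0" "\<epsilon> * C1 \<le> c / 2" "\<epsilon> * (\<eta>\<^sup>2 * R) \<le> 1 / 2"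
  proof -
    have p: "\<eta>\<^sup>2 * R > 0" using \<eta> R by simp
    show "\<epsilon> > 0" using c C1 p by (simp add: \<epsilon>_def)
    have "\<epsilon> * C1 \<le> c / (2 * C1) * C1" using C1 by (intro mult_right_mono) (auto simp: \<epsilon>_def)
    then show "\<epsilon> * C1 \<le> c / 2" using C1 by simp
    have "\<epsilon> * (\<eta>\<^sup>2 * R) \<le> 1 / (2 * (\<eta>\<^sup>2 * R)) * (\<eta>\<^sup>2 * R)" using p by (intro mult_right_mono) (auto simp: \<epsilon>_def)
    also have "\<dots> = 1 / 2" using \<eta>(1) R(1) by simp
    finally show "\<epsilon> * (\<eta>\<^sup>2 * R) \<le> 1 / 2" .
  qed
  define W where "W t = E t + \<epsilon> * F t" for t
  define W' where "W' t = - (\<phi> (x t) * y t) + \<epsilon> * F' t" for t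
  \<comment> \<open>Within {T..}, since the formula for F' presupposes the small energy reached at T
    and \<open>riccati_decay\<close> starts there.\<close>
  have dW: "(W has_real_derivative W' t) (at t within {T..})" if t: "t \<ge> T" for t
  proof -
    have "(W has_real_derivative W' t) (at t within {0..})"
      unfolding W_def[abs_def] W'_def E_def y_def
      by (intro DERIV_add DERIV_cmult trajectory_energy_derivative tr dF t) (use t T in simp)
    then show ?thesis by (rule DERIV_subset) (use T in auto)
  qed
  have EW: "E t \<le> 2 * W t" "W t \<le> 3 / 2 * E t" "W t \<ge> 0" if t: "t \<ge> T" for t
  proof -
    have E0: "E t \<ge> 0" using energy_nonneg by (simp add: E_def)
    have "\<bar>\<epsilon> * F t\<bar> \<le> \<epsilon> * (\<eta>\<^sup>2 * R * E t)" using Fb[OF t] \<epsilon>(1) by (simp add: abs_mult)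
    also have "\<dots> = (\<epsilon> * (\<eta>\<^sup>2 * R)) * E t" by simp
    also have "\<dots> \<le> 1 / 2 * E t" by (rule mult_right_mono[OF \<epsilon>(3) E0])
    finally have b: "\<bar>\<epsilon> * F t\<bar> \<le> 1 / 2 * E t" .
    define h where "h = \<epsilon> * F t"
    have b': "h \<le> 1 / 2 * E t" "- h \<le> 1 / 2 * E t" using abs_le_D1[OF b] abs_le_D2[OF b] by (simp_all add: h_def)
    have "E t / 2 \<le> W t" using b' E0 unfolding W_def h_def[symmetric] by linarith
    then show "E t \<le> 2 * W t" by simp
    show "W t \<le> 3 / 2 * E t" using b' E0 unfolding W_def h_def[symmetric] by linarith
    show "W t \<ge> 0" using b' E0 unfolding W_def h_def[symmetric] by linarith
  qed
  \<comment> \<open>Matched to the bound of W^2 by 9/4 \<eta>^2 |v|^2 + 9/2 \<rho>^4: the first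
    entry keeps the velocity part of \<delta> W^2 below c/4 |v|^2, the second keeps the rest below
    \<epsilon> \<open>l\<^sub>0\<close> / 4 times \<rho>^4.\<close>
  define \<delta> where "\<delta> = min (c / (9 * \<eta>\<^sup>2)) (\<epsilon> * l\<^sub>0 / 18)"
  have \<delta>: "\<delta> > 0" using c \<eta> \<epsilon> l by (simp add: \<delta>_def)
  have W'b: "W' t \<le> - \<delta> * (W t)\<^sup>2" if t: "t \<ge> T" for t
  proof -
    have "W' t \<le> - (c * y t) + \<epsilon> * (C1 * y t - l\<^sub>0 / 2 * (\<rho> t) ^ 4)"
      unfolding W'_def using c(2)[OF rR[OF t]] y0[of t] F'b[OF t] \<epsilon>(1)
      by (intro add_mono mult_left_mono le_imp_neg_le mult_right_mono) auto
    also have "\<dots> = - (c * y t) + (\<epsilon> * C1) * y t - \<epsilon> * l\<^sub>0 / 2 * (\<rho> t) ^ 4"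
      by (simp add: algebra_simps)
    also have "\<dots> \<le> - (c / 2 * y t) - \<epsilon> * l\<^sub>0 / 2 * (\<rho> t) ^ 4"
      using mult_right_mono[OF \<epsilon>(2) y0[of t]] by simp
    finally have 1: "W' t \<le> - (c / 2 * y t + \<epsilon> * l\<^sub>0 / 2 * (\<rho> t) ^ 4)" by simp
    have yy: "y t * y t \<le> 2 * \<eta>\<^sup>2 * y t"
      using Eeq[OF t] ET[OF t] zero_le_power2[of "\<rho> t"] y0[of t] by (intro mult_right_mono) linarith+
    have "(W t)\<^sup>2 \<le> (3 / 2 * E t)\<^sup>2" using EW[OF t] by (intro power_mono) auto
    also have "\<dots> = 9 / 4 * (y t / 2 + (\<rho> t)\<^sup>2)\<^sup>2" 
      unfolding Eeq[OF t] power_mult_distrib by (simp add: power_divide)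
    also have "\<dots> \<le> 9 / 4 * (2 * ((y t / 2)\<^sup>2 + ((\<rho> t)\<^sup>2)\<^sup>2))"
    proof -
      have "0 \<le> (y t / 2 - (\<rho> t)\<^sup>2)\<^sup>2" by simp
      then have "(y t / 2 + (\<rho> t)\<^sup>2)\<^sup>2 \<le> 2 * ((y t / 2)\<^sup>2 + ((\<rho> t)\<^sup>2)\<^sup>2)"
        by (simp add: power2_sum power2_diff)
      then show ?thesis by simp
    qed
    also have "\<dots> = 9 / 8 * (y t * y t) + 9 / 2 * (\<rho> t) ^ 4"
      by (simp add: power2_eq_square power4_eq_xxxx field_simps)
    also have "\<dots> \<le> 9 / 4 * \<eta>\<^sup>2 * y t + 9 / 2 * (\<rho> t) ^ 4" using yy by (simp add: mult_ac)
    finally have WW: "(W t)\<^sup>2 \<le> 9 / 4 * \<eta>\<^sup>2 * y t + 9 / 2 * (\<rho> t) ^ 4" .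
    have "\<delta> * (W t)\<^sup>2 \<le> \<delta> * (9 / 4 * \<eta>\<^sup>2 * y t) + \<delta> * (9 / 2 * (\<rho> t) ^ 4)"
      using mult_left_mono[OF WW less_imp_le[OF \<delta>]] by (simp only: distrib_left)
    also have "\<dots> \<le> c / (9 * \<eta>\<^sup>2) * (9 / 4 * \<eta>\<^sup>2 * y t) + \<epsilon> * l\<^sub>0 / 18 * (9 / 2 * (\<rho> t) ^ 4)"
      using y0[of t] by (intro add_mono mult_right_mono) (auto simp: \<delta>_def)
    also have "\<dots> = c / 4 * y t + \<epsilon> * l\<^sub>0 / 4 * (\<rho> t) ^ 4" using \<eta>(1) by simp
    also have "\<dots> \<le> c / 2 * y t + \<epsilon> * l\<^sub>0 / 2 * (\<rho> t) ^ 4"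
      using c(1) y0[of t] \<epsilon>(1) l(1) by (intro add_mono mult_right_mono) auto
    finally show ?thesis using 1 by simp
  qed
  show ?thesis
  proof (rule that[OF T \<delta>])
    show "energy (x t) (v t) * (\<delta> * (t - T)) \<le> 2" if t: "t \<ge> T" for t
    proof -
      have "W t * (\<delta> * (t - T)) \<le> 1" by (rule riccati_decay[OF dW W'b t \<delta>])
      moreover have "E t * (\<delta> * (t - T)) \<le> (2 * W t) * (\<delta> * (t - T))"
        using EW(1)[OF t] \<delta> t by (intro mult_right_mono) auto
      ultimately show ?thesis by (simp add: E_def)
    qed
  qed (rule E)
qed

lemma flocking_rate:
  assumes tr: "trajectory x v" and lim: "((\<lambda>t. energy (x t) (v t)) \<longlongrightarrow> 0) at_top" and r01: "l\<^sub>1 < r\<^sub>0"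
  shows "\<exists>C>0. \<forall>t\<ge>0. infdist (norm (x t)) {l\<^sub>0..l\<^sub>1} + norm (v t) \<le> C / sqrt (1 + t)"
proof -
  obtain T \<delta> where T: "T \<ge> 0" "\<delta> > 0"
    "\<And>t. t \<ge> T \<Longrightarrow> energy (x t) (v t) * (\<delta> * (t - T)) \<le> 2"
    "\<And>t. t \<ge> T \<Longrightarrow> energy (x t) (v t) < (l\<^sub>0 / 2)\<^sup>2"
    by (rule energy_rate[OF assms]) (rule that)
  obtain M where M: "M > 0" "\<And>t. t \<ge> 0 \<Longrightarrow> infdist (norm (x t)) {l\<^sub>0..l\<^sub>1} + norm (v t) \<le> M"
    by (rule flocking_bounded[OF tr]) (rule that)
  \<comment> \<open>The first entry covers t <= 2 T + 1, where only the bound M is available. Later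
    t - T >= (1 + t) / 2, so the energy is at most 4 / (\<delta> (1 + t)), whence the second
    entry.\<close>
  define C where "C = max (M * sqrt (2 + 2 * T)) (3 * sqrt (4 / \<delta>))"
  have "infdist (norm (x t)) {l\<^sub>0..l\<^sub>1} + norm (v t) \<le> C / sqrt (1 + t)" if t: "t \<ge> 0" for t
  proof (cases "t \<le> 2 * T + 1")
    case True
    have "M * sqrt (1 + t) \<le> M * sqrt (2 + 2 * T)" using True M(1) by (intro mult_left_mono real_sqrt_le_mono) auto
    then have "M * sqrt (1 + t) \<le> C" by (simp add: C_def)
    then have "M \<le> C / sqrt (1 + t)" using t by (simp add: pos_le_divide_eq)
    then show ?thesis using M(2)[OF t] by linarith
  next
    case False
    then have tT: "t \<ge> T" "(1 + t) / 2 \<le> t - T" using T(1) by auto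
    have e0: "energy (x t) (v t) \<ge> 0" by (rule energy_nonneg)
    have "energy (x t) (v t) * (\<delta> * ((1 + t) / 2)) \<le> energy (x t) (v t) * (\<delta> * (t - T))"
      using tT(2) T(2) e0 by (intro mult_left_mono) auto
    then have "energy (x t) (v t) * (\<delta> * ((1 + t) / 2)) \<le> 2" using T(3)[OF tT(1)] by linarith
    then have "energy (x t) (v t) * (\<delta> * (1 + t)) \<le> 4" by simp
    then have "energy (x t) (v t) \<le> 4 / (\<delta> * (1 + t))" using T(2) t by (subst pos_le_divide_eq) auto
    then have "energy (x t) (v t) \<le> (4 / \<delta>) / (1 + t)" by simp
    then have "sqrt (energy (x t) (v t)) \<le> sqrt (4 / \<delta>) / sqrt (1 + t)"
      by (metis real_sqrt_divide real_sqrt_le_mono)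
    then have "infdist (norm (x t)) {l\<^sub>0..l\<^sub>1} + norm (v t) \<le> 3 * sqrt (4 / \<delta>) / sqrt (1 + t)"
      using flocking_bound_energy(1)[OF T(4)[OF tT(1)]] by simp
    also have "\<dots> \<le> C / sqrt (1 + t)"
      using t by (intro divide_right_mono) (auto simp: C_def)
    finally show ?thesis .
  qed
  moreover have "C > 0" using M(1) T(1) by (simp add: C_def less_max_iff_disj)
  ultimately show ?thesis by blast
qed

end

section \<open>The two-particle system\<close>

lemma test_function_bounded:
  assumes "test_function f"
  obtains M where "M \<ge> 0" "\<And>x. \<bar>f x\<bar> \<le> M"
proof -
  define S where "S = closure {x. f x \<noteq> 0}"
  have "continuous_on UNIV f"
    using assms by (auto simp: test_function_def smooth_on_def intro: Ck_on_continuous)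
  then have "continuous_on S f" by (rule continuous_on_subset) simp
  moreover have "compact S" using assms by (simp add: S_def test_function_def)
  ultimately have "bounded (f ` S)" by (intro compact_imp_bounded compact_continuous_image)
  then obtain M where M: "M > 0" "\<And>x. x \<in> S \<Longrightarrow> \<bar>f x\<bar> \<le> M"
    by (auto simp: bounded_pos)
  have "\<bar>f x\<bar> \<le> M" for x
  proof (cases "x \<in> S")
    case False
    then have "f x = 0" using closure_subset[of "{x. f x \<noteq> 0}"] by (auto simp: S_def)
    then show ?thesis using M(1) by simp
  qed (rule M(2))
  then show ?thesis using M(1) that[of M] by simp
qed

text \<open>The partial derivatives are again test functions, hence bounded.\<close>

lemma test_function_lipschitz:
  fixes f :: "'a::euclidean_space \<Rightarrow> real"
  assumes "test_function f"
  obtains L where "L-lipschitz_on UNIV f"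
proof -
  let ?D = "\<lambda>x. frechet_derivative f (at x)"
  have "\<exists>M\<ge>0. \<forall>x. \<bar>?D x b\<bar> \<le> M" if "b \<in> Basis" for b
    by (rule test_function_bounded[OF test_function_partial(1)[OF assms that]]) blast
  then obtain M where M: "\<And>b. b \<in> Basis \<Longrightarrow> M b \<ge> 0" "\<And>b x. b \<in> Basis \<Longrightarrow> \<bar>?D x b\<bar> \<le> M b"
    by metis
  have D: "(f has_derivative ?D x) (at x)" for x
    using assms by (intro smooth_on_has_derivative) (simp add: test_function_def)
  have "(\<Sum>b\<in>Basis. M b)-lipschitz_on UNIV f"
  proof (rule bounded_derivative_imp_lipschitz)
    show "(f has_derivative ?D x) (at x within UNIV)" for x using D by simp
    show "onorm (?D x) \<le> (\<Sum>b\<in>Basis. M b)" for x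
    proof (rule onorm_bound)
      fix h :: 'a
      have lin: "linear (?D x)" by (rule has_derivative_linear[OF D])
      have "?D x h = ?D x (\<Sum>b\<in>Basis. (h \<bullet> b) *\<^sub>R b)" by (simp add: euclidean_representation)
      also have "\<dots> = (\<Sum>b\<in>Basis. (h \<bullet> b) * ?D x b)"
        by (simp add: linear_sum[OF lin] linear_scale[OF lin])
      also have "\<bar>\<dots>\<bar> \<le> (\<Sum>b\<in>Basis. norm h * M b)"
      proof (rule order_trans[OF sum_abs], rule sum_mono)
        fix b :: 'a assume b: "b \<in> Basis"
        show "\<bar>(h \<bullet> b) * ?D x b\<bar> \<le> norm h * M b"
          unfolding abs_mult using Basis_le_norm[OF b, of h] M(2)[OF b, of x] by (intro mult_mono) auto
      qed
      also have "\<dots> = (\<Sum>b\<in>Basis. M b) * norm h" by (simp add: sum_distrib_left mult.commute)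
      finally show "norm (?D x h) \<le> (\<Sum>b\<in>Basis. M b) * norm h" by simp
    qed (intro sum_nonneg M(1))
  qed (auto intro: sum_nonneg M(1))
  then show ?thesis by (rule that)
qed

lemma comm_kernel_test_function:
  assumes "comm_kernel TYPE('n::finite) r\<^sub>0 l\<^sub>0 l\<^sub>1 p"
  shows "test_function (radial p :: real^'n \<Rightarrow> real)"
proof -
  have "{x::real^'n. radial p x \<noteq> 0} \<subseteq> ball 0 r\<^sub>0"
    using assms by (force simp: comm_kernel_def not_le)
  then have "bounded {x::real^'n. radial p x \<noteq> 0}" using bounded_ball bounded_subset by blast
  then show ?thesis using assms by (simp add: test_function_def comm_kernel_def)
qed

text \<open>A kernel that increases on \<open>[0, l\<^sub>0]\<close> from a positive value cannot vanish there.\<close>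

lemma comm_kernel_range:
  assumes "comm_kernel TYPE('n::finite) r\<^sub>0 l\<^sub>0 l\<^sub>1 p" "0 < r\<^sub>0" "0 < l\<^sub>0"
  shows "l\<^sub>0 < r\<^sub>0"
proof (rule ccontr)
  assume "\<not> l\<^sub>0 < r\<^sub>0"
  define \<phi> where "\<phi> = (radial p :: real^'n \<Rightarrow> real)"
  have \<phi>: "smooth_on UNIV \<phi>" "\<And>x. norm x < r\<^sub>0 \<Longrightarrow> \<phi> x > 0" "\<And>x. norm x \<ge> r\<^sub>0 \<Longrightarrow> \<phi> x = 0"
    "\<And>r. r \<in> {0..l\<^sub>0} \<Longrightarrow> vector_derivative p (at r within {0..}) \<ge> 0"
    using assms(1) by (auto simp: comm_kernel_def \<phi>_def)
  obtain b :: "real^'n" where b: "b \<in> Basis" using nonempty_Basis by blast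
  have pb: "\<phi> (s *\<^sub>R b) = p s" if "s \<ge> 0" for s using that b by (simp add: \<phi>_def radial_def)
  have dp: "(p has_real_derivative vector_derivative p (at s within {0..})) (at s within {0..})" if s: "s \<ge> 0" for s
  proof -
    have "((\<lambda>s. \<phi> (0 + s *\<^sub>R b)) has_real_derivative frechet_derivative \<phi> (at (0 + s *\<^sub>R b)) b) (at s)"
      by (rule partial_along_line[OF smooth_on_has_derivative[OF \<phi>(1)]])
    then have "((\<lambda>s. \<phi> (s *\<^sub>R b)) has_real_derivative frechet_derivative \<phi> (at (s *\<^sub>R b)) b) (at s within {0..})"
      using has_field_derivative_at_within by simp
    then have "(p has_real_derivative frechet_derivative \<phi> (at (s *\<^sub>R b)) b) (at s within {0..})"
      by (rule has_field_derivative_transform_within[OF _ zero_less_one]) (use s pb in auto)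
    then have "p differentiable (at s within {0..})"
      by (auto simp: has_field_derivative_def intro: differentiableI)
    then show ?thesis
      by (simp add: vector_derivative_works has_real_derivative_iff_has_vector_derivative)
  qed
  have "p 0 \<le> p l\<^sub>0"
    by (rule nondecreasing_if_deriv_nonneg[OF dp]) (use \<phi>(4) assms in auto)
  moreover have "p 0 > 0" using \<phi>(2)[of 0] pb[of 0] assms by simp
  moreover have "p l\<^sub>0 = 0" using \<phi>(3)[of "l\<^sub>0 *\<^sub>R b"] pb[of l\<^sub>0] assms b \<open>\<not> l\<^sub>0 < r\<^sub>0\<close> by simp
  ultimately show False by simp
qed

lemma GDERIV_unique: "GDERIV f x :> D \<Longrightarrow> GDERIV f x :> E \<Longrightarrow> D = E"
  using has_derivative_unique[of f "\<lambda>h. h \<bullet> D" x "\<lambda>h. h \<bullet> E"]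
  by (simp add: gderiv_def fun_eq_iff vector_eq_ldot)

lemma grad_eqI: "GDERIV f x :> D \<Longrightarrow> grad f x = D"
  unfolding grad_def by (rule the_equality) (auto intro: GDERIV_unique)

lemma damped_well_exists:
  fixes U \<phi> :: "real^'n::finite \<Rightarrow> real"
  assumes "r\<^sub>0 > 0" and l: "0 < l\<^sub>0" "l\<^sub>0 \<le> l\<^sub>1"
    and wp: "well_potential TYPE('n) l\<^sub>0 l\<^sub>1 u" and U: "U = radial u"
    and ck: "comm_kernel TYPE('n) r\<^sub>0 l\<^sub>0 l\<^sub>1 p" and \<phi>: "\<phi> = radial p"
  obtains w K P B where "damped_well \<phi> U (grad U) u w r\<^sub>0 l\<^sub>0 l\<^sub>1 K P B"
proof -
  have tf: "test_function \<phi>" unfolding \<phi> by (rule comm_kernel_test_function[OF ck])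
  have \<phi>p: "\<phi> x \<ge> 0" "norm x < r\<^sub>0 \<Longrightarrow> \<phi> x > 0" "norm x \<ge> r\<^sub>0 \<Longrightarrow> \<phi> x = 0" for x
    using ck by (auto simp: comm_kernel_def \<phi>)
  have "\<phi> 0 > 0" using \<phi>p(2)[of 0] assms(1) by simp
  obtain w K where w: "\<And>x::real^'n. GDERIV (radial u) x :> (w (norm x) / norm x) *\<^sub>R x"
    "K-lipschitz_on UNIV (\<lambda>x::real^'n. (w (norm x) / norm x) *\<^sub>R x)"
    "\<And>r. 0 < r \<Longrightarrow> r < l\<^sub>0 \<Longrightarrow> w r < 0"
    "\<And>r. l\<^sub>0 / 2 \<le> r \<Longrightarrow> w r = 2 * min (r - l\<^sub>0) 0 + 2 * max (r - l\<^sub>1) 0"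
    by (rule well_potential_gradient[OF l wp tf \<phi>p(1) \<open>\<phi> 0 > 0\<close>]) (rule that)
  obtain P where P: "P-lipschitz_on UNIV \<phi>" by (rule test_function_lipschitz[OF tf])
  obtain B where "B \<ge> 0" and B: "\<And>x. \<bar>\<phi> x\<bar> \<le> B"
    by (rule test_function_bounded[OF tf]) (rule that)
  have G: "grad U x = (w (norm x) / norm x) *\<^sub>R x" for x
    unfolding U by (rule grad_eqI[OF w(1)])
  have dec: "u s < u r" if "0 \<le> r" "r < s" "s \<le> l\<^sub>0 / 2" for r s
  proof -
    have "strict_antimono_on {0..l\<^sub>0 / 2} u" using wp by (simp add: well_potential_def)
    then show ?thesis using that by (auto simp: monotone_on_def)
  qed
  have uo: "u r = (min (r - l\<^sub>0) 0)\<^sup>2 + (max (r - l\<^sub>1) 0)\<^sup>2" if "l\<^sub>0 / 2 \<le> r" for r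
  proof -
    have v: "\<forall>r\<in>{l\<^sub>0/2..l\<^sub>0}. u r = \<bar>r - l\<^sub>0\<bar>\<^sup>2" "\<forall>r\<in>{l\<^sub>0..l\<^sub>1}. u r = 0" "\<forall>r\<ge>l\<^sub>1. u r = \<bar>r - l\<^sub>1\<bar>\<^sup>2"
      using wp by (auto simp: well_potential_def)
    consider "r \<le> l\<^sub>0" | "l\<^sub>0 \<le> r" "r \<le> l\<^sub>1" | "l\<^sub>1 \<le> r" "l\<^sub>0 \<le> r" using l by linarith
    then show ?thesis
      by cases (use v that l in \<open>auto simp: min_def max_def power2_commute[of l\<^sub>0]\<close>)
  qed
  have ui: "(l\<^sub>0 / 2)\<^sup>2 \<le> u r" if "0 \<le> r" "r \<le> l\<^sub>0 / 2" for r
  proof -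
    have "u (l\<^sub>0 / 2) = (l\<^sub>0 / 2)\<^sup>2" using uo[of "l\<^sub>0 / 2"] l by (simp add: power2_eq_square)
    then show ?thesis using dec[of r "l\<^sub>0 / 2"] that by (cases "r = l\<^sub>0 / 2") auto
  qed
  have um: "u r < u 0" if "0 < r" "r \<le> l\<^sub>0" for r
  proof (cases "r \<le> l\<^sub>0 / 2")
    case True
    then show ?thesis using dec[of 0 r] that by simp
  next
    case False
    have "u r = (l\<^sub>0 - r)\<^sup>2" using uo[of r] False that l by (simp add: power2_commute)
    also have "\<dots> \<le> (l\<^sub>0 / 2)\<^sup>2" using False that by (intro power_mono) auto
    also have "\<dots> \<le> u (l\<^sub>0 / 2)" using ui[of "l\<^sub>0 / 2"] l by simp
    also have "\<dots> < u 0" using dec[of 0 "l\<^sub>0 / 2"] l by simp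
    finally show ?thesis .
  qed
  have "damped_well \<phi> U (grad U) u w r\<^sub>0 l\<^sub>0 l\<^sub>1 K P B"
  proof
    show "l\<^sub>0 < r\<^sub>0" by (rule comm_kernel_range[OF ck assms(1) l(1)])
    show "U x = u (norm x)" for x by (simp add: U radial_def)
    show "GDERIV U x :> grad U x" for x unfolding G unfolding U by (rule w(1))
    have "grad U = (\<lambda>x. (w (norm x) / norm x) *\<^sub>R x)" by (rule ext) (rule G)
    then show "K-lipschitz_on UNIV (grad U)" by (simp only: w(2))
    show "\<phi> x \<le> B" for x using B[of x] by simp
    show "\<phi> (- x) = \<phi> x" for x by (simp add: \<phi> radial_def)
  qed (use l G P \<phi>p w uo ui um in auto)
  then show ?thesis by (rule that)
qed

section \<open>Null sets of two-particle states\<close>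

definition pair_vec :: "'b::zero \<Rightarrow> 'b \<Rightarrow> 'b^2" where
  "pair_vec a b = (\<chi> i. if i = 1 then a else b)"

lemma pair_vec_nth [simp]: "pair_vec a b $ 1 = a" "pair_vec a b $ 2 = b"
  by (simp_all add: pair_vec_def)

lemma vec_2_eq_iff: "(z::'b^2) = y \<longleftrightarrow> z $ 1 = y $ 1 \<and> z $ 2 = y $ 2"
  by (simp add: vec_eq_iff forall_2)

lemma bounded_linear_pair_vec:
  "bounded_linear (\<lambda>p::'b::euclidean_space \<times> 'b. pair_vec (fst p) (snd p))"
  by (rule linear_conv_bounded_linear[THEN iffD1])
    (auto intro!: linearI simp: vec_2_eq_iff)

text \<open>A state is determined by its relative coordinates and the second particle, so the set
  lies in a differentiable image of S \<times> R^(2n), whose dimension stays below the 4n of the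
  state space.\<close>

lemma negligible_relative_image:
  fixes h :: "'m::euclidean_space \<Rightarrow> (real^'n::finite) \<times> (real^'n)"
  assumes "h differentiable_on S" "DIM('m) < 2 * CARD('n)"
  shows "negligible {z :: 'n state. (rel_pos z, rel_vel z) \<in> h ` S}"
proof -
  define g where "g q = (pair_vec (fst (snd q) + fst (h (fst q))) (fst (snd q)),
      pair_vec (snd (snd q) + snd (h (fst q))) (snd (snd q)))" for q :: "'m \<times> (real^'n) \<times> (real^'n)"
  have "g differentiable_on S \<times> UNIV"
    unfolding differentiable_on_def
  proof
    fix q assume q: "q \<in> S \<times> (UNIV :: ((real^'n) \<times> (real^'n)) set)"
    then obtain D where "(h has_derivative D) (at (fst q) within S)"
      using assms(1) by (auto simp: differentiable_on_def differentiable_def)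
    then have D: "(h has_derivative D) (at (fst q) within fst ` (S \<times> (UNIV :: ((real^'n) \<times> (real^'n)) set)))"
      by simp
    have h: "((\<lambda>q. h (fst q)) has_derivative (\<lambda>d. D (fst d))) (at q within S \<times> UNIV)"
      using has_derivative_in_compose[OF has_derivative_fst[OF has_derivative_ident] D] by simp
    note pv = bounded_linear.has_derivative[OF bounded_linear_pair_vec]
    have 1: "((\<lambda>q. fst (snd q) + fst (h (fst q))) has_derivative (\<lambda>d. fst (snd d) + fst (D (fst d)))) (at q within S \<times> UNIV)"
      by (intro has_derivative_add has_derivative_fst has_derivative_snd has_derivative_ident h)
    have 2: "((\<lambda>q. snd (snd q) + snd (h (fst q))) has_derivative (\<lambda>d. snd (snd d) + snd (D (fst d)))) (at q within S \<times> UNIV)"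
      by (intro has_derivative_add has_derivative_fst has_derivative_snd has_derivative_ident h)
    have 3: "((\<lambda>q::'m \<times> (real^'n) \<times> (real^'n). fst (snd q)) has_derivative (\<lambda>d. fst (snd d))) (at q within S \<times> UNIV)"
      "((\<lambda>q::'m \<times> (real^'n) \<times> (real^'n). snd (snd q)) has_derivative (\<lambda>d. snd (snd d))) (at q within S \<times> UNIV)"
      by (intro has_derivative_fst has_derivative_snd has_derivative_ident)+
    have "(g has_derivative (\<lambda>d. (pair_vec (fst (snd d) + fst (D (fst d))) (fst (snd d)),
        pair_vec (snd (snd d) + snd (D (fst d))) (snd (snd d))))) (at q within S \<times> UNIV)"
      unfolding g_def[abs_def]
      using has_derivative_Pair[OF pv[OF has_derivative_Pair[OF 1 3(1)]] pv[OF has_derivative_Pair[OF 2 3(2)]]]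
      by simp
    then show "g differentiable (at q within S \<times> UNIV)" by (rule differentiableI)
  qed
  moreover have "DIM('m \<times> (real^'n) \<times> (real^'n)) < DIM('n state)"
    using assms(2) by simp
  ultimately have "negligible (g ` (S \<times> UNIV))"
    by (intro negligible_differentiable_image_lowdim)
  moreover have "{z :: 'n state. (rel_pos z, rel_vel z) \<in> h ` S} \<subseteq> g ` (S \<times> UNIV)"
  proof
    fix z :: "'n state" assume "z \<in> {z. (rel_pos z, rel_vel z) \<in> h ` S}"
    then obtain m where m: "m \<in> S" "h m = (rel_pos z, rel_vel z)" by auto
    have "z = g (m, fst z $ 2, snd z $ 2)"
      by (simp add: g_def m prod_eq_iff vec_2_eq_iff rel_pos_def rel_vel_def)
    then show "z \<in> g ` (S \<times> UNIV)" using m(1) by auto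
  qed
  ultimately show ?thesis using negligible_subset by blast
qed

text \<open>Parallel pairs have the form (x, s x) or, to include x = 0, (s v, v). These are n + 1
  parameters, fewer than 2n once n >= 2.\<close>

lemma negligible_parallel:
  assumes "CARD('n::finite) \<ge> 2"
  shows "negligible {z :: 'n state. \<forall>b\<in>Basis. \<forall>c\<in>Basis.
    (rel_pos z \<bullet> b) * (rel_vel z \<bullet> c) = (rel_pos z \<bullet> c) * (rel_vel z \<bullet> b)}"
proof -
  define h1 h2 where "h1 q = (fst q, snd q *\<^sub>R fst q)" and "h2 q = (snd q *\<^sub>R fst q, fst q)" for q :: "(real^'n) \<times> real"
  have d: "(\<lambda>q::(real^'n) \<times> real. snd q *\<^sub>R fst q) differentiable (at q within UNIV)"
    "(\<lambda>q::(real^'n) \<times> real. fst q) differentiable (at q within UNIV)" for q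
    by (rule differentiableI, (rule derivative_eq_intros refl | simp)+)+
  have pr: "(\<lambda>q. (f q, g q)) differentiable (at p)" if fg: "f differentiable (at p)" "g differentiable (at p)"
    for f g :: "(real^'n) \<times> real \<Rightarrow> real^'n" and p
  proof -
    obtain D E where "(f has_derivative D) (at p)" "(g has_derivative E) (at p)"
      using fg by (auto simp: differentiable_def)
    from has_derivative_Pair[OF this] show ?thesis by (rule differentiableI)
  qed
  have "h1 differentiable_on UNIV" "h2 differentiable_on UNIV"
    unfolding h1_def[abs_def] h2_def[abs_def] differentiable_on_def
    by (intro ballI pr d)+
  then have "negligible ({z :: 'n state. (rel_pos z, rel_vel z) \<in> h1 ` UNIV} \<union> {z. (rel_pos z, rel_vel z) \<in> h2 ` UNIV})"
    using assms by (intro negligible_Un negligible_relative_image) simp_all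
  moreover have "(x, v) \<in> h1 ` UNIV \<or> (x, v) \<in> h2 ` UNIV"
    if xv: "\<And>b c. b \<in> Basis \<Longrightarrow> c \<in> Basis \<Longrightarrow> (x \<bullet> b) * (v \<bullet> c) = (x \<bullet> c) * (v \<bullet> b)" for x v :: "real^'n"
  proof (cases "x = 0")
    case True
    then have "(x, v) = h2 (v, 0)" by (simp add: h2_def)
    then show ?thesis by blast
  next
    case False
    then obtain b where b: "b \<in> Basis" "x \<bullet> b \<noteq> 0" using euclidean_all_zero_iff[of x] by blast
    have "v = ((v \<bullet> b) / (x \<bullet> b)) *\<^sub>R x"
    proof (rule euclidean_eqI)
      fix c :: "real^'n" assume "c \<in> Basis"
      then show "v \<bullet> c = ((v \<bullet> b) / (x \<bullet> b)) *\<^sub>R x \<bullet> c"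
        using xv[OF b(1), of c] b(2) by (simp add: field_simps)
    qed
    then have "(x, v) = h1 (x, (v \<bullet> b) / (x \<bullet> b))" by (simp add: h1_def)
    then show ?thesis by blast
  qed
  ultimately show ?thesis
    by (elim negligible_subset) blast
qed

text \<open>The self-interaction terms vanish and the two halved forces are opposite: the difference
  of the particles feels the full force, and their sum moves uniformly.\<close>

lemma solution_relative_derivative:
  fixes z :: "real \<Rightarrow> 'n::finite state"
  assumes "is_solution \<phi> U z" "t \<ge> 0" and even: "\<And>x. \<phi> (- x) = \<phi> x"
    and G: "\<And>x. grad U (- x) = - grad U x" and G0: "grad U 0 = 0"
  shows "((\<lambda>s. rel_pos (z s)) has_vector_derivative rel_vel (z t)) (at t within {0..})"
    and "((\<lambda>s. rel_vel (z s)) has_vector_derivative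
      - (\<phi> (rel_pos (z t)) *\<^sub>R rel_vel (z t)) - grad U (rel_pos (z t))) (at t within {0..})"
    and "((\<lambda>s. fst (z s) $ 1 + fst (z s) $ 2) has_vector_derivative snd (z t) $ 1 + snd (z t) $ 2) (at t within {0..})"
    and "((\<lambda>s. snd (z s) $ 1 + snd (z s) $ 2) has_vector_derivative 0) (at t within {0..})"
proof -
  define X V where "X = rel_pos (z t)" and "V = rel_vel (z t)"
  have x: "((\<lambda>s. fst (z s) $ i) has_vector_derivative snd (z t) $ i) (at t within {0..})" for i
    using assms(1,2) by (simp add: is_solution_def Let_def)
  have v: "((\<lambda>s. snd (z s) $ i) has_vector_derivative
        (1/2) *\<^sub>R (\<Sum>j\<in>UNIV. \<phi> (fst (z t) $ i - fst (z t) $ j) *\<^sub>R (snd (z t) $ j - snd (z t) $ i))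
        - (1/2) *\<^sub>R (\<Sum>j\<in>UNIV. grad U (fst (z t) $ i - fst (z t) $ j))) (at t within {0..})" for i
    using assms(1,2) by (simp add: is_solution_def Let_def)
  have n: "fst (z t) $ 2 - fst (z t) $ 1 = - X" "snd (z t) $ 2 - snd (z t) $ 1 = - V"
    "fst (z t) $ 1 - fst (z t) $ 2 = X" "snd (z t) $ 1 - snd (z t) $ 2 = V"
    by (simp_all add: X_def V_def rel_pos_def rel_vel_def)
  have v1: "((\<lambda>s. snd (z s) $ 1) has_vector_derivative
      (1/2) *\<^sub>R (- (\<phi> X *\<^sub>R V) - grad U X)) (at t within {0..})"
    using v[of 1] unfolding sum_2 n by (simp add: G0 scaleR_diff_right)
  have v2: "((\<lambda>s. snd (z s) $ 2) has_vector_derivative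
      - ((1/2) *\<^sub>R (- (\<phi> X *\<^sub>R V) - grad U X))) (at t within {0..})"
    using v[of 2] unfolding sum_2 n by (simp add: G0 even G scaleR_diff_right add.commute)
  show "((\<lambda>s. rel_pos (z s)) has_vector_derivative rel_vel (z t)) (at t within {0..})"
    unfolding rel_pos_def rel_vel_def by (intro has_vector_derivative_diff x)
  have "((\<lambda>s. rel_vel (z s)) has_vector_derivative
      (1/2) *\<^sub>R (- (\<phi> X *\<^sub>R V) - grad U X) - - ((1/2) *\<^sub>R (- (\<phi> X *\<^sub>R V) - grad U X))) (at t within {0..})"
    unfolding rel_vel_def by (rule has_vector_derivative_diff[OF v1 v2])
  moreover have "(1/2) *\<^sub>R (- (\<phi> X *\<^sub>R V) - grad U X) - - ((1/2) *\<^sub>R (- (\<phi> X *\<^sub>R V) - grad U X)) = - (\<phi> X *\<^sub>R V) - grad U X"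
    by (simp flip: scaleR_left_distrib)
  ultimately show "((\<lambda>s. rel_vel (z s)) has_vector_derivative
      - (\<phi> (rel_pos (z t)) *\<^sub>R rel_vel (z t)) - grad U (rel_pos (z t))) (at t within {0..})"
    by (simp add: X_def V_def)
  show "((\<lambda>s. fst (z s) $ 1 + fst (z s) $ 2) has_vector_derivative snd (z t) $ 1 + snd (z t) $ 2) (at t within {0..})"
    by (intro has_vector_derivative_add x)
  show "((\<lambda>s. snd (z s) $ 1 + snd (z s) $ 2) has_vector_derivative 0) (at t within {0..})"
    using has_vector_derivative_add[OF v1 v2] by simp
qed

text \<open>\<open>flow\<close> is a definite description, so it takes both existence and uniqueness
  to evaluate it. A solution is assembled from the relative trajectory and a centre of mass c in
  uniform motion; any other solution has the same relative part and the same sum of positions and of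
  velocities.\<close>

lemma flow_relative_trajectory:
  fixes U \<phi> :: "real^'n::finite \<Rightarrow> real"
  assumes "damped_well \<phi> U (grad U) u w r\<^sub>0 l\<^sub>0 l\<^sub>1 K P B"
  obtains x v where "damped_well.trajectory \<phi> (grad U) x v" "x 0 = rel_pos z\<^sub>0" "v 0 = rel_vel z\<^sub>0"
    "\<And>t. t \<ge> 0 \<Longrightarrow> rel_pos (flow \<phi> U z\<^sub>0 t) = x t" "\<And>t. t \<ge> 0 \<Longrightarrow> rel_vel (flow \<phi> U z\<^sub>0 t) = v t"
proof -
  interpret damped_well \<phi> U "grad U" u w r\<^sub>0 l\<^sub>0 l\<^sub>1 K P B by (rule assms)
  have G: "grad U (- x) = - grad U x" for x using G_eq[of x] G_eq[of "- x"] by simp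
  have G0: "grad U 0 = 0" using G_eq[of 0] by simp
  obtain x v where xv: "trajectory x v" "x 0 = rel_pos z\<^sub>0" "v 0 = rel_vel z\<^sub>0" by (rule trajectory_exists)
  define c where "c t = (1/2) *\<^sub>R (fst z\<^sub>0 $ 1 + fst z\<^sub>0 $ 2) + t *\<^sub>R ((1/2) *\<^sub>R (snd z\<^sub>0 $ 1 + snd z\<^sub>0 $ 2))" for t
  define m where "m = (1/2) *\<^sub>R (snd z\<^sub>0 $ 1 + snd z\<^sub>0 $ 2)"
  define z where "z t = (pair_vec (c t + (1/2) *\<^sub>R x t) (c t - (1/2) *\<^sub>R x t),
      pair_vec (m + (1/2) *\<^sub>R v t) (m - (1/2) *\<^sub>R v t))" for t
  have half: "(1/2) *\<^sub>R a + (1/2) *\<^sub>R a = a" for a :: "real^'n" by (simp flip: scaleR_left_distrib)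
  have rel: "rel_pos (z t) = x t" "rel_vel (z t) = v t" for t
    by (simp_all add: z_def rel_pos_def rel_vel_def half)
  have z0: "z 0 = z\<^sub>0"
  proof -
    have "(1/2) *\<^sub>R (a + b) + (1/2) *\<^sub>R (a - b) = a" "(1/2) *\<^sub>R (a + b) - (1/2) *\<^sub>R (a - b) = b" for a b :: "real^'n"
      by (simp_all add: scaleR_add_right scaleR_diff_right half)
    then show ?thesis
      by (simp add: z_def c_def m_def xv(2,3) rel_pos_def rel_vel_def prod_eq_iff vec_2_eq_iff)
  qed
  have sol: "is_solution \<phi> U z"
    unfolding is_solution_def Let_def
  proof (intro allI impI)
    fix t :: real and i :: 2 assume t: "0 \<le> t"
    note D = trajectoryD[OF xv(1) t]
    have c: "(c has_vector_derivative m) (at t within {0..})"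
      unfolding c_def[abs_def] m_def by (auto intro!: derivative_eq_intros)
    have h: "((\<lambda>s. (1/2) *\<^sub>R x s) has_vector_derivative (1/2) *\<^sub>R v t) (at t within {0..})"
      "((\<lambda>s. (1/2) *\<^sub>R v s) has_vector_derivative (1/2) *\<^sub>R (- (\<phi> (x t) *\<^sub>R v t) - grad U (x t))) (at t within {0..})"
      by (intro bounded_linear.has_vector_derivative[OF bounded_linear_scaleR_right] D)+
    note hm = has_vector_derivative_const[of m]
    have n: "c t + (1/2) *\<^sub>R x t - (c t - (1/2) *\<^sub>R x t) = x t" "c t - (1/2) *\<^sub>R x t - (c t + (1/2) *\<^sub>R x t) = - x t"
      "m + (1/2) *\<^sub>R v t - (m - (1/2) *\<^sub>R v t) = v t" "m - (1/2) *\<^sub>R v t - (m + (1/2) *\<^sub>R v t) = - v t"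
      using half[of "x t"] half[of "v t"] by (simp_all add: algebra_simps)
    show "((\<lambda>s. fst (z s) $ i) has_vector_derivative snd (z t) $ i) (at t within {0..}) \<and>
        ((\<lambda>s. snd (z s) $ i) has_vector_derivative
          (1/2) *\<^sub>R (\<Sum>j\<in>UNIV. \<phi> (fst (z t) $ i - fst (z t) $ j) *\<^sub>R (snd (z t) $ j - snd (z t) $ i))
          - (1/2) *\<^sub>R (\<Sum>j\<in>UNIV. grad U (fst (z t) $ i - fst (z t) $ j))) (at t within {0..})"
      using exhaust_2[of i]
    proof (elim disjE)
      assume i: "i = 1"
      show ?thesis
        using has_vector_derivative_add[OF c h(1)] has_vector_derivative_add[OF hm h(2)]
        unfolding i z_def fst_conv snd_conv pair_vec_nth sum_2 n
        by (simp add: G0 scaleR_diff_right)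
    next
      assume i: "i = 2"
      show ?thesis
        using has_vector_derivative_diff[OF c h(1)] has_vector_derivative_diff[OF hm h(2)]
        unfolding i z_def fst_conv snd_conv pair_vec_nth sum_2 n
        by (simp add: G0 G \<phi>_even scaleR_diff_right add.commute)
    qed
  qed
  have uniq: "y t = z t" if y: "is_solution \<phi> U y" "y 0 = z\<^sub>0" and t: "t \<ge> 0" for y t
  proof -
    note dy = solution_relative_derivative[OF y(1) _ \<phi>_even G G0]
    note dz = solution_relative_derivative[OF sol _ \<phi>_even G G0]
    have "trajectory (\<lambda>t. rel_pos (y t)) (\<lambda>t. rel_vel (y t))"
      unfolding trajectory_def using dy(1,2) by blast
    then have r: "rel_pos (y t) = x t" "rel_vel (y t) = v t"
      using trajectory_unique_forward[OF _ xv(1), of "\<lambda>t. rel_pos (y t)" "\<lambda>t. rel_vel (y t)" t] xv(2,3) y(2) t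
      by simp_all
    have V: "snd (y s) $ 1 + snd (y s) $ 2 = snd z\<^sub>0 $ 1 + snd z\<^sub>0 $ 2"
      "snd (z s) $ 1 + snd (z s) $ 2 = snd z\<^sub>0 $ 1 + snd z\<^sub>0 $ 2" if "s \<ge> 0" for s
      using constant_if_deriv_zero[of 0 "\<lambda>s. snd (y s) $ 1 + snd (y s) $ 2" s, OF dy(4) that] y(2)
        constant_if_deriv_zero[of 0 "\<lambda>s. snd (z s) $ 1 + snd (z s) $ 2" s, OF dz(4) that] z0
      by simp_all
    have "((\<lambda>s. (fst (y s) $ 1 + fst (y s) $ 2) - (fst (z s) $ 1 + fst (z s) $ 2)) has_vector_derivative 0) (at s within {0..})"
      if s: "s \<ge> 0" for s
      using has_vector_derivative_diff[OF dy(3)[OF s] dz(3)[OF s]] V[OF s] by simp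
    from constant_if_deriv_zero[OF this t]
    have X: "fst (y t) $ 1 + fst (y t) $ 2 = fst (z t) $ 1 + fst (z t) $ 2"
      using y(2) z0 by simp
    have two: "a = b" if "a + a = b + b" for a b :: "real^'n"
      using that by (metis half scaleR_add_right)
    have eq: "a $ 1 = b $ 1 \<and> a $ 2 = b $ 2" if "a $ 1 - a $ 2 = b $ 1 - b $ 2" "a $ 1 + a $ 2 = b $ 1 + b $ 2"
      for a b :: "real^'n^2"
    proof -
      have "a $ 1 + a $ 1 = (a $ 1 - a $ 2) + (a $ 1 + a $ 2)" by simp
      also have "\<dots> = b $ 1 + b $ 1" unfolding that by simp
      finally have "a $ 1 = b $ 1" by (rule two)
      then show ?thesis using that(2) by simp
    qed
    show "y t = z t"
      using eq[of "fst (y t)" "fst (z t)"] eq[of "snd (y t)" "snd (z t)"] r rel[of t] X V[OF t]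
      by (simp add: prod_eq_iff vec_2_eq_iff rel_pos_def rel_vel_def)
  qed
  have flow: "flow \<phi> U z\<^sub>0 t = z t" if "t \<ge> 0" for t
    unfolding flow_def
  proof (rule the_equality)
    show "\<exists>y. is_solution \<phi> U y \<and> y 0 = z\<^sub>0 \<and> y t = z t" using sol z0 by blast
    show "y = z t" if "\<exists>y'. is_solution \<phi> U y' \<and> y' 0 = z\<^sub>0 \<and> y' t = y" for y
      using that uniq \<open>t \<ge> 0\<close> by blast
  qed
  show ?thesis by (rule that[OF xv]) (simp_all add: flow rel)
qed

lemma AE_lebesgue_not_in_negligible:
  assumes "negligible N"
  shows "AE x in lebesgue. x \<notin> N"
  using assms by (intro AE_not_in) (simp add: negligible_iff_null_sets)

lemma negligible_sink_data:
  fixes U \<phi> :: "real^'n::finite \<Rightarrow> real"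
  assumes "damped_well \<phi> U (grad U) u w r\<^sub>0 l\<^sub>0 l\<^sub>1 K P B"
  shows "negligible {z :: 'n state. \<exists>x v. damped_well.sink \<phi> (grad U) x v \<and> x 0 = rel_pos z \<and> v 0 = rel_vel z}"
    (is "negligible ?N")
proof -
  interpret damped_well \<phi> U "grad U" u w r\<^sub>0 l\<^sub>0 l\<^sub>1 K P B by (rule assms)
  show ?thesis
  proof (cases "CARD('n) \<ge> 2")
    case True
    have "?N \<subseteq> {z. \<forall>b\<in>Basis. \<forall>c\<in>Basis.
        (rel_pos z \<bullet> b) * (rel_vel z \<bullet> c) = (rel_pos z \<bullet> c) * (rel_vel z \<bullet> b)}"
      using angular_momentum_zero_if_tendsto_zero[OF sinkD(1,2)] by force
    then show ?thesis by (rule negligible_subset[OF negligible_parallel[OF True]])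
  next
    case False
    have "CARD('n) > 0" by simp
    then have card: "CARD('n) = 1" using False by linarith
    then have "DIM(real^'n) = 1" by simp
    then obtain D where D: "countable D" "\<And>y z. (y, z) \<in> D \<Longrightarrow> trajectory y z"
      "\<And>x v. sink x v \<Longrightarrow> \<exists>p\<in>D. (x 0, v 0) \<in> orbit p"
      by (rule sinks_countable_orbits) (rule that)
    have "negligible {z :: 'n state. (rel_pos z, rel_vel z) \<in> orbit p}" if p: "p \<in> D" for p
      unfolding orbit_def
    proof (rule negligible_relative_image)
      have "trajectory (fst p) (snd p)" using D(2)[of "fst p" "snd p"] p by simp
      note d = trajectoryD[OF this]
      show "(\<lambda>t. (fst p t, snd p t)) differentiable_on {0..}"
        unfolding differentiable_on_def
      proof
        fix t :: real assume "t \<in> {0..}"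
        then have "t \<ge> 0" by simp
        from has_derivative_Pair[OF d(1)[OF this, unfolded has_vector_derivative_def] d(2)[OF this, unfolded has_vector_derivative_def]]
        show "(\<lambda>t. (fst p t, snd p t)) differentiable (at t within {0..})"
          by (rule differentiableI)
      qed
      show "DIM(real) < 2 * CARD('n)" by (simp add: card)
    qed
    then have "negligible (\<Union>p\<in>D. {z :: 'n state. (rel_pos z, rel_vel z) \<in> orbit p})"
      using D(1) by (intro negligible_countable_Union) auto
    moreover have "?N \<subseteq> (\<Union>p\<in>D. {z. (rel_pos z, rel_vel z) \<in> orbit p})"
    proof
      fix z :: "'n state" assume "z \<in> ?N"
      then obtain x v where "sink x v" "x 0 = rel_pos z" "v 0 = rel_vel z" by blast
      then show "z \<in> (\<Union>p\<in>D. {z. (rel_pos z, rel_vel z) \<in> orbit p})" using D(3)[of x v] by auto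
    qed
    ultimately show ?thesis by (rule negligible_subset)
  qed
qed

text \<open>A positive limit of the energy would force x -> 0 and equal U 0, and then the kinetic
  energy would tend to 0 as well.\<close>

lemma (in damped_well) energy_tendsto_zero_unless_sink:
  assumes "trajectory x v" "t\<^sub>0 \<ge> 0" "norm (x t\<^sub>0) < r\<^sub>0" "\<not> sink x v"
  shows "((\<lambda>t. energy (x t) (v t)) \<longlongrightarrow> 0) at_top"
proof -
  obtain e where e: "((\<lambda>t. energy (x t) (v t)) \<longlongrightarrow> e) at_top" "e \<ge> 0"
    by (rule energy_limit[OF assms(1)]) (rule that)
  have "e = 0"
  proof (rule ccontr)
    assume "e \<noteq> 0"
    then have "e > 0" using e(2) by simp
    note rest = positive_energy_limit_imp_rest[OF assms(1) e(1) this assms(2,3)]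
    have "sink x v"
      by (rule energy_limit_rest_imp_sink[OF assms(1) rest(1)]) (use e(1) rest(2) in simp)
    then show False using assms(4) by simp
  qed
  then show ?thesis using e(1) by simp
qed

theorem corollary4p7:
  fixes r\<^sub>0 l\<^sub>0 l\<^sub>1 :: real and u p :: "real \<Rightarrow> real"
    and U \<phi> :: "real^'n::finite \<Rightarrow> real"
  assumes "r\<^sub>0 > 0" and "0 < l\<^sub>0" and "l\<^sub>0 \<le> l\<^sub>1"
    and "well_potential TYPE('n) l\<^sub>0 l\<^sub>1 u" and "U = radial u"
    and "comm_kernel TYPE('n) r\<^sub>0 l\<^sub>0 l\<^sub>1 p" and "\<phi> = radial p"
  shows
    "(AE z\<^sub>0 in lebesgue. z\<^sub>0 \<notin> noninteracting \<phi> U r\<^sub>0 \<longrightarrow>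
       ((\<lambda>t. flocking_defect l\<^sub>0 l\<^sub>1 (flow \<phi> U z\<^sub>0 t)) \<longlongrightarrow> 0) at_top) \<and>
     (r\<^sub>0 > l\<^sub>1 \<longrightarrow> (AE z\<^sub>0 in lebesgue. z\<^sub>0 \<notin> noninteracting \<phi> U r\<^sub>0 \<longrightarrow>
       (\<exists>C>0. \<forall>t\<ge>0. flocking_defect l\<^sub>0 l\<^sub>1 (flow \<phi> U z\<^sub>0 t) \<le> C / sqrt (1 + t)))) \<and>
     (AE z\<^sub>0 in lebesgue. norm (rel_pos z\<^sub>0) < r\<^sub>0 \<longrightarrow>
       ((\<lambda>t. flocking_defect l\<^sub>0 l\<^sub>1 (flow \<phi> U z\<^sub>0 t)) \<longlongrightarrow> 0) at_top) \<and>
     (r\<^sub>0 > l\<^sub>1 \<longrightarrow> (AE z\<^sub>0 in lebesgue. norm (rel_pos z\<^sub>0) < r\<^sub>0 \<longrightarrow>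
       (\<exists>C>0. \<forall>t\<ge>0. flocking_defect l\<^sub>0 l\<^sub>1 (flow \<phi> U z\<^sub>0 t) \<le> C / sqrt (1 + t))))"
proof -
  obtain w K P B where dw: "damped_well \<phi> U (grad U) u w r\<^sub>0 l\<^sub>0 l\<^sub>1 K P B"
    by (rule damped_well_exists[OF assms]) (rule that)
  interpret damped_well \<phi> U "grad U" u w r\<^sub>0 l\<^sub>0 l\<^sub>1 K P B by (rule dw)
  \<comment> \<open>One exceptional set, the data attracted to the unstable rest point, serves all
    four assertions.\<close>
  define N where "N = {z :: 'n state. \<exists>x v. sink x v \<and> x 0 = rel_pos z \<and> v 0 = rel_vel z}"
  have "negligible N" unfolding N_def by (rule negligible_sink_data[OF dw])
  then have AE: "AE z in lebesgue. z \<notin> N" by (rule AE_lebesgue_not_in_negligible)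
  have main: "((\<lambda>t. flocking_defect l\<^sub>0 l\<^sub>1 (flow \<phi> U z\<^sub>0 t)) \<longlongrightarrow> 0) at_top"
    "l\<^sub>1 < r\<^sub>0 \<Longrightarrow> \<exists>C>0. \<forall>t\<ge>0. flocking_defect l\<^sub>0 l\<^sub>1 (flow \<phi> U z\<^sub>0 t) \<le> C / sqrt (1 + t)"
    if z0: "z\<^sub>0 \<notin> N" "z\<^sub>0 \<notin> noninteracting \<phi> U r\<^sub>0" for z\<^sub>0 :: "'n state"
  proof -
    obtain x v where xv: "trajectory x v" "x 0 = rel_pos z\<^sub>0" "v 0 = rel_vel z\<^sub>0"
      "\<And>t. t \<ge> 0 \<Longrightarrow> rel_pos (flow \<phi> U z\<^sub>0 t) = x t" "\<And>t. t \<ge> 0 \<Longrightarrow> rel_vel (flow \<phi> U z\<^sub>0 t) = v t"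
      by (rule flow_relative_trajectory[OF dw]) (rule that)
    have defect: "flocking_defect l\<^sub>0 l\<^sub>1 (flow \<phi> U z\<^sub>0 t) = infdist (norm (x t)) {l\<^sub>0..l\<^sub>1} + norm (v t)"
      if "t \<ge> 0" for t
      by (simp add: flocking_defect_def xv(4,5)[OF that])
    obtain t\<^sub>0 where t0: "t\<^sub>0 \<ge> 0" "norm (x t\<^sub>0) < r\<^sub>0"
      using z0(2) xv(4) by (auto simp: noninteracting_def not_le)
    have "\<not> sink x v" using z0(1) xv(2,3) by (auto simp: N_def)
    then have E: "((\<lambda>t. energy (x t) (v t)) \<longlongrightarrow> 0) at_top"
      by (rule energy_tendsto_zero_unless_sink[OF xv(1) t0])
    have "\<forall>\<^sub>F t in at_top. infdist (norm (x t)) {l\<^sub>0..l\<^sub>1} + norm (v t) = flocking_defect l\<^sub>0 l\<^sub>1 (flow \<phi> U z\<^sub>0 t)"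
      by (rule eventually_at_top_linorderI[of 0]) (simp add: defect)
    from Lim_transform_eventually[OF flocking_tendsto[OF xv(1) E] this]
    show "((\<lambda>t. flocking_defect l\<^sub>0 l\<^sub>1 (flow \<phi> U z\<^sub>0 t)) \<longlongrightarrow> 0) at_top" .
    show "\<exists>C>0. \<forall>t\<ge>0. flocking_defect l\<^sub>0 l\<^sub>1 (flow \<phi> U z\<^sub>0 t) \<le> C / sqrt (1 + t)" if "l\<^sub>1 < r\<^sub>0"
      using flocking_rate[OF xv(1) E that] defect by simp
  qed
  have init: "z\<^sub>0 \<notin> noninteracting \<phi> U r\<^sub>0" if close: "norm (rel_pos z\<^sub>0) < r\<^sub>0" for z\<^sub>0 :: "'n state"
  proof -
    obtain x v where "x 0 = rel_pos z\<^sub>0" "\<And>t. t \<ge> 0 \<Longrightarrow> rel_pos (flow \<phi> U z\<^sub>0 t) = x t"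
      by (rule flow_relative_trajectory[OF dw, of z\<^sub>0]) (rule that)
    then have "norm (rel_pos (flow \<phi> U z\<^sub>0 0)) < r\<^sub>0" using close by simp
    then show ?thesis by (force simp: noninteracting_def)
  qed
  show ?thesis
  proof (intro conjI impI)
    show "AE z\<^sub>0 in lebesgue. z\<^sub>0 \<notin> noninteracting \<phi> U r\<^sub>0 \<longrightarrow>
        ((\<lambda>t. flocking_defect l\<^sub>0 l\<^sub>1 (flow \<phi> U z\<^sub>0 t)) \<longlongrightarrow> 0) at_top"
      using AE by eventually_elim (intro impI main(1))
    show "AE z\<^sub>0 in lebesgue. norm (rel_pos z\<^sub>0) < r\<^sub>0 \<longrightarrow>
        ((\<lambda>t. flocking_defect l\<^sub>0 l\<^sub>1 (flow \<phi> U z\<^sub>0 t)) \<longlongrightarrow> 0) at_top"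
      using AE by eventually_elim (intro impI main(1) init)
    assume r: "l\<^sub>1 < r\<^sub>0"
    show "AE z\<^sub>0 in lebesgue. z\<^sub>0 \<notin> noninteracting \<phi> U r\<^sub>0 \<longrightarrow>
        (\<exists>C>0. \<forall>t\<ge>0. flocking_defect l\<^sub>0 l\<^sub>1 (flow \<phi> U z\<^sub>0 t) \<le> C / sqrt (1 + t))"
      using AE by eventually_elim (intro impI main(2) r)
    show "AE z\<^sub>0 in lebesgue. norm (rel_pos z\<^sub>0) < r\<^sub>0 \<longrightarrow>
        (\<exists>C>0. \<forall>t\<ge>0. flocking_defect l\<^sub>0 l\<^sub>1 (flow \<phi> U z\<^sub>0 t) \<le> C / sqrt (1 + t))"
      using AE by eventually_elim (intro impI main(2) init r)
  qed
qed

end
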